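(* For $j=1,2$ let $\varepsilon_j,\mu_j:\mathbf{R}\to(0,\infty)$ be piecewise continuous, $1$-periodic and even, and let $\mathcal{L}_j\psi=-\frac{1}{\varepsilon_j(x)}\frac{d}{dx}\left(\frac{1}{\mu_j(x)}\frac{d\psi}{dx}\right)$. Define the glued operator $\tilde{\mathcal{L}}\psi=\mathcal{L}_1\psi$ for $x<0$ and $\tilde{\mathcal{L}}\psi=\mathcal{L}_2\psi$ for $x>0$. Assume: (i) there are positive integers $m_1,m_2$ such that the common band gap $I:=(E_{m_1}^{(1),+},E_{m_1+1}^{(1),-})\cap(E_{m_2}^{(2),+},E_{m_2+1}^{(2),-})$ is nonempty (with $E_{m_j}^{(j),+}<E_{m_j+1}^{(j),-}$); (ii) the bulk indices differ: $\gamma_{m_1}^{(1)}\neq\gamma_{m_2}^{(2)}$. Then there exists a unique interface mode of $\tilde{\mathcal{L}}$ with energy in $I$: there is exactly one $E\in I$ for which $\tilde{\mathcal{L}}$ has an interface mode at energy $E$.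
   Context: For each operator $\mathcal{L}_j$ (coefficients $\varepsilon_j,\mu_j$) and $k\in[-\pi,\pi]$, let $V_k=\{u\in AC[0,1]: u(1)=e^{ik}u(0),\ \frac{u'}{\mu_j}\in AC[0,1],\ \frac{u'(1)}{\mu_j(1)}=e^{ik}\frac{u'(0)}{\mu_j(0)}\}$; the self-adjoint problem $\mathcal{L}_j\psi=E\psi$ in $V_k$ (inner product $\int_0^1\varepsilon_j\bar u v$) has eigenvalues $E^{(j)}_1(k)\le E^{(j)}_2(k)\le\cdots$, and $E_m^{(j),-}=\min_kE_m^{(j)}(k)$, $E_m^{(j),+}=\max_kE_m^{(j)}(k)$. When $E_m^{(j),+}<E_{m+1}^{(j),-}$, the maximum $E_m^{(j),+}$ is attained at some $k^*\in\{0,\pi\}$ and the corresponding eigenspace in $V_{k^*}$ is one-dimensional, spanned by a real function whose extension to $\mathbf{R}$ via $u(x+n)=e^{ik^*n}u(x)$ (the Bloch mode) is either even or odd. The bulk index $\gamma_m^{(j)}\in\{+1,-1\}$ is defined as $+1$ if this Bloch mode at $E_m^{(j),+}$ is even and $-1$ if it is odd. An interface mode of $\tilde{\mathcal{L}}$ at energy $E\in\mathbf{R}$ is a nonzero $\psi\in L^2(\mathbf{R})$ such that $\psi$ and $\psi'/\tilde\mu$ are locally absolutely continuous on $\mathbf{R}$ (where $\tilde\mu=\mu_1$ on $x<0$, $\tilde\mu=\mu_2$ on $x>0$) and $(\tilde{\mathcal{L}}-E)\psi=0$. *)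

theory Defs
  imports "HOL-Analysis.Analysis"
begin

definition piecewise_cont :: "(real \<Rightarrow> real) \<Rightarrow> bool" where
  "piecewise_cont f \<longleftrightarrow>
     (\<forall>a b. finite {x \<in> {a..b}. \<not> isCont f x}) \<and>
     (\<forall>x. (\<exists>l. (f \<longlongrightarrow> l) (at_left x)) \<and> (\<exists>l. (f \<longlongrightarrow> l) (at_right x)))"

definition abs_cont_on :: "real \<Rightarrow> real \<Rightarrow> (real \<Rightarrow> 'a::real_normed_vector) \<Rightarrow> bool" where
  "abs_cont_on a b f \<longleftrightarrow>
     (\<forall>e>0. \<exists>d>0. \<forall>(n::nat) (x::nat \<Rightarrow> real) (y::nat \<Rightarrow> real).
        (\<forall>i<n. a \<le> x i \<and> x i \<le> y i \<and> y i \<le> b) \<and>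
        (\<forall>i<n. \<forall>j<n. i \<noteq> j \<longrightarrow> y i \<le> x j \<or> y j \<le> x i) \<and>
        (\<Sum>i<n. y i - x i) < d
        \<longrightarrow> (\<Sum>i<n. norm (f (y i) - f (x i))) < e)"

text \<open>u solves  -(1/eps) (u'/mu)' = E u  on [a,b]:  u is AC, q is an AC function with
  q = u'/mu a.e. (i.e. u' = mu q a.e.), and -(1/eps) q' = E u a.e. (i.e. q' = - E eps u a.e.).\<close>
definition sl_solution ::
  "(real \<Rightarrow> real) \<Rightarrow> (real \<Rightarrow> real) \<Rightarrow> real \<Rightarrow> real \<Rightarrow> real \<Rightarrow>
   (real \<Rightarrow> complex) \<Rightarrow> (real \<Rightarrow> complex) \<Rightarrow> bool" where
  "sl_solution eps mu E a b u q \<longleftrightarrow>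
     abs_cont_on a b u \<and> abs_cont_on a b q \<and>
     (AE x in lborel. x \<in> {a..b} \<longrightarrow>
        (u has_vector_derivative (complex_of_real (mu x) * q x)) (at x)) \<and>
     (AE x in lborel. x \<in> {a..b} \<longrightarrow>
        (q has_vector_derivative (- complex_of_real (E * eps x) * u x)) (at x))"

definition eigsp :: "(real \<Rightarrow> real) \<Rightarrow> (real \<Rightarrow> real) \<Rightarrow> real \<Rightarrow> real \<Rightarrow> (real \<Rightarrow> complex) set" where
  "eigsp eps mu k E = {u. \<exists>q. sl_solution eps mu E 0 1 u q \<and>
       u 1 = cis k * u 0 \<and> q 1 = cis k * q 0}"

definition mult :: "(real \<Rightarrow> real) \<Rightarrow> (real \<Rightarrow> real) \<Rightarrow> real \<Rightarrow> real \<Rightarrow> nat" where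
  "mult eps mu k E = (GREATEST n. \<exists>v::nat \<Rightarrow> real \<Rightarrow> complex.
       (\<forall>i<n. v i \<in> eigsp eps mu k E) \<and>
       (\<forall>c::nat \<Rightarrow> complex. (\<forall>x\<in>{0..1}. (\<Sum>i<n. c i * v i x) = 0) \<longrightarrow> (\<forall>i<n. c i = 0)))"

definition eig_count :: "(real \<Rightarrow> real) \<Rightarrow> (real \<Rightarrow> real) \<Rightarrow> real \<Rightarrow> real \<Rightarrow> nat" where
  "eig_count eps mu k E = (\<Sum>l \<in> {l. l \<le> E \<and> 0 < mult eps mu k l}. mult eps mu k l)"

text \<open>E_m(k): the m-th eigenvalue (m \<ge> 1), counted with multiplicity, in increasing order.\<close>
definition band :: "(real \<Rightarrow> real) \<Rightarrow> (real \<Rightarrow> real) \<Rightarrow> nat \<Rightarrow> real \<Rightarrow> real" where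
  "band eps mu m k = Inf {E. m \<le> eig_count eps mu k E}"

definition band_min :: "(real \<Rightarrow> real) \<Rightarrow> (real \<Rightarrow> real) \<Rightarrow> nat \<Rightarrow> real" where
  "band_min eps mu m = (INF k\<in>{-pi..pi}. band eps mu m k)"

definition band_max :: "(real \<Rightarrow> real) \<Rightarrow> (real \<Rightarrow> real) \<Rightarrow> nat \<Rightarrow> real" where
  "band_max eps mu m = (SUP k\<in>{-pi..pi}. band eps mu m k)"

definition bloch_ext :: "real \<Rightarrow> (real \<Rightarrow> complex) \<Rightarrow> real \<Rightarrow> complex" where
  "bloch_ext k u x = cis (k * of_int \<lfloor>x\<rfloor>) * u (x - of_int \<lfloor>x\<rfloor>)"

text \<open>Bulk index: +1 if the Bloch mode at the top E_m^+ of the m-th band (attained at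
  k* \<in> {0, pi}) is even, -1 otherwise (i.e. odd).\<close>
definition bulk_index :: "(real \<Rightarrow> real) \<Rightarrow> (real \<Rightarrow> real) \<Rightarrow> nat \<Rightarrow> int" where
  "bulk_index eps mu m =
     (if \<exists>k\<in>{0, pi}. band eps mu m k = band_max eps mu m \<and>
          (\<exists>u\<in>eigsp eps mu k (band_max eps mu m).
             (\<exists>x\<in>{0..1}. u x \<noteq> 0) \<and> (\<forall>x. bloch_ext k u (- x) = bloch_ext k u x))
      then 1 else -1)"

definition glue :: "(real \<Rightarrow> real) \<Rightarrow> (real \<Rightarrow> real) \<Rightarrow> real \<Rightarrow> real" where
  "glue f g x = (if x < 0 then f x else g x)"

definition interface_mode ::
  "(real \<Rightarrow> real) \<Rightarrow> (real \<Rightarrow> real) \<Rightarrow> (real \<Rightarrow> real) \<Rightarrow> (real \<Rightarrow> real) \<Rightarrow>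
   real \<Rightarrow> (real \<Rightarrow> complex) \<Rightarrow> bool" where
  "interface_mode eps1 mu1 eps2 mu2 E \<psi> \<longleftrightarrow>
     (\<exists>x. \<psi> x \<noteq> 0) \<and>
     (\<lambda>x. (cmod (\<psi> x))\<^sup>2) integrable_on UNIV \<and>
     (\<exists>q. \<forall>a b. sl_solution (glue eps1 eps2) (glue mu1 mu2) E a b \<psi> q)"

end

theory Submission
  imports Defs
begin

text \<open>
  Let \<open>D, b, s\<close> denote the diagonal, lower left and upper right entries of the monodromy matrix over
  one period, with \<open>D\<^sup>2 - b s = 1\<close>. The eigenvalues at quasimomentum \<open>k\<close> are the solutions
  of \<open>D = cos k\<close>, so a gap is an interval with \<open>\<bar>D\<bar> > 1\<close>, that is \<open>b s > 0\<close>, and exactly one of \<open>b, s\<close>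
  vanishes at each of its ends. The Bloch mode at the lower end is even iff \<open>b = 0\<close> there. The solution
  decaying at \<open>+\<infinity>\<close> has \<open>(u'/\<mu>)(0) / u(0) = \<plusminus> sqrt (b / s)\<close>, with sign \<open>+\<close> in the even case and \<open>-\<close> in the
  odd one; by reflection an interface mode exists iff these ratios of the two media add up to \<open>0\<close>. Since
  the derivatives in \<open>E\<close> of \<open>D, b, s\<close> are quadratic integrals of the fundamental system, \<open>b / s\<close> is
  strictly monotone across a gap, increasing from \<open>0\<close> to \<open>\<infinity>\<close> in the even case and decreasing from
  \<open>\<infinity>\<close> to \<open>0\<close> in the odd case. Two media of different index therefore have exactly one crossing.
\<close>

section \<open>Absolutely continuous functions\<close>

text \<open>The definitions ask for absolutely continuous \<open>u\<close> and \<open>q\<close> with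
  equations almost everywhere, and bands are infima of a counting function. Two obstacles follow. A
  fundamental theorem for absolutely continuous functions, proved with gauges, upgrades the
  equations to genuine derivatives at every continuity point of the coefficients, hence off a finite
  set in a bounded interval; after that the argument is classical. And the infima, suprema, greatest
  elements and sums of the definitions carry information only if, for each quasimomentum, the
  eigenvalues are infinitely many but finitely many below each bound. Finiteness comes from the
  derivatives of D, b, s at an accumulation point, infinitude from a Pruefer angle that grows at
  least like a multiple of sqrt E. All derivatives in E come from an exact formula, given by
  Lagrange's identity, for the difference of the fundamental systems at two energies. Evenness
  enters through the map x -> 1 - x, which sends solutions to solutions and thereby makes both
  diagonal entries of the monodromy matrix equal.\<close>

lemma straddle_estimate:
  fixes f :: "real \<Rightarrow> 'a::real_normed_vector"
  assumes "(f has_vector_derivative g) (at x)" "0 < e"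
  obtains d where "0 < d"
    "\<And>u v. u \<le> x \<Longrightarrow> x \<le> v \<Longrightarrow> \<bar>u - x\<bar> < d \<Longrightarrow> \<bar>v - x\<bar> < d \<Longrightarrow>
       norm ((v - u) *\<^sub>R g - (f v - f u)) \<le> e * (v - u)"
proof -
  from assms obtain d where d: "0 < d"
    "\<And>y. norm (y - x) < d \<Longrightarrow> norm (f y - f x - (y - x) *\<^sub>R g) \<le> e * norm (y - x)"
    unfolding has_vector_derivative_def has_derivative_at_alt by blast
  show ?thesis
  proof (rule that[OF d(1)])
    fix u v assume uv: "u \<le> x" "x \<le> v" "\<bar>u - x\<bar> < d" "\<bar>v - x\<bar> < d"
    \<comment> \<open>The tag x lies between u and v, so the two one-sided errors add up to exactly
      e times the length of the interval.\<close>
    have "norm ((v - u) *\<^sub>R g - (f v - f u)) =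
       norm ((f u - f x - (u - x) *\<^sub>R g) - (f v - f x - (v - x) *\<^sub>R g))"
      by (simp add: algebra_simps)
    also have "\<dots> \<le> norm (f u - f x - (u - x) *\<^sub>R g) + norm (f v - f x - (v - x) *\<^sub>R g)"
      by (rule norm_triangle_ineq4)
    also have "\<dots> \<le> e * norm (u - x) + e * norm (v - x)"
      using d(2)[of u] d(2)[of v] uv by (intro add_mono) auto
    also have "\<dots> = e * (v - u)" using uv by (simp add: algebra_simps)
    finally show "norm ((v - u) *\<^sub>R g - (f v - f u)) \<le> e * (v - u)" .
  qed
qed

text \<open>Bridge between the finite families of intervals in \<open>abs_cont_on\<close>, indexed
  by natural numbers and ordered by their end points, and the tagged divisions of gauge integration,
  whose intervals merely have disjoint interiors.\<close>

lemma abs_cont_on_partial_division_sum: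
  fixes f :: "real \<Rightarrow> 'a::real_normed_vector"
  assumes p: "p tagged_partial_division_of {a..b}"
    and sub: "\<And>x k. (x, k) \<in> p \<Longrightarrow> k \<subseteq> U"
    and U: "U \<in> lmeasurable" "measure lebesgue U < d"
    and d: "\<forall>(n::nat) (x::nat \<Rightarrow> real) (y::nat \<Rightarrow> real).
        (\<forall>i<n. a \<le> x i \<and> x i \<le> y i \<and> y i \<le> b) \<and>
        (\<forall>i<n. \<forall>j<n. i \<noteq> j \<longrightarrow> y i \<le> x j \<or> y j \<le> x i) \<and>
        (\<Sum>i<n. y i - x i) < d
        \<longrightarrow> (\<Sum>i<n. norm (f (y i) - f (x i))) < e"
  shows "(\<Sum>(x,k)\<in>p. norm (f (Sup k) - f (Inf k))) < e"
proof -
  \<comment> \<open>Degenerate intervals are dropped: they add nothing to the sum, but their empty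
    interiors would say nothing about how they lie relative to the other intervals.\<close>
  define p' where "p' = {xk \<in> p. Inf (snd xk) < (Sup (snd xk) :: real)}"
  have fin: "finite p" using p by (rule tagged_partial_division_ofD)
  have p'sub: "p' \<subseteq> p" by (auto simp: p'_def)
  have p': "p' tagged_partial_division_of {a..b}"
    using tagged_partial_division_subset[OF p p'sub] .
  have fin': "finite p'" using fin p'sub finite_subset by blast
  have iv: "\<exists>u v. k = {u..v} \<and> Inf k = u \<and> Sup k = v \<and> u \<le> v \<and> a \<le> u \<and> v \<le> b"
    if "(x, k) \<in> p" for x k
  proof -
    from tagged_partial_division_ofD(4)[OF p that] obtain u v where k: "k = {u..v}" by auto
    have "x \<in> k" "k \<subseteq> {a..b}" using tagged_partial_division_ofD(2,3)[OF p that] by auto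
    with k have "u \<le> v" "a \<le> u" "v \<le> b" by auto
    with k show ?thesis by auto
  qed
  have len: "measure lebesgue k = Sup k - Inf k" if "(x, k) \<in> p" for x k
    using iv[OF that] by force
  have disj: "Sup k \<le> Inf k' \<or> Sup k' \<le> Inf k"
    if "(x, k) \<in> p'" "(x', k') \<in> p'" "(x, k) \<noteq> (x', k')" for x k x' k'
  proof -
    have kk: "(x, k) \<in> p" "(x', k') \<in> p" using that p'sub by auto
    from iv[OF kk(1)] iv[OF kk(2)] obtain u v u' v' where
      k: "k = {u..v}" "Inf k = u" "Sup k = v" and k': "k' = {u'..v'}" "Inf k' = u'" "Sup k' = v'"
      by blast
    have lt: "u < v" "u' < v'" using that k k' by (auto simp: p'_def)
    have "{u<..<v} \<inter> {u'<..<v'} = {}"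
      using tagged_partial_division_ofD(5)[OF p kk that(3)] k k' by (simp add: interior_atLeastAtMost_real)
    moreover have "(max u u' + min v v') / 2 \<in> {u<..<v} \<inter> {u'<..<v'}" if "max u u' < min v v'"
      using that by auto
    ultimately have "\<not> max u u' < min v v'" by blast
    then show ?thesis using lt k k' by auto
  qed
  have inj: "inj_on snd p'"
  proof (rule inj_onI)
    fix z z' assume z: "z \<in> p'" "z' \<in> p'" "snd z = snd z'"
    show "z = z'"
    proof (rule ccontr)
      assume "z \<noteq> z'"
      with disj[of "fst z" "snd z" "fst z'" "snd z'"] z(1,2) have
        "Sup (snd z) \<le> Inf (snd z') \<or> Sup (snd z') \<le> Inf (snd z)" by (simp add: prod_eq_iff)
      with z show False by (auto simp: p'_def)
    qed
  qed
  have div: "snd ` p' division_of \<Union>(snd ` p')"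
    using division_of_tagged_division[OF tagged_partial_division_of_Union_self[OF p']] .
  have "(\<Sum>(x,k)\<in>p'. Sup k - Inf k) = (\<Sum>(x,k)\<in>p'. measure lebesgue k)"
    using len p'sub by (intro sum.cong) auto
  also have "\<dots> = sum (measure lebesgue) (snd ` p')"
    by (simp add: sum.reindex[OF inj] case_prod_beta)
  also have "\<dots> = measure lebesgue (\<Union>(snd ` p'))"
    using content_division[OF div] by simp
  also have "\<dots> \<le> measure lebesgue U"
    using sub p'sub U(1) div lmeasurable_division[OF div] by (intro measure_mono_fmeasurable) (force simp: fmeasurableD)+
  also have "\<dots> < d" by fact
  finally have lt: "(\<Sum>(x,k)\<in>p'. Sup k - Inf k) < d" .
  obtain h where h: "bij_betw h {..<card p'} p'"
    using ex_bij_betw_nat_finite[OF fin'] by (auto simp: atLeast0LessThan)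
  have hin: "h i \<in> p'" if "i < card p'" for i using h that by (auto simp: bij_betw_def)
  have hne: "h i \<noteq> h j" if "i < card p'" "j < card p'" "i \<noteq> j" for i j
    using h that by (auto simp: bij_betw_def inj_on_def)
  have "(\<Sum>i<card p'. norm (f (Sup (snd (h i))) - f (Inf (snd (h i))))) < e"
  proof (rule d[rule_format], intro conjI allI impI)
    fix i assume "i < card p'"
    with hin p'sub have "(fst (h i), snd (h i)) \<in> p" by auto
    from iv[OF this] show "a \<le> Inf (snd (h i))" "Inf (snd (h i)) \<le> Sup (snd (h i))"
      "Sup (snd (h i)) \<le> b" by auto
  next
    fix i j assume "i < card p'" "j < card p'" "i \<noteq> j"
    then show "Sup (snd (h i)) \<le> Inf (snd (h j)) \<or> Sup (snd (h j)) \<le> Inf (snd (h i))"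
      using disj[of "fst (h i)" "snd (h i)" "fst (h j)" "snd (h j)"] hin hne by auto
  next
    show "(\<Sum>i<card p'. Sup (snd (h i)) - Inf (snd (h i))) < d"
      using lt sum.reindex_bij_betw[OF h, of "\<lambda>(x,k). Sup k - Inf k"] by (simp add: case_prod_beta)
  qed
  also have "(\<Sum>i<card p'. norm (f (Sup (snd (h i))) - f (Inf (snd (h i))))) =
     (\<Sum>(x,k)\<in>p'. norm (f (Sup k) - f (Inf k)))"
    using sum.reindex_bij_betw[OF h, of "\<lambda>(x,k). norm (f (Sup k) - f (Inf k))"]
    by (simp add: case_prod_beta)
  also have "\<dots> = (\<Sum>(x,k)\<in>p. norm (f (Sup k) - f (Inf k)))"
  proof (rule sum.mono_neutral_left[OF fin p'sub], clarify)
    fix x k assume "(x, k) \<in> p" "(x, k) \<notin> p'"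
    with iv[of x k] show "norm (f (Sup k) - f (Inf k)) = 0"
      by (force simp: p'_def)
  qed
  finally show ?thesis .
qed

text \<open>Henstock's argument. Where the derivative exists, the straddle estimate controls each
  increment. The exceptional null set N is covered by an open U of measure below the d of absolute
  continuity, so the intervals tagged in N contribute a small total increment. The integrand is set
  to 0 on N, which leaves the integral unchanged.\<close>

theorem abs_cont_on_fundamental_theorem:
  fixes f :: "real \<Rightarrow> 'a::real_normed_vector"
  assumes ab: "a \<le> b" and ac: "abs_cont_on a b f"
    and ae: "AE x in lborel. x \<in> {a..b} \<longrightarrow> (f has_vector_derivative g x) (at x)"
  shows "(g has_integral (f b - f a)) {a..b}"
proof -
  from ae obtain N where N: "{x. \<not> (x \<in> {a..b} \<longrightarrow> (f has_vector_derivative g x) (at x))} \<subseteq> N"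
    "N \<in> null_sets lborel" by (auto elim!: AE_E simp: null_sets_def)
  have negN: "negligible N"
    using N(2) null_sets_completionI negligible_iff_null_sets by blast
  define g' where "g' x = (if x \<in> N then 0 else g x)" for x
  have "(g' has_integral (f b - f a)) (cbox a b)"
    unfolding has_integral
  proof (intro allI impI)
    fix e :: real assume e: "0 < e"
    \<comment> \<open>The summand 1 keeps the denominator positive when a = b; the factor 2 leaves
      the other half of e for the tags in N.\<close>
    define e' where "e' = e / (2 * (b - a + 1))"
    have e': "0 < e'" "e' * (b - a) \<le> e / 2" using e ab by (auto simp: e'_def field_simps)
    have "\<exists>d>0. \<forall>(n::nat) (x::nat \<Rightarrow> real) (y::nat \<Rightarrow> real).
        (\<forall>i<n. a \<le> x i \<and> x i \<le> y i \<and> y i \<le> b) \<and>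
        (\<forall>i<n. \<forall>j<n. i \<noteq> j \<longrightarrow> y i \<le> x j \<or> y j \<le> x i) \<and>
        (\<Sum>i<n. y i - x i) < d \<longrightarrow> (\<Sum>i<n. norm (f (y i) - f (x i))) < e / 2" (is "\<exists>d>0. ?P d")
      using ac[unfolded abs_cont_on_def, THEN spec, of "e / 2"] e by (simp only: half_gt_zero simp_thms)
    then obtain d where d: "0 < d" "?P d" by (elim exE conjE) (rule that)
    have "N \<in> sets lebesgue" using negN by (simp add: negligible_imp_sets)
    from sets_lebesgue_outer_open[OF this d(1)] obtain U where U: "open U" "N \<subseteq> U"
      "U - N \<in> lmeasurable" "emeasure lebesgue (U - N) < ennreal d" .
    have UN: "U = (U - N) \<union> N" using U(2) by blast
    have Um: "U \<in> lmeasurable" "measure lebesgue U = measure lebesgue (U - N)"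
    proof -
      have "(U - N) \<union> N \<in> lmeasurable"
        using U(3) negN by (intro fmeasurable.Un) (auto simp: negligible_imp_measurable)
      then show "U \<in> lmeasurable" using UN by simp
      then show "measure lebesgue U = measure lebesgue (U - N)"
        using negN by (metis measure_Diff_null_set fmeasurableD negligible_iff_null_sets)
    qed
    have Ud: "measure lebesgue U < d"
      using U(3,4) Um(2) d(1) by (simp add: emeasure_eq_measure2 ennreal_less_iff)
    have "\<exists>dl>0. \<forall>u v. u \<le> x \<longrightarrow> x \<le> v \<longrightarrow> \<bar>u - x\<bar> < dl \<longrightarrow> \<bar>v - x\<bar> < dl \<longrightarrow>
       norm ((v - u) *\<^sub>R g x - (f v - f u)) \<le> e' * (v - u)" if "x \<in> {a..b} - N" for x
    proof -
      have "(f has_vector_derivative g x) (at x)" using that N(1) by auto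
      from straddle_estimate[OF this e'(1)] show ?thesis by metis
    qed
    then obtain dl where dl: "\<And>x. x \<in> {a..b} - N \<Longrightarrow> dl x > 0"
       "\<And>x u v. x \<in> {a..b} - N \<Longrightarrow> u \<le> x \<Longrightarrow> x \<le> v \<Longrightarrow> \<bar>u - x\<bar> < dl x \<Longrightarrow> \<bar>v - x\<bar> < dl x \<Longrightarrow>
       norm ((v - u) *\<^sub>R g x - (f v - f u)) \<le> e' * (v - u)" by metis
    \<comment> \<open>The neighbourhood of a tag in N is all of U, so every interval tagged in N
      lies in U. The unit ball is a default value for points outside \<open>{a..b}\<close>.\<close>
    define \<gamma> where "\<gamma> x = (if x \<in> N then U else if x \<in> {a..b} then ball x (dl x) else ball x 1)" for x
    have gauge: "gauge \<gamma>" using U(1,2) dl(1) by (auto simp: gauge_def \<gamma>_def)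
    have est: "norm ((\<Sum>(x,k)\<in>p. measure lborel k *\<^sub>R g' x) - (f b - f a)) < e"
      if p: "p tagged_division_of cbox a b" and fine: "\<gamma> fine p" for p
    proof -
      have p': "p tagged_division_of {a..b}" using p by simp
      have fin: "finite p" using p by auto
      have iv: "\<exists>u v. k = {u..v} \<and> Inf k = u \<and> Sup k = v \<and> u \<le> x \<and> x \<le> v \<and> x \<in> {a..b}"
        if "(x, k) \<in> p" for x k
      proof -
        from tagged_division_ofD(4)[OF p' that] obtain u v where k: "k = {u..v}" by auto
        have "x \<in> k" "k \<subseteq> {a..b}" using tagged_division_ofD(2,3)[OF p' that] by auto
        with k show ?thesis by auto
      qed
      have eq: "(\<Sum>(x,k)\<in>p. f (Sup k) - f (Inf k)) = f b - f a"
        using additive_tagged_division_1[OF ab p'] .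
      define pN where "pN = {xk \<in> p. fst xk \<in> N}"
      have pN: "pN \<subseteq> p" by (auto simp: pN_def)
      have "(\<Sum>(x,k)\<in>p. measure lborel k *\<^sub>R g' x) - (f b - f a) =
        (\<Sum>(x,k)\<in>p. measure lborel k *\<^sub>R g' x - (f (Sup k) - f (Inf k)))"
        by (simp add: eq[symmetric] sum_subtractf case_prod_beta)
      also have "\<dots> = (\<Sum>(x,k)\<in>p - pN. measure lborel k *\<^sub>R g' x - (f (Sup k) - f (Inf k)))
          + (\<Sum>(x,k)\<in>pN. measure lborel k *\<^sub>R g' x - (f (Sup k) - f (Inf k)))"
        by (rule sum.subset_diff[OF pN fin])
      also have "norm \<dots> < e"
      proof -
        have "norm (\<Sum>(x,k)\<in>p - pN. measure lborel k *\<^sub>R g' x - (f (Sup k) - f (Inf k)))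
            \<le> (\<Sum>(x,k)\<in>p - pN. e' * measure lborel k)"
        proof (rule sum_norm_le, clarify)
          fix x k assume xk: "(x, k) \<in> p" "(x, k) \<notin> pN"
          then have xN: "x \<notin> N" by (auto simp: pN_def)
          from iv[OF xk(1)] obtain u v where k: "k = {u..v}" "Inf k = u" "Sup k = v" "u \<le> x" "x \<le> v"
            "x \<in> {a..b}" by blast
          have "k \<subseteq> ball x (dl x)" using fineD[OF fine xk(1)] k(6) xN by (simp add: \<gamma>_def)
          moreover have "u \<in> k" "v \<in> k" using k by auto
          ultimately have "u \<in> ball x (dl x)" "v \<in> ball x (dl x)" by blast+
          then have "\<bar>u - x\<bar> < dl x" "\<bar>v - x\<bar> < dl x"
            unfolding mem_ball dist_real_def by linarith+
          with dl(2)[of x u v] k xN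
          show "norm (measure lborel k *\<^sub>R g' x - (f (Sup k) - f (Inf k))) \<le> e' * measure lborel k"
            by (auto simp: g'_def)
        qed
        also have "\<dots> \<le> (\<Sum>(x,k)\<in>p. e' * measure lborel k)"
          using e'(1) fin by (intro sum_mono2) auto
        also have "\<dots> = e' * (b - a)"
          using additive_content_tagged_division[OF p] ab
          by (simp add: sum_distrib_left[symmetric] case_prod_beta)
        finally have 1: "norm (\<Sum>(x,k)\<in>p - pN. measure lborel k *\<^sub>R g' x - (f (Sup k) - f (Inf k))) \<le> e / 2"
          using e'(2) by linarith
        have "norm (\<Sum>(x,k)\<in>pN. measure lborel k *\<^sub>R g' x - (f (Sup k) - f (Inf k)))
            \<le> (\<Sum>(x,k)\<in>pN. norm (f (Sup k) - f (Inf k)))"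
        proof (rule sum_norm_le, clarify)
          fix x k assume "(x, k) \<in> pN"
          then have "g' x = 0" by (auto simp: pN_def g'_def)
          then show "norm (measure lborel k *\<^sub>R g' x - (f (Sup k) - f (Inf k))) \<le> norm (f (Sup k) - f (Inf k))"
            by (simp add: norm_minus_commute)
        qed
        also have "\<dots> < e / 2"
        proof (rule abs_cont_on_partial_division_sum[OF _ _ Um(1) Ud d(2)])
          show "pN tagged_partial_division_of {a..b}"
            using tagged_partial_division_subset[OF _ pN] p' by (auto simp: tagged_division_of_def)
          show "k \<subseteq> U" if "(x, k) \<in> pN" for x k
            using that fineD[OF fine, of x k] by (simp add: pN_def \<gamma>_def)
        qed
        finally have "norm (\<Sum>(x,k)\<in>pN. measure lborel k *\<^sub>R g' x - (f (Sup k) - f (Inf k))) < e / 2" .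
        from add_le_less_mono[OF 1 this] show ?thesis
          by (intro norm_triangle_lt) (simp only: field_sum_of_halves)
      qed
      finally show ?thesis .
    qed
    show "\<exists>\<gamma>. gauge \<gamma> \<and> (\<forall>p. p tagged_division_of cbox a b \<and> \<gamma> fine p \<longrightarrow>
        norm ((\<Sum>(x,k)\<in>p. measure lborel k *\<^sub>R g' x) - (f b - f a)) < e)"
      using gauge est by (intro exI[of _ \<gamma>] conjI allI impI) (simp_all only: simp_thms)
  qed
  then have "(g' has_integral (f b - f a)) {a..b}" by simp
  then show ?thesis
    by (rule has_integral_spike[OF negN, rotated]) (auto simp: g'_def)
qed

lemma abs_cont_on_imp_continuous_on:
  fixes f :: "real \<Rightarrow> 'a::real_normed_vector"
  assumes "abs_cont_on a b f"
  shows "continuous_on {a..b} f"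
  unfolding continuous_on_iff
proof (intro ballI allI impI)
  fix x e :: real assume x: "x \<in> {a..b}" and e: "0 < e"
  have "\<exists>d>0. \<forall>(n::nat) (x::nat \<Rightarrow> real) (y::nat \<Rightarrow> real).
        (\<forall>i<n. a \<le> x i \<and> x i \<le> y i \<and> y i \<le> b) \<and>
        (\<forall>i<n. \<forall>j<n. i \<noteq> j \<longrightarrow> y i \<le> x j \<or> y j \<le> x i) \<and>
        (\<Sum>i<n. y i - x i) < d \<longrightarrow> (\<Sum>i<n. norm (f (y i) - f (x i))) < e" (is "\<exists>d>0. ?P d")
    using assms[unfolded abs_cont_on_def, THEN spec, of e] e by (simp only: simp_thms)
  then obtain d where d: "0 < d" "?P d" by (elim exE conjE) (rule that)
  have "dist (f y) (f x) < e" if "y \<in> {a..b}" "dist y x < d" for y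
  proof -
    have "(\<Sum>i<1::nat. norm (f (max x y) - f (min x y))) < e"
      by (rule d(2)[rule_format]) (use x that in \<open>auto simp: dist_real_def\<close>)
    then show ?thesis by (auto simp: max_def min_def dist_norm norm_minus_commute split: if_splits)
  qed
  with d(1) show "\<exists>d>0. \<forall>y\<in>{a..b}. dist y x < d \<longrightarrow> dist (f y) (f x) < e" by blast
qed

lemma abs_cont_on_lipschitz:
  fixes f :: "real \<Rightarrow> 'a::real_normed_vector"
  assumes "0 \<le> L" "\<And>x y. a \<le> x \<Longrightarrow> x \<le> y \<Longrightarrow> y \<le> b \<Longrightarrow> norm (f y - f x) \<le> L * (y - x)"
  shows "abs_cont_on a b f"
  unfolding abs_cont_on_def
proof (intro allI impI)
  fix e :: real assume e: "0 < e"
  show "\<exists>d>0. \<forall>(n::nat) (x::nat \<Rightarrow> real) (y::nat \<Rightarrow> real).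
        (\<forall>i<n. a \<le> x i \<and> x i \<le> y i \<and> y i \<le> b) \<and>
        (\<forall>i<n. \<forall>j<n. i \<noteq> j \<longrightarrow> y i \<le> x j \<or> y j \<le> x i) \<and>
        (\<Sum>i<n. y i - x i) < d \<longrightarrow> (\<Sum>i<n. norm (f (y i) - f (x i))) < e"
  proof (intro exI conjI allI impI; (elim conjE)?)
    show "0 < e / (L + 1)" using e assms(1) by simp
    fix n :: nat and x y :: "nat \<Rightarrow> real"
    assume *: "\<forall>i<n. a \<le> x i \<and> x i \<le> y i \<and> y i \<le> b" "(\<Sum>i<n. y i - x i) < e / (L + 1)"
    have "(\<Sum>i<n. norm (f (y i) - f (x i))) \<le> (\<Sum>i<n. L * (y i - x i))"
      using * assms(2) by (intro sum_mono) auto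
    also have "\<dots> = L * (\<Sum>i<n. y i - x i)" by (simp add: sum_distrib_left)
    also have "\<dots> \<le> L * (e / (L + 1))" using * assms(1) by (intro mult_left_mono) auto
    also have "\<dots> < e" using e assms(1) by (simp add: field_simps)
    finally show "(\<Sum>i<n. norm (f (y i) - f (x i))) < e" .
  qed
qed

section \<open>Classical solutions\<close>

text \<open>This form is shared by a piecewise continuous coefficient and by the glue of two of
  them. Finitely many jumps give derivatives off a finite set, boundedness gives the Lipschitz
  estimates that lead back to absolute continuity.\<close>

definition regular_on :: "real \<Rightarrow> real \<Rightarrow> (real \<Rightarrow> real) \<Rightarrow> bool" where
  "regular_on a b f \<longleftrightarrow> finite {x \<in> {a<..<b}. \<not> isCont f x} \<and> (\<exists>K. \<forall>x\<in>{a..b}. \<bar>f x\<bar> \<le> K)"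

text \<open>The equation is imposed off a finite set only, which is where piecewise continuous
  coefficients may jump.\<close>

definition csol ::
  "(real \<Rightarrow> real) \<Rightarrow> (real \<Rightarrow> real) \<Rightarrow> real \<Rightarrow> real \<Rightarrow> real \<Rightarrow>
   (real \<Rightarrow> 'a::real_normed_vector) \<Rightarrow> (real \<Rightarrow> 'a) \<Rightarrow> bool" where
  "csol eps mu E a b u q \<longleftrightarrow>
     continuous_on {a..b} u \<and> continuous_on {a..b} q \<and>
     (\<exists>S. finite S \<and> (\<forall>x\<in>{a<..<b} - S.
        (u has_vector_derivative mu x *\<^sub>R q x) (at x) \<and>
        (q has_vector_derivative (- E * eps x) *\<^sub>R u x) (at x)))"

lemma has_vector_derivative_if_has_integral:
  fixes f :: "real \<Rightarrow> 'a::banach"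
  assumes int: "\<And>y. y \<in> {a..b} \<Longrightarrow> (g has_integral (f y - f a)) {a..y}"
    and x: "x \<in> {a<..<b}" and g: "isCont g x"
  shows "(f has_vector_derivative g x) (at x)"
proof -
  have gi: "g integrable_on {a..b}" using int[of b] x by (auto simp: integrable_on_def)
  have "((\<lambda>y. integral {a..y} g) has_vector_derivative g x) (at x within {a..b} - {})"
    by (rule integral_has_vector_derivative_continuous_at[OF gi])
       (use x g in \<open>auto intro: continuous_within_subset simp: continuous_at_imp_continuous_at_within\<close>)
  then have "((\<lambda>y. integral {a..y} g) has_vector_derivative g x) (at x within {a<..<b})"
    by (rule has_vector_derivative_within_subset) auto
  then have "((\<lambda>y. integral {a..y} g + f a) has_vector_derivative g x) (at x within {a<..<b})"
    by (simp add: has_vector_derivative_add_const)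
  then have "(f has_vector_derivative g x) (at x within {a<..<b})"
    by (rule has_vector_derivative_transform[rotated 2])
      (use x int in \<open>auto simp: integral_unique[OF int]\<close>)
  then show ?thesis using x by (simp add: at_within_open[of x "{a<..<b}"])
qed

text \<open>By the fundamental theorem on every \<open>{a..y}\<close>, f is the indefinite integral
  of g up to a constant, and such an integral is differentiable wherever its integrand is
  continuous.\<close>

lemma abs_cont_on_derivative_at_continuity_point:
  fixes f :: "real \<Rightarrow> 'a::banach"
  assumes ac: "abs_cont_on a b f"
    and ae: "AE x in lborel. x \<in> {a..b} \<longrightarrow> (f has_vector_derivative g x) (at x)"
    and x: "x \<in> {a<..<b}" and g: "isCont g x"
  shows "(f has_vector_derivative g x) (at x)"
proof -
  have int: "(g has_integral (f y - f a)) {a..y}" if "y \<in> {a..b}" for y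
  proof (rule abs_cont_on_fundamental_theorem)
    show "a \<le> y" using that by simp
    show "abs_cont_on a y f"
      unfolding abs_cont_on_def
    proof (intro allI impI)
      fix e :: real assume "0 < e"
      with ac obtain d where "0 < d" and d: "\<forall>(n::nat) (x::nat \<Rightarrow> real) (y::nat \<Rightarrow> real).
        (\<forall>i<n. a \<le> x i \<and> x i \<le> y i \<and> y i \<le> b) \<and>
        (\<forall>i<n. \<forall>j<n. i \<noteq> j \<longrightarrow> y i \<le> x j \<or> y j \<le> x i) \<and>
        (\<Sum>i<n. y i - x i) < d \<longrightarrow> (\<Sum>i<n. norm (f (y i) - f (x i))) < e"
        unfolding abs_cont_on_def by (elim allE[of _ e]) (elim impE exE conjE; assumption?)
      have "(\<Sum>i<n. norm (f (v i) - f (u i))) < e"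
        if "\<forall>i<n. a \<le> u i \<and> u i \<le> v i \<and> v i \<le> y" "\<forall>i<n. \<forall>j<n. i \<noteq> j \<longrightarrow> v i \<le> u j \<or> v j \<le> u i"
          "(\<Sum>i<n. v i - u i) < d" for n :: nat and u v
      proof (rule d[rule_format], intro conjI)
        show "\<forall>i<n. a \<le> u i \<and> u i \<le> v i \<and> v i \<le> b" using that(1) \<open>y \<in> {a..b}\<close> by force
      qed (use that in auto)
      with \<open>0 < d\<close> show "\<exists>d>0. \<forall>(n::nat) (x::nat \<Rightarrow> real) (z::nat \<Rightarrow> real).
        (\<forall>i<n. a \<le> x i \<and> x i \<le> z i \<and> z i \<le> y) \<and>
        (\<forall>i<n. \<forall>j<n. i \<noteq> j \<longrightarrow> z i \<le> x j \<or> z j \<le> x i) \<and>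
        (\<Sum>i<n. z i - x i) < d \<longrightarrow> (\<Sum>i<n. norm (f (z i) - f (x i))) < e" by blast
    qed
    show "AE x in lborel. x \<in> {a..y} \<longrightarrow> (f has_vector_derivative g x) (at x)"
      using ae by eventually_elim (use that in auto)
  qed
  show ?thesis by (rule has_vector_derivative_if_has_integral[OF int x g])
qed

text \<open>Since u and q are continuous, the right-hand sides of both equations are continuous
  wherever the coefficients are, so the equations hold there without an almost everywhere
  clause.\<close>

lemma csol_if_sl_solution:
  assumes sl: "sl_solution eps mu E a b u q" and reg: "regular_on a b eps" "regular_on a b mu"
  shows "csol eps mu E a b u q"
proof -
  from sl have uc: "continuous_on {a..b} u" and qc: "continuous_on {a..b} q"
    unfolding sl_solution_def by (auto intro: abs_cont_on_imp_continuous_on)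
  define S where "S = {x \<in> {a<..<b}. \<not> isCont eps x} \<union> {x \<in> {a<..<b}. \<not> isCont mu x}"
  have "finite S" using reg by (auto simp: S_def regular_on_def)
  moreover have "(u has_vector_derivative mu x *\<^sub>R q x) (at x) \<and>
        (q has_vector_derivative (- E * eps x) *\<^sub>R u x) (at x)" if x: "x \<in> {a<..<b} - S" for x
  proof -
    have cont: "isCont eps x" "isCont mu x" using x by (auto simp: S_def)
    have xi: "x \<in> interior {a..b}" using x by (simp add: interior_atLeastAtMost_real)
    have "isCont u x" "isCont q x"
      using continuous_on_interior[OF uc xi] continuous_on_interior[OF qc xi] by auto
    then have "isCont (\<lambda>x. complex_of_real (mu x) * q x) x"
      "isCont (\<lambda>x. - complex_of_real (E * eps x) * u x) x"
      using cont by (auto intro!: continuous_intros)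
    note c = this
    have "(u has_vector_derivative complex_of_real (mu x) * q x) (at x)"
      by (rule abs_cont_on_derivative_at_continuity_point[OF _ _ _ c(1)])
         (use x sl in \<open>auto simp: sl_solution_def\<close>)
    moreover have "(q has_vector_derivative - complex_of_real (E * eps x) * u x) (at x)"
      by (rule abs_cont_on_derivative_at_continuity_point[OF _ _ _ c(2)])
         (use x sl in \<open>auto simp: sl_solution_def\<close>)
    ultimately show ?thesis by (simp add: scaleR_conv_of_real)
  qed
  ultimately show ?thesis using uc qc unfolding csol_def by blast
qed

lemma lipschitz_if_bounded_derivative:
  fixes f :: "real \<Rightarrow> 'a::banach"
  assumes S: "finite S" "\<And>x. x \<in> {a<..<b} - S \<Longrightarrow> (f has_vector_derivative g x) (at x)"
    and c: "continuous_on {a..b} f" and K: "\<And>x. x \<in> {a..b} \<Longrightarrow> norm (g x) \<le> K"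
    and xy: "a \<le> x" "x \<le> y" "y \<le> b"
  shows "norm (f y - f x) \<le> K * (y - x)"
proof -
  have "(g has_integral (f y - f x)) (cbox x y)"
    using fundamental_theorem_of_calculus_interior_strong[OF S(1) xy(2), of f g] S(2) xy
      continuous_on_subset[OF c, of "{x..y}"] by auto
  moreover have "0 \<le> K" using order_trans[OF norm_ge_zero K[of x]] xy by simp
  ultimately show ?thesis using has_integral_bound[of K g "f y - f x" x y] K xy by auto
qed

text \<open>Bounded coefficients and continuous u, q give bounded derivatives off a finite set,
  hence Lipschitz functions, hence absolutely continuous ones; the finite set and the end points are
  null.\<close>

lemma sl_solution_if_csol:
  fixes u q :: "real \<Rightarrow> complex"
  assumes sol: "csol eps mu E a b u q" and reg: "regular_on a b eps" "regular_on a b mu"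
  shows "sl_solution eps mu E a b u q"
proof -
  from sol obtain S where uc: "continuous_on {a..b} u" and qc: "continuous_on {a..b} q"
    and S: "finite S"
    and du: "\<And>x. x \<in> {a<..<b} - S \<Longrightarrow> (u has_vector_derivative mu x *\<^sub>R q x) (at x)"
    and dq: "\<And>x. x \<in> {a<..<b} - S \<Longrightarrow> (q has_vector_derivative (- E * eps x) *\<^sub>R u x) (at x)"
    unfolding csol_def by blast
  from reg obtain K1 K2 where K: "\<forall>x\<in>{a..b}. \<bar>eps x\<bar> \<le> K1" "\<forall>x\<in>{a..b}. \<bar>mu x\<bar> \<le> K2"
    unfolding regular_on_def by blast
  obtain U where U: "\<And>x. x \<in> {a..b} \<Longrightarrow> norm (u x) \<le> U" "0 \<le> U"
    using compact_imp_bounded[OF compact_continuous_image[OF uc compact_Icc]]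
    unfolding bounded_pos by (metis imageI less_imp_le)
  obtain Q where Q: "\<And>x. x \<in> {a..b} \<Longrightarrow> norm (q x) \<le> Q" "0 \<le> Q"
    using compact_imp_bounded[OF compact_continuous_image[OF qc compact_Icc]]
    unfolding bounded_pos by (metis imageI less_imp_le)
  have "abs_cont_on a b u"
  proof (rule abs_cont_on_lipschitz)
    show "norm (u y - u x) \<le> (\<bar>K2\<bar> * Q) * (y - x)" if "a \<le> x" "x \<le> y" "y \<le> b" for x y
      using that Q K
      by (intro lipschitz_if_bounded_derivative[OF S du uc])
         (auto simp: abs_mult intro!: mult_mono intro: order_trans[OF _ abs_ge_self])
  qed (use Q in auto)
  moreover have "abs_cont_on a b q"
  proof (rule abs_cont_on_lipschitz)
    show "norm (q y - q x) \<le> (\<bar>E\<bar> * \<bar>K1\<bar> * U) * (y - x)" if "a \<le> x" "x \<le> y" "y \<le> b" for x y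
      using that U K
      by (intro lipschitz_if_bounded_derivative[OF S dq qc])
         (auto simp: abs_mult intro!: mult_mono intro: order_trans[OF _ abs_ge_self])
  qed (use U in auto)
  moreover have "AE x in lborel. x \<notin> S \<union> {a, b}"
    using S by (intro AE_lborel_singleton countable_imp_null_set_lborel AE_not_in) (auto intro: countable_finite)
  then have "AE x in lborel. x \<in> {a..b} \<longrightarrow> x \<in> {a<..<b} - S"
    by eventually_elim auto
  then have "AE x in lborel. x \<in> {a..b} \<longrightarrow>
        (u has_vector_derivative (complex_of_real (mu x) * q x)) (at x)"
      "AE x in lborel. x \<in> {a..b} \<longrightarrow>
        (q has_vector_derivative (- complex_of_real (E * eps x) * u x)) (at x)"
    using du dq by (auto elim!: eventually_mono simp: scaleR_conv_of_real)
  ultimately show ?thesis unfolding sl_solution_def by blast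
qed


section \<open>Operations on classical solutions: restriction, linearity, reflection, translation,
  joining\<close>

lemma csol_subinterval:
  assumes "csol eps mu E a b u q" "a \<le> a'" "b' \<le> b"
  shows "csol eps mu E a' b' u q"
proof -
  from assms(1) obtain S where S: "continuous_on {a..b} u" "continuous_on {a..b} q" "finite S"
    "\<forall>x\<in>{a<..<b} - S. (u has_vector_derivative mu x *\<^sub>R q x) (at x) \<and>
        (q has_vector_derivative (- E * eps x) *\<^sub>R u x) (at x)" unfolding csol_def by blast
  have "continuous_on {a'..b'} u" "continuous_on {a'..b'} q"
    using S(1,2) assms(2,3) by (auto elim: continuous_on_subset)
  moreover have "{a'<..<b'} - S \<subseteq> {a<..<b} - S" using assms(2,3) by auto
  ultimately show ?thesis using S(3,4) unfolding csol_def by blast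
qed

lemma csol_linear_image:
  assumes "csol eps mu E a b u q" "bounded_linear h"
  shows "csol eps mu E a b (\<lambda>x. h (u x)) (\<lambda>x. h (q x))"
proof -
  interpret bounded_linear h by fact
  from assms(1) obtain S where S: "continuous_on {a..b} u" "continuous_on {a..b} q" "finite S"
    "\<And>x. x\<in>{a<..<b} - S \<Longrightarrow> (u has_vector_derivative mu x *\<^sub>R q x) (at x)"
    "\<And>x. x\<in>{a<..<b} - S \<Longrightarrow> (q has_vector_derivative (- E * eps x) *\<^sub>R u x) (at x)"
    unfolding csol_def by blast
  show ?thesis unfolding csol_def
    using S has_vector_derivative[OF S(4)] has_vector_derivative[OF S(5)]
    by (auto intro!: continuous_on exI[of _ S] simp: scaleR neg)
qed

lemma csol_add:
  assumes "csol eps mu E a b u q" "csol eps mu E a b v r"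
  shows "csol eps mu E a b (\<lambda>x. u x + v x) (\<lambda>x. q x + r x)"
proof -
  from assms(1) obtain S where S: "continuous_on {a..b} u" "continuous_on {a..b} q" "finite S"
    "\<And>x. x\<in>{a<..<b} - S \<Longrightarrow> (u has_vector_derivative mu x *\<^sub>R q x) (at x)"
    "\<And>x. x\<in>{a<..<b} - S \<Longrightarrow> (q has_vector_derivative (- E * eps x) *\<^sub>R u x) (at x)"
    unfolding csol_def by blast
  from assms(2) obtain T where T: "continuous_on {a..b} v" "continuous_on {a..b} r" "finite T"
    "\<And>x. x\<in>{a<..<b} - T \<Longrightarrow> (v has_vector_derivative mu x *\<^sub>R r x) (at x)"
    "\<And>x. x\<in>{a<..<b} - T \<Longrightarrow> (r has_vector_derivative (- E * eps x) *\<^sub>R v x) (at x)"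
    unfolding csol_def by blast
  have "((\<lambda>x. u x + v x) has_vector_derivative mu x *\<^sub>R (q x + r x)) (at x)"
       "((\<lambda>x. q x + r x) has_vector_derivative (- E * eps x) *\<^sub>R (u x + v x)) (at x)"
    if "x \<in> {a<..<b} - (S \<union> T)" for x
    using has_vector_derivative_add[OF S(4) T(4)] has_vector_derivative_add[OF S(5) T(5)] that
    by (auto simp: scaleR_add_right)
  then show ?thesis unfolding csol_def
    using S(1-3) T(1-3) by (auto intro!: continuous_on_add exI[of _ "S \<union> T"])
qed

text \<open>The flux is odd under reflection since it is a derivative.\<close>

lemma csol_reflect:
  assumes sol: "csol eps mu E a b u q"
    and sym: "\<And>x. x \<in> {c - b<..<c - a} \<Longrightarrow> eps' x = eps (c - x) \<and> mu' x = mu (c - x)"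
  shows "csol eps' mu' E (c - b) (c - a) (\<lambda>x. u (c - x)) (\<lambda>x. - q (c - x))"
proof -
  from sol obtain S where S: "continuous_on {a..b} u" "continuous_on {a..b} q" "finite S"
    "\<And>x. x\<in>{a<..<b} - S \<Longrightarrow> (u has_vector_derivative mu x *\<^sub>R q x) (at x)"
    "\<And>x. x\<in>{a<..<b} - S \<Longrightarrow> (q has_vector_derivative (- E * eps x) *\<^sub>R u x) (at x)"
    unfolding csol_def by blast
  have "continuous_on {c - b..c - a} (\<lambda>x. u (c - x))" "continuous_on {c - b..c - a} (\<lambda>x. - q (c - x))"
    using S(1,2) by (auto intro!: continuous_on_minus continuous_on_compose2[of "{a..b}"] continuous_intros)
  moreover have "finite ((\<lambda>x. c - x) ` S)" using S by simp
  moreover have "((\<lambda>x. u (c - x)) has_vector_derivative mu' x *\<^sub>R - q (c - x)) (at x) \<and>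
      ((\<lambda>x. - q (c - x)) has_vector_derivative (- E * eps' x) *\<^sub>R u (c - x)) (at x)"
    if x: "x \<in> {c - b<..<c - a} - (\<lambda>x. c - x) ` S" for x
  proof -
    have "c - x \<notin> S" using x by (force simp: image_iff)
    then have cx: "c - x \<in> {a<..<b} - S" using x by auto
    have d: "((\<lambda>x. c - x) has_vector_derivative -1) (at x)"
      by (auto intro!: derivative_eq_intros)
    show ?thesis
      using vector_diff_chain_at[OF d S(4)[OF cx]]
        has_vector_derivative_minus[OF vector_diff_chain_at[OF d S(5)[OF cx]]] sym[of x] x
      by (simp add: o_def)
  qed
  ultimately show ?thesis unfolding csol_def by blast
qed

text \<open>A translation is the composite of two reflections, and the two sign changes of the flux
  cancel.\<close>

lemma csol_shift:
  assumes sol: "csol eps mu E a b u q"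
    and sym: "\<And>x. x \<in> {a - c<..<b - c} \<Longrightarrow> eps' x = eps (x + c) \<and> mu' x = mu (x + c)"
  shows "csol eps' mu' E (a - c) (b - c) (\<lambda>x. u (x + c)) (\<lambda>x. q (x + c))"
proof -
  have "csol (\<lambda>x. eps (- x)) (\<lambda>x. mu (- x)) E (- b) (- a) (\<lambda>x. u (- x)) (\<lambda>x. - q (- x))"
    using csol_reflect[OF sol, of 0 "\<lambda>x. eps (- x)" "\<lambda>x. mu (- x)"] by simp
  from csol_reflect[OF this, of "- c" eps' mu'] sym show ?thesis
    by (simp add: algebra_simps)
qed

text \<open>The junction point is put into the exceptional set, so only continuity of u and of the
  flux has to match there. This is the transmission condition at the interface.\<close>

lemma csol_join:
  assumes "csol eps mu E a b u q" "csol eps mu E b c u q" "a \<le> b" "b \<le> c"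
  shows "csol eps mu E a c u q"
proof -
  from assms(1) obtain S where S: "continuous_on {a..b} u" "continuous_on {a..b} q" "finite S"
    "\<forall>x\<in>{a<..<b} - S. (u has_vector_derivative mu x *\<^sub>R q x) (at x) \<and>
        (q has_vector_derivative (- E * eps x) *\<^sub>R u x) (at x)" unfolding csol_def by blast
  from assms(2) obtain T where T: "continuous_on {b..c} u" "continuous_on {b..c} q" "finite T"
    "\<forall>x\<in>{b<..<c} - T. (u has_vector_derivative mu x *\<^sub>R q x) (at x) \<and>
        (q has_vector_derivative (- E * eps x) *\<^sub>R u x) (at x)" unfolding csol_def by blast
  have ac: "{a..c} = {a..b} \<union> {b..c}" using assms(3,4) by auto
  have "continuous_on {a..c} u" "continuous_on {a..c} q"
    using S(1,2) T(1,2) unfolding ac by (auto intro: continuous_on_closed_Un)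
  moreover have "finite (insert b (S \<union> T))" using S(3) T(3) by simp
  moreover have "{a<..<c} - insert b (S \<union> T) \<subseteq> ({a<..<b} - S) \<union> ({b<..<c} - T)" by auto
  ultimately show ?thesis using S(4) T(4) unfolding csol_def by blast
qed

lemma csol_cong:
  assumes sol: "csol eps mu E a b u q"
    and eq: "\<And>x. x \<in> {a..b} \<Longrightarrow> u' x = u x \<and> q' x = q x"
    "\<And>x. x \<in> {a<..<b} \<Longrightarrow> eps' x = eps x \<and> mu' x = mu x"
  shows "csol eps' mu' E a b u' q'"
proof -
  from sol obtain S where S: "continuous_on {a..b} u" "continuous_on {a..b} q" "finite S"
    "\<And>x. x\<in>{a<..<b} - S \<Longrightarrow> (u has_vector_derivative mu x *\<^sub>R q x) (at x)"
    "\<And>x. x\<in>{a<..<b} - S \<Longrightarrow> (q has_vector_derivative (- E * eps x) *\<^sub>R u x) (at x)"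
    unfolding csol_def by blast
  have "(u' has_vector_derivative mu' x *\<^sub>R q' x) (at x)"
       "(q' has_vector_derivative (- E * eps' x) *\<^sub>R u' x) (at x)" if x: "x \<in> {a<..<b} - S" for x
  proof -
    have x': "x \<in> {a<..<b}" using x by simp
    have e: "mu' x = mu x" "eps' x = eps x" "u' x = u x" "q' x = q x" using eq x' by auto
    show "(u' has_vector_derivative mu' x *\<^sub>R q' x) (at x)" unfolding e
      by (rule has_vector_derivative_transform_within_open[OF S(4)[OF x] _ x']) (use eq in auto)
    show "(q' has_vector_derivative (- E * eps' x) *\<^sub>R u' x) (at x)" unfolding e
      by (rule has_vector_derivative_transform_within_open[OF S(5)[OF x] _ x']) (use eq in auto)
  qed
  moreover have "continuous_on {a..b} u'" "continuous_on {a..b} q'"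
    using continuous_on_eq[OF S(1), of u'] continuous_on_eq[OF S(2), of q'] eq(1) by simp_all
  ultimately show ?thesis using S(3) unfolding csol_def by blast
qed

section \<open>Piecewise continuous coefficients\<close>

text \<open>One-sided limits give a bound near each point, and bisection turns local boundedness
  into boundedness on a compact interval.\<close>

lemma piecewise_cont_bounded_on:
  assumes "piecewise_cont f"
  shows "\<exists>K. \<forall>x\<in>{a..b}. \<bar>f x\<bar> \<le> K"
proof (cases "a \<le> b")
  case True
  then show ?thesis
  proof (induction rule: Bolzano)
    case (trans a b c)
    then obtain K1 K2 where "\<forall>x\<in>{a..b}. \<bar>f x\<bar> \<le> K1" "\<forall>x\<in>{b..c}. \<bar>f x\<bar> \<le> K2" by blast
    then have "\<forall>x\<in>{a..c}. \<bar>f x\<bar> \<le> max K1 K2" by (metis atLeastAtMost_iff le_cases max.coboundedI1 max.coboundedI2)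
    then show ?case by blast
  next
    case (local x)
    have lim: "\<exists>d>0. \<forall>y. y \<in> S \<and> y \<noteq> x \<and> \<bar>y - x\<bar> < d \<longrightarrow> \<bar>f y\<bar> \<le> \<bar>l\<bar> + 1"
      if "(f \<longlongrightarrow> l) (at x within S)" for l S
    proof -
      have "eventually (\<lambda>y. dist (f y) l < 1) (at x within S)"
        using that by (rule tendstoD) simp
      then obtain d where "d > 0" and d: "\<forall>y\<in>S. y \<noteq> x \<and> dist y x < d \<longrightarrow> dist (f y) l < 1"
        unfolding eventually_at by blast
      have "\<bar>f y\<bar> \<le> \<bar>l\<bar> + 1" if "y \<in> S" "y \<noteq> x" "\<bar>y - x\<bar> < d" for y
        using d that unfolding dist_real_def by (smt (verit))
      with \<open>d > 0\<close> show ?thesis by blast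
    qed
    from assms obtain l1 l2 where "(f \<longlongrightarrow> l1) (at_left x)" "(f \<longlongrightarrow> l2) (at_right x)"
      unfolding piecewise_cont_def by blast
    from lim[OF this(1)] lim[OF this(2)] obtain d1 d2 where
      d: "d1 > 0" "d2 > 0" "\<And>y. y < x \<Longrightarrow> \<bar>y - x\<bar> < d1 \<Longrightarrow> \<bar>f y\<bar> \<le> \<bar>l1\<bar> + 1"
       "\<And>y. y > x \<Longrightarrow> \<bar>y - x\<bar> < d2 \<Longrightarrow> \<bar>f y\<bar> \<le> \<bar>l2\<bar> + 1" by auto
    have "\<bar>f y\<bar> \<le> \<bar>l1\<bar> + \<bar>l2\<bar> + 1 + \<bar>f x\<bar>" if "\<bar>y - x\<bar> < min d1 d2" for y
      using d(3)[of y] d(4)[of y] that by (cases y x rule: linorder_cases) auto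
    then have "\<forall>a b. a \<le> x \<and> x \<le> b \<and> b - a < min d1 d2 \<longrightarrow> (\<exists>K. \<forall>x\<in>{a..b}. \<bar>f x\<bar> \<le> K)"
      by (intro allI impI exI[of _ "\<bar>l1\<bar> + \<bar>l2\<bar> + 1 + \<bar>f x\<bar>"] ballI) (smt (verit) atLeastAtMost_iff)
    with d(1,2) show ?case by (intro exI[of _ "min d1 d2"]) auto
  qed
qed auto

lemma piecewise_cont_regular_on:
  assumes "piecewise_cont f" shows "regular_on a b f"
proof -
  have "{x \<in> {a<..<b}. \<not> isCont f x} \<subseteq> {x \<in> {a..b}. \<not> isCont f x}" by auto
  with assms have "finite {x \<in> {a<..<b}. \<not> isCont f x}"
    unfolding piecewise_cont_def by (meson finite_subset)
  with piecewise_cont_bounded_on[OF assms] show ?thesis unfolding regular_on_def by blast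
qed

lemma regular_on_glue:
  assumes "piecewise_cont f" "piecewise_cont g" shows "regular_on a b (glue f g)"
proof -
  have "isCont (glue f g) x" if "x \<noteq> 0" "isCont f x" "isCont g x" for x
  proof (cases "x < 0")
    case True
    then have "eventually (\<lambda>y. glue f g y = f y) (nhds x)"
      unfolding eventually_nhds by (intro exI[of _ "{..<0}"]) (auto simp: glue_def)
    then show ?thesis using that by (simp add: isCont_cong)
  next
    case False
    then have "eventually (\<lambda>y. glue f g y = g y) (nhds x)"
      using that unfolding eventually_nhds by (intro exI[of _ "{0<..}"]) (auto simp: glue_def)
    then show ?thesis using that by (simp add: isCont_cong)
  qed
  then have "{x \<in> {a<..<b}. \<not> isCont (glue f g) x} \<subseteq>
      {0} \<union> {x \<in> {a..b}. \<not> isCont f x} \<union> {x \<in> {a..b}. \<not> isCont g x}" by auto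
  moreover have "finite ({0} \<union> {x \<in> {a..b}. \<not> isCont f x} \<union> {x \<in> {a..b}. \<not> isCont g x})"
    using assms unfolding piecewise_cont_def by blast
  ultimately have "finite {x \<in> {a<..<b}. \<not> isCont (glue f g) x}" by (rule finite_subset)
  moreover obtain K1 K2 where "\<forall>x\<in>{a..b}. \<bar>f x\<bar> \<le> K1" "\<forall>x\<in>{a..b}. \<bar>g x\<bar> \<le> K2"
    using piecewise_cont_bounded_on assms by metis
  then have "\<forall>x\<in>{a..b}. \<bar>glue f g x\<bar> \<le> max K1 K2" by (auto simp: glue_def le_max_iff_disj)
  ultimately show ?thesis unfolding regular_on_def by blast
qed

lemma piecewise_cont_borel_measurable:
  assumes "piecewise_cont f" shows "f \<in> borel_measurable borel"
proof (rule borel_measurable_continuous_countable_exceptions)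
  have "{x. \<not> isCont f x} = (\<Union>n::nat. {x \<in> {- real n..real n}. \<not> isCont f x})"
  proof -
    have "\<exists>n. x \<in> {- real n..real n}" for x
    proof -
      obtain n where "\<bar>x\<bar> \<le> real n" using real_arch_simple by blast
      then show ?thesis by (intro exI[of _ n]) auto
    qed
    then show ?thesis by blast
  qed
  moreover have "countable (\<Union>n::nat. {x \<in> {- real n..real n}. \<not> isCont f x})"
    using assms unfolding piecewise_cont_def by (intro countable_UN) (auto intro: countable_finite)
  ultimately show "countable {x. \<not> isCont f x}" by simp
  show "continuous_on (- {x. \<not> isCont f x}) f"
    by (auto intro: continuous_at_imp_continuous_on)
qed

lemma piecewise_cont_mult_integrable:
  assumes f: "piecewise_cont f" and g: "continuous_on {a..b} g"
  shows "(\<lambda>x. f x * g x :: real) integrable_on {a..b}"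
proof -
  obtain K where K: "\<forall>x\<in>{a..b}. \<bar>f x\<bar> \<le> K" using piecewise_cont_bounded_on[OF f] by blast
  obtain L where L: "\<forall>x\<in>{a..b}. \<bar>g x\<bar> \<le> L"
    using compact_imp_bounded[OF compact_continuous_image[OF g compact_Icc]]
    unfolding bounded_iff by auto
  have "f \<in> borel_measurable lebesgue"
    using piecewise_cont_borel_measurable[OF f] by (simp add: measurable_completion)
  then have "f \<in> borel_measurable (lebesgue_on {a..b})"
    by (simp add: measurable_restrict_space1)
  moreover have "g \<in> borel_measurable (lebesgue_on {a..b})"
    using continuous_imp_measurable_on_sets_lebesgue[OF g] by simp
  ultimately have m: "(\<lambda>x. f x * g x) \<in> borel_measurable (lebesgue_on {a..b})" by measurable
  have "\<bar>f x * g x\<bar> \<le> \<bar>K\<bar> * L" if "x \<in> {a..b}" for x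
    unfolding abs_mult by (rule mult_mono) (use K L that in \<open>auto intro: order_trans[OF _ abs_ge_self]\<close>)
  then show ?thesis
    by (intro measurable_bounded_by_integrable_imp_integrable_real[OF m integrable_const_ivl[of "\<bar>K\<bar> * L"]]) auto
qed

lemma integral_pos:
  fixes h :: "real \<Rightarrow> real"
  assumes h: "h integrable_on {a..b}" "\<And>x. x \<in> {a..b} \<Longrightarrow> 0 \<le> h x"
    and x: "x \<in> {a<..<b}" "isCont h x" "0 < h x"
  shows "0 < integral {a..b} h"
proof -
  have "eventually (\<lambda>y. h x / 2 < h y) (nhds x)"
    using x(2,3) by (intro order_tendstoD(1)[of _ "h x"]) (auto simp: continuous_at tendsto_at_iff_tendsto_nhds)
  moreover have "eventually (\<lambda>y. y \<in> {a<..<b}) (nhds x)"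
    using x(1) by (intro eventually_nhds_in_open) auto
  ultimately have "eventually (\<lambda>y. h x / 2 < h y \<and> y \<in> {a<..<b}) (nhds x)" by eventually_elim auto
  then obtain d where d: "d > 0" "\<And>y. dist y x < d \<Longrightarrow> h x / 2 < h y \<and> y \<in> {a<..<b}"
    unfolding eventually_nhds_metric by blast
  have sub: "{x..x + d/2} \<subseteq> {a..b}"
  proof
    fix y assume "y \<in> {x..x + d/2}"
    then have "dist y x < d" using d(1) by (auto simp: dist_real_def)
    with d(2) show "y \<in> {a..b}" by force
  qed
  have "0 < (d/2) * (h x / 2)" using d(1) x(3) by simp
  also have "\<dots> = integral {x..x + d/2} (\<lambda>y. h x / 2)" using d(1) by simp
  also have "\<dots> \<le> integral {x..x + d/2} h"
  proof (rule integral_le)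
    show "h integrable_on {x..x + d/2}" using h(1) sub by (rule integrable_on_subinterval)
    show "h x / 2 \<le> h y" if "y \<in> {x..x + d/2}" for y
      using d(2)[of y] that d(1) by (auto simp: dist_real_def)
  qed auto
  also have "\<dots> \<le> integral {a..b} h"
    using sub h integrable_on_subinterval[OF h(1) sub] by (intro integral_subset_le) auto
  finally show ?thesis .
qed

section \<open>Coefficients of a single periodic, even medium\<close>

locale sl_coeffs =
  fixes eps mu :: "real \<Rightarrow> real"
  assumes pc_eps: "piecewise_cont eps" and pc_mu: "piecewise_cont mu"
    and eps_pos: "0 < eps x" and mu_pos: "0 < mu x"
    and eps_per: "eps (x + 1) = eps x" and mu_per: "mu (x + 1) = mu x"
    and eps_even: "eps (- x) = eps x" and mu_even: "mu (- x) = mu x"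
begin

lemma eps_shift: "eps (x + of_int n) = eps x" and mu_shift: "mu (x + of_int n) = mu x"
proof -
  have *: "f (x + of_int n) = f x" if f: "\<And>x. f (x + 1) = f x" for f :: "real \<Rightarrow> real"
  proof (induction n rule: int_induct[of _ 0])
    case (step1 i)
    then show ?case using f[of "x + of_int i"] by (simp add: algebra_simps)
  next
    case (step2 i)
    then show ?case using f[of "x + of_int (i - 1)"] by (simp add: algebra_simps)
  qed simp
  show "eps (x + of_int n) = eps x" "mu (x + of_int n) = mu x" by (rule *, rule eps_per mu_per)+
qed

lemma coeff_bound:
  obtains K where "0 < K" "\<And>x. eps x \<le> K" "\<And>x. mu x \<le> K"
proof -
  obtain K1 K2 where K: "\<forall>x\<in>{0..1}. \<bar>eps x\<bar> \<le> K1" "\<forall>x\<in>{0..1}. \<bar>mu x\<bar> \<le> K2"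
    using piecewise_cont_bounded_on pc_eps pc_mu by metis
  have fr: "x + of_int (- \<lfloor>x\<rfloor>) \<in> {0..1}" for x :: real
    by (simp, linarith)
  have "eps x \<le> \<bar>K1\<bar> + \<bar>K2\<bar> + 1" "mu x \<le> \<bar>K1\<bar> + \<bar>K2\<bar> + 1" for x
    using K[THEN bspec, OF fr[of x]] eps_shift[of x "- \<lfloor>x\<rfloor>"] mu_shift[of x "- \<lfloor>x\<rfloor>"]
    by linarith+
  then show ?thesis using that[of "\<bar>K1\<bar> + \<bar>K2\<bar> + 1"] by auto
qed

lemma exists_continuity_point:
  assumes "a < b" obtains x where "x \<in> {a<..<b}" "isCont eps x" "isCont mu x"
proof -
  have "finite ({x \<in> {a..b}. \<not> isCont eps x} \<union> {x \<in> {a..b}. \<not> isCont mu x})"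
    using pc_eps pc_mu unfolding piecewise_cont_def by blast
  then have "infinite ({a<..<b} - ({x \<in> {a..b}. \<not> isCont eps x} \<union> {x \<in> {a..b}. \<not> isCont mu x}))"
    using assms by (simp add: Diff_infinite_finite infinite_Ioo)
  then have "{a<..<b} - ({x \<in> {a..b}. \<not> isCont eps x} \<union> {x \<in> {a..b}. \<not> isCont mu x}) \<noteq> {}"
    using infinite_imp_nonempty by blast
  then obtain x where "x \<in> {a<..<b} - ({x \<in> {a..b}. \<not> isCont eps x} \<union> {x \<in> {a..b}. \<not> isCont mu x})"
    by blast
  then show ?thesis by (intro that[of x]) auto
qed

text \<open>The given x may be an end point of the period or a jump of \<open>eps\<close>.
  Continuity of f allows moving to a nearby interior point at which f is still positive and
  \<open>eps\<close> is continuous, where \<open>integral_pos\<close> applies.\<close>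

lemma weighted_integral_pos:
  assumes f: "continuous_on {0..1} f" "\<And>x. x \<in> {0..1} \<Longrightarrow> 0 \<le> f x"
    and x: "x \<in> {0..1}" "0 < f x"
  shows "0 < integral {0..1} (\<lambda>x. eps x * f x)"
proof -
  obtain d where d: "d > 0" "\<And>y. y \<in> {0..1} \<Longrightarrow> dist y x < d \<Longrightarrow> dist (f y) (f x) < f x"
    using f(1) x unfolding continuous_on_iff by blast
  have "max 0 (x - d) < min 1 (x + d)" using x(1) d(1) by auto
  from exists_continuity_point[OF this] obtain z where
    z: "z \<in> {max 0 (x - d)<..<min 1 (x + d)}" "isCont eps z" by blast
  have z': "z \<in> {0<..<1}" using z by auto
  have "dist (f z) (f x) < f x" using d(2)[of z] z by (auto simp: dist_real_def)
  then have "0 < f z" by (auto simp: dist_real_def)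
  moreover have "isCont f z"
    using continuous_on_interior[OF f(1), of z] z' by (simp add: interior_atLeastAtMost_real)
  ultimately show ?thesis
    using z(2) z' f(2) eps_pos
    by (intro integral_pos[of _ _ _ z] piecewise_cont_mult_integrable pc_eps f(1))
       (auto intro!: mult_nonneg_nonneg less_imp_le[OF eps_pos])
qed

end

section \<open>The initial value problem on the half-line\<close>

context sl_coeffs
begin

text \<open>These are the increments between successive Picard iterates: the n-th term is the n-fold
  iterated integral of the initial data, and the solution is the sum over n.\<close>

fun picard :: "real \<Rightarrow> real \<Rightarrow> real \<Rightarrow> nat \<Rightarrow> real \<Rightarrow> real \<times> real" where
  "picard E u0 q0 0 x = (u0, q0)"
| "picard E u0 q0 (Suc n) x =
    (integral {0..x} (\<lambda>t. mu t * snd (picard E u0 q0 n t)),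
     integral {0..x} (\<lambda>t. eps t * (- E * fst (picard E u0 q0 n t))))"

lemma picard_continuous:
  "continuous_on {0..b} (\<lambda>x. fst (picard E u0 q0 n x)) \<and>
   continuous_on {0..b} (\<lambda>x. snd (picard E u0 q0 n x))"
proof (induction n)
  case (Suc n)
  then show ?case
    by (auto intro!: indefinite_integral_continuous_1 piecewise_cont_mult_integrable pc_eps pc_mu
        continuous_intros)
qed auto

text \<open>Integrating L times the bound for n reproduces the bound for n + 1. The constant L
  dominates both \<open>mu\<close> and \<open>\<bar>E\<bar> * eps\<close>, so one estimate serves
  both components.\<close>

lemma picard_bound:
  fixes E u0 q0 :: real
  assumes K: "0 < K" "\<And>x. eps x \<le> K" "\<And>x. mu x \<le> K" and x: "0 \<le> x"
  defines "L \<equiv> K * (1 + \<bar>E\<bar>)" and "M \<equiv> \<bar>u0\<bar> + \<bar>q0\<bar>"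
  shows "\<bar>fst (picard E u0 q0 n x)\<bar> \<le> M * (L * x) ^ n / fact n \<and>
         \<bar>snd (picard E u0 q0 n x)\<bar> \<le> M * (L * x) ^ n / fact n"
  using x
proof (induction n arbitrary: x)
  case 0
  then show ?case by (auto simp: M_def)
next
  case (Suc n)
  have L: "0 < L" "K \<le> L" "K * \<bar>E\<bar> \<le> L" and M: "0 \<le> M"
    using K(1) by (auto simp: L_def M_def algebra_simps add_pos_nonneg)
  have int: "((\<lambda>t. L * (M * (L * t) ^ n / fact n)) has_integral M * (L * x) ^ Suc n / fact (Suc n)) {0..x}"
  proof -
    have "((\<lambda>t. L * (M * (L * t) ^ n / fact n)) has_integral
      M * (L * x) ^ Suc n / fact (Suc n) - M * (L * 0) ^ Suc n / fact (Suc n)) {0..x}"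
    proof (rule fundamental_theorem_of_calculus)
      fix t assume "t \<in> {0..x}"
      have "((\<lambda>t. M * (L * t) ^ Suc n / fact (Suc n)) has_real_derivative
         M * (real (Suc n) * (L * t) ^ n * L) / fact (Suc n)) (at t within {0..x})"
        by (rule derivative_eq_intros refl | simp)+
      then show "((\<lambda>t. M * (L * t) ^ Suc n / fact (Suc n)) has_vector_derivative
         L * (M * (L * t) ^ n / fact n)) (at t within {0..x})"
        by (simp add: has_real_derivative_iff_has_vector_derivative field_simps del: of_nat_Suc)
    qed (use Suc in auto)
    then show ?thesis by simp
  qed
  have "norm (integral {0..x} (\<lambda>t. mu t * snd (picard E u0 q0 n t)))
     \<le> integral {0..x} (\<lambda>t. L * (M * (L * t) ^ n / fact n))"
  proof (rule integral_norm_bound_integral)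
    show "(\<lambda>t. mu t * snd (picard E u0 q0 n t)) integrable_on {0..x}"
      using picard_continuous by (auto intro: piecewise_cont_mult_integrable pc_mu)
    show "norm (mu t * snd (picard E u0 q0 n t)) \<le> L * (M * (L * t) ^ n / fact n)" if "t \<in> {0..x}" for t
    proof -
      have "norm (mu t * snd (picard E u0 q0 n t)) = mu t * \<bar>snd (picard E u0 q0 n t)\<bar>"
        using mu_pos[of t] by (simp add: abs_mult)
      also have "\<dots> \<le> L * (M * (L * t) ^ n / fact n)"
        using Suc.IH[of t] that K(3)[of t] L by (intro mult_mono) auto
      finally show ?thesis .
    qed
  qed (use int in blast)
  moreover have "norm (integral {0..x} (\<lambda>t. eps t * (- E * fst (picard E u0 q0 n t))))
     \<le> integral {0..x} (\<lambda>t. L * (M * (L * t) ^ n / fact n))"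
  proof (rule integral_norm_bound_integral)
    show "(\<lambda>t. eps t * (- E * fst (picard E u0 q0 n t))) integrable_on {0..x}"
      using picard_continuous by (intro piecewise_cont_mult_integrable pc_eps continuous_on_mult_left) blast
    show "norm (eps t * (- E * fst (picard E u0 q0 n t))) \<le> L * (M * (L * t) ^ n / fact n)"
      if "t \<in> {0..x}" for t
    proof -
      have "norm (eps t * (- E * fst (picard E u0 q0 n t))) = (eps t * \<bar>E\<bar>) * \<bar>fst (picard E u0 q0 n t)\<bar>"
        using eps_pos[of t] by (simp add: abs_mult)
      also have "\<dots> \<le> L * (M * (L * t) ^ n / fact n)"
      proof (rule mult_mono)
        show "eps t * \<bar>E\<bar> \<le> L" using mult_right_mono[OF K(2)[of t], of "\<bar>E\<bar>"] L(3) by linarith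
      qed (use Suc.IH[of t] that L in auto)
      finally show ?thesis .
    qed
  qed (use int in blast)
  ultimately show ?case using integral_unique[OF int] by simp
qed

lemma ivp_exists:
  "\<exists>u q. u 0 = u0 \<and> q 0 = q0 \<and> (\<forall>b. csol eps mu E 0 b u (q :: real \<Rightarrow> real))"
proof -
  obtain K where K: "0 < K" "\<And>x. eps x \<le> K" "\<And>x. mu x \<le> K" using coeff_bound by metis
  define L where "L = K * (1 + \<bar>E\<bar>)"
  define M where "M = \<bar>u0\<bar> + \<bar>q0\<bar>"
  define U where "U n x = fst (picard E u0 q0 n x)" for n x
  define Q where "Q n x = snd (picard E u0 q0 n x)" for n x
  define u where "u x = (\<Sum>n. U n x)" for x
  define q where "q x = (\<Sum>n. Q n x)" for x
  have L: "0 < L" and M: "0 \<le> M" using K(1) by (auto simp: L_def M_def add_pos_nonneg)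
  have bd: "\<bar>U n x\<bar> \<le> M * (L * b) ^ n / fact n" "\<bar>Q n x\<bar> \<le> M * (L * b) ^ n / fact n"
    if "x \<in> {0..b}" for n x b
  proof -
    have "M * (L * x) ^ n / fact n \<le> M * (L * b) ^ n / fact n"
      using that L M by (auto intro!: divide_right_mono mult_left_mono power_mono)
    with picard_bound[OF K, of x E u0 q0 n] that
    show "\<bar>U n x\<bar> \<le> M * (L * b) ^ n / fact n" "\<bar>Q n x\<bar> \<le> M * (L * b) ^ n / fact n"
      by (auto simp: L_def M_def U_def Q_def intro: order_trans)
  qed
  have sm: "summable (\<lambda>n. M * (L * b) ^ n / fact n)" for b
    using summable_mult[OF summable_exp[of "L * b"], of M] by (simp add: field_simps)
  have Uc: "continuous_on {0..b} (U n)" and Qc: "continuous_on {0..b} (Q n)" for n b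
    using picard_continuous unfolding U_def Q_def by blast+
  have Uu: "uniform_limit {0..b} (\<lambda>n x. \<Sum>i<n. U i x) u sequentially" for b
    unfolding u_def using bd[of _ b] sm by (intro Weierstrass_m_test) auto
  have Qu: "uniform_limit {0..b} (\<lambda>n x. \<Sum>i<n. Q i x) q sequentially" for b
    unfolding q_def using bd[of _ b] sm by (intro Weierstrass_m_test) auto
  have uc: "continuous_on {0..b} u" for b
    by (rule uniform_limit_theorem[OF _ Uu]) (auto intro!: always_eventually continuous_on_sum Uc)
  have qc: "continuous_on {0..b} q" for b
    by (rule uniform_limit_theorem[OF _ Qu]) (auto intro!: always_eventually continuous_on_sum Qc)
  \<comment> \<open>Termwise integration of the series, stated once for both components: it is used
    with f = \<open>mu\<close>, c = 1 for u and with f = \<open>eps\<close>, c = - E for q. The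
    bound by the exponential series dominates all partial sums.\<close>
  have step: "((\<lambda>t. f t * (c * V t)) has_integral (w b - w0)) {0..b}"
    if b: "0 \<le> b" and f: "piecewise_cont f" "\<And>x. \<bar>f x\<bar> \<le> K"
      and v: "\<And>n. continuous_on {0..b} (v n)" "uniform_limit {0..b} (\<lambda>n x. \<Sum>i<n. v i x) V sequentially"
        "\<And>n x. x \<in> {0..b} \<Longrightarrow> \<bar>v n x\<bar> \<le> M * (L * b) ^ n / fact n"
      and w: "W 0 b = w0" "\<And>n. W (Suc n) b = integral {0..b} (\<lambda>t. f t * (c * v n t))"
        "(\<lambda>n. \<Sum>i<n. W i b) \<longlonglongrightarrow> w b"
    for f :: "real \<Rightarrow> real" and c v V W w w0 b
  proof (rule has_integral_dominated_convergence)
    let ?B = "\<Sum>n. M * (L * b) ^ n / fact n"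
    have int: "(\<lambda>t. f t * (c * v n t)) integrable_on {0..b}" for n
      by (intro piecewise_cont_mult_integrable f continuous_intros v)
    show "((\<lambda>t. f t * (c * (\<Sum>i<n. v i t))) has_integral ((\<Sum>i<Suc n. W i b) - w0)) {0..b}" for n
    proof -
      have "((\<lambda>t. \<Sum>i<n. f t * (c * v i t)) has_integral (\<Sum>i<n. W (Suc i) b)) {0..b}"
        unfolding w(2) by (intro has_integral_sum integrable_integral int) auto
      moreover have "(\<Sum>i<Suc n. W i b) = w0 + (\<Sum>i<n. W (Suc i) b)"
        by (subst sum.lessThan_Suc_shift) (simp add: w(1))
      ultimately show ?thesis by (simp add: sum_distrib_left)
    qed
    show "(\<lambda>_. K * (\<bar>c\<bar> * ?B)) integrable_on {0..b}" by (rule integrable_const_ivl)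
    show "\<forall>x\<in>{0..b}. norm (f x * (c * (\<Sum>i<n. v i x))) \<le> K * (\<bar>c\<bar> * ?B)" for n
    proof
      fix x assume x: "x \<in> {0..b}"
      have "\<bar>\<Sum>i<n. v i x\<bar> \<le> (\<Sum>i<n. M * (L * b) ^ i / fact i)"
        using v(3)[OF x] by (intro order_trans[OF sum_abs] sum_mono) auto
      also have "\<dots> \<le> ?B" using sm b L M by (intro sum_le_suminf) auto
      finally show "norm (f x * (c * (\<Sum>i<n. v i x))) \<le> K * (\<bar>c\<bar> * ?B)"
        using f(2)[of x] K(1) by (auto simp: abs_mult intro!: mult_mono)
    qed
    show "\<forall>x\<in>{0..b}. (\<lambda>n. f x * (c * (\<Sum>i<n. v i x))) \<longlonglongrightarrow> f x * (c * V x)"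
      using tendsto_uniform_limitI[OF v(2)] by (auto intro!: tendsto_intros)
    show "(\<lambda>n. (\<Sum>i<Suc n. W i b) - w0) \<longlonglongrightarrow> w b - w0"
      by (intro tendsto_diff tendsto_const LIMSEQ_Suc[OF w(3)])
  qed
  have bK: "\<bar>eps x\<bar> \<le> K" "\<bar>mu x\<bar> \<le> K" for x
    using K(2,3)[of x] eps_pos[of x] mu_pos[of x] by auto
  have ui: "((\<lambda>t. mu t * (1 * q t)) has_integral (u b - u0)) {0..b}" if "0 \<le> b" for b
    by (rule step[where v = Q and W = U])
       (use that bd(2)[of _ b] pc_mu bK Qc Qu[of b] tendsto_uniform_limitI[OF Uu[of b]] in
         \<open>auto simp: U_def Q_def\<close>)
  have qi: "((\<lambda>t. eps t * (- E * u t)) has_integral (q b - q0)) {0..b}" if "0 \<le> b" for b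
    by (rule step[where v = U and W = Q])
       (use that bd(1)[of _ b] pc_eps bK Uc Uu[of b] tendsto_uniform_limitI[OF Qu[of b]] in
         \<open>auto simp: U_def Q_def\<close>)
  have u0: "u 0 = u0" using has_integral_unique[OF ui[of 0]] by (force simp: has_integral_refl)
  have q0: "q 0 = q0" using has_integral_unique[OF qi[of 0]] by (force simp: has_integral_refl)
  have "csol eps mu E 0 b u q" for b
    unfolding csol_def
  proof (intro conjI uc qc exI ballI)
    let ?S = "{x \<in> {0..b}. \<not> isCont eps x} \<union> {x \<in> {0..b}. \<not> isCont mu x}"
    show "finite ?S" using pc_eps pc_mu unfolding piecewise_cont_def by blast
    fix x assume x: "x \<in> {0<..<b} - ?S"
    then have c: "isCont eps x" "isCont mu x" by auto
    have xb: "x \<in> {0<..<b}" using x by simp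
    have "isCont u x" "isCont q x"
      using continuous_on_interior[OF uc, of x b] continuous_on_interior[OF qc, of x b] xb
      by (auto simp: interior_atLeastAtMost_real)
    note c = c this
    have "(u has_vector_derivative mu x * (1 * q x)) (at x)"
      by (rule has_vector_derivative_if_has_integral[OF _ xb]) (use ui u0 c in \<open>auto intro!: continuous_intros\<close>)
    then show "(u has_vector_derivative mu x *\<^sub>R q x) (at x)" by simp
    have "(q has_vector_derivative eps x * (- E * u x)) (at x)"
      by (rule has_vector_derivative_if_has_integral[OF _ xb]) (use qi q0 c in \<open>auto intro!: continuous_intros\<close>)
    then show "(q has_vector_derivative (- E * eps x) *\<^sub>R u x) (at x)" by (simp add: mult_ac)
  qed
  with u0 q0 show ?thesis by blast
qed

end

section \<open>Lagrange's identity and the fundamental system\<close>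

lemma csol_realE:
  fixes u q :: "real \<Rightarrow> real"
  assumes "csol eps mu E a b u q"
  obtains S where "finite S" "continuous_on {a..b} u" "continuous_on {a..b} q"
    "\<And>x. x \<in> {a<..<b} - S \<Longrightarrow> (u has_real_derivative mu x * q x) (at x)"
    "\<And>x. x \<in> {a<..<b} - S \<Longrightarrow> (q has_real_derivative - (E * (eps x * u x))) (at x)"
proof -
  from assms obtain S where "finite S" "continuous_on {a..b} u" "continuous_on {a..b} q"
    "\<And>x. x \<in> {a<..<b} - S \<Longrightarrow> (u has_vector_derivative mu x *\<^sub>R q x) (at x)"
    "\<And>x. x \<in> {a<..<b} - S \<Longrightarrow> (q has_vector_derivative (- E * eps x) *\<^sub>R u x) (at x)"
    unfolding csol_def by blast
  then show ?thesis
    by (intro that[of S]) (auto simp: has_real_derivative_iff_has_vector_derivative mult_ac)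
qed

lemma ftc_real:
  fixes f :: "real \<Rightarrow> real"
  assumes "finite S" "a \<le> b" "continuous_on {a..b} f"
    and "\<And>x. x \<in> {a<..<b} - S \<Longrightarrow> (f has_real_derivative g x) (at x)"
  shows "(g has_integral (f b - f a)) {a..b}"
  using assms by (intro fundamental_theorem_of_calculus_interior_strong)
    (auto simp: has_real_derivative_iff_has_vector_derivative)

text \<open>In the derivative of the Wronskian the terms \<open>mu * q1 * q2\<close> cancel and the
  energy terms combine. Equal energies give a constant Wronskian; different energies give the
  difference formulas behind every derivative in E.\<close>

lemma lagrange_identity:
  fixes u1 q1 u2 q2 :: "real \<Rightarrow> real"
  assumes "csol eps mu E1 a b u1 q1" "csol eps mu E2 a b u2 q2" "a \<le> b"
  shows "((\<lambda>x. (E1 - E2) * (eps x * (u1 x * u2 x))) has_integral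
     ((u1 b * q2 b - u2 b * q1 b) - (u1 a * q2 a - u2 a * q1 a))) {a..b}"
proof -
  obtain S where S: "finite S" "continuous_on {a..b} u1" "continuous_on {a..b} q1"
    "\<And>x. x \<in> {a<..<b} - S \<Longrightarrow> (u1 has_real_derivative mu x * q1 x) (at x)"
    "\<And>x. x \<in> {a<..<b} - S \<Longrightarrow> (q1 has_real_derivative - (E1 * (eps x * u1 x))) (at x)"
    using csol_realE[OF assms(1)] by metis
  obtain T where T: "finite T" "continuous_on {a..b} u2" "continuous_on {a..b} q2"
    "\<And>x. x \<in> {a<..<b} - T \<Longrightarrow> (u2 has_real_derivative mu x * q2 x) (at x)"
    "\<And>x. x \<in> {a<..<b} - T \<Longrightarrow> (q2 has_real_derivative - (E2 * (eps x * u2 x))) (at x)"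
    using csol_realE[OF assms(2)] by metis
  have "((\<lambda>x. u1 x * q2 x - u2 x * q1 x) has_real_derivative (E1 - E2) * (eps x * (u1 x * u2 x))) (at x)"
    if "x \<in> {a<..<b} - (S \<union> T)" for x
    using that by (auto intro!: derivative_eq_intros S T simp: algebra_simps)
  note d = this
  show ?thesis
    by (rule ftc_real[where S = "S \<union> T", OF _ assms(3) _ d]) (use S(1-3) T(1-3) in \<open>auto intro!: continuous_intros\<close>)
qed

text \<open>The integrand is the derivative of u q. Its sign for E < 0 is what excludes negative
  eigenvalues.\<close>

lemma energy_identity:
  fixes u q :: "real \<Rightarrow> real"
  assumes "csol eps mu E a b u q" "a \<le> b"
  shows "((\<lambda>x. mu x * (q x)\<^sup>2 - E * (eps x * (u x)\<^sup>2)) has_integral (u b * q b - u a * q a)) {a..b}"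
proof -
  obtain S where S: "finite S" "continuous_on {a..b} u" "continuous_on {a..b} q"
    "\<And>x. x \<in> {a<..<b} - S \<Longrightarrow> (u has_real_derivative mu x * q x) (at x)"
    "\<And>x. x \<in> {a<..<b} - S \<Longrightarrow> (q has_real_derivative - (E * (eps x * u x))) (at x)"
    using csol_realE[OF assms(1)] by metis
  have "((\<lambda>x. u x * q x) has_real_derivative mu x * (q x)\<^sup>2 - E * (eps x * (u x)\<^sup>2)) (at x)"
    if "x \<in> {a<..<b} - S" for x
    using that by (auto intro!: derivative_eq_intros S simp: algebra_simps power2_eq_square)
  note d = this
  show ?thesis
    by (rule ftc_real[OF S(1) assms(2) _ d]) (use S(2,3) in \<open>auto intro!: continuous_intros\<close>)
qed

context sl_coeffs
begin

definition ivp :: "real \<Rightarrow> real \<Rightarrow> real \<Rightarrow> (real \<Rightarrow> real) \<times> (real \<Rightarrow> real)" where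
  "ivp E u0 q0 = (SOME w. fst w 0 = u0 \<and> snd w 0 = q0 \<and> (\<forall>b. csol eps mu E 0 b (fst w) (snd w)))"

text \<open>\<open>cu\<close> and \<open>su\<close> are the cosine-like and sine-like solutions, \<open>cq\<close> and \<open>sq\<close> their fluxes \<open>u' / mu\<close>.\<close>

definition "cu E = fst (ivp E 1 0)"
definition "cq E = snd (ivp E 1 0)"
definition "su E = fst (ivp E 0 1)"
definition "sq E = snd (ivp E 0 1)"

lemma ivp: "fst (ivp E u0 q0) 0 = u0" "snd (ivp E u0 q0) 0 = q0"
    "csol eps mu E 0 b (fst (ivp E u0 q0)) (snd (ivp E u0 q0))"
proof -
  from ivp_exists[of u0 q0 E] have
    "\<exists>w. fst w 0 = u0 \<and> snd w 0 = q0 \<and> (\<forall>b. csol eps mu E 0 b (fst w) (snd w))" by force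
  from someI_ex[OF this] show "fst (ivp E u0 q0) 0 = u0" "snd (ivp E u0 q0) 0 = q0"
    "csol eps mu E 0 b (fst (ivp E u0 q0)) (snd (ivp E u0 q0))"
    unfolding ivp_def by blast+
qed

lemma fund_0 [simp]: "cu E 0 = 1" "cq E 0 = 0" "su E 0 = 0" "sq E 0 = 1"
  and csol_c: "csol eps mu E 0 b (cu E) (cq E)" and csol_s: "csol eps mu E 0 b (su E) (sq E)"
  using ivp unfolding cu_def cq_def su_def sq_def by blast+

lemma fund_continuous: "continuous_on {0..b} (cu E)" "continuous_on {0..b} (cq E)"
    "continuous_on {0..b} (su E)" "continuous_on {0..b} (sq E)"
  using csol_c csol_s unfolding csol_def by blast+

lemma wronskian_constant:
  fixes u1 q1 u2 q2 :: "real \<Rightarrow> real"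
  assumes "csol eps mu E 0 b u1 q1" "csol eps mu E 0 b u2 q2" "x \<in> {0..b}"
  shows "u1 x * q2 x - u2 x * q1 x = u1 0 * q2 0 - u2 0 * q1 0"
proof -
  have "csol eps mu E 0 x u1 q1" "csol eps mu E 0 x u2 q2"
    using assms by (auto intro: csol_subinterval)
  from lagrange_identity[OF this] assms(3) have
    "((\<lambda>x. 0) has_integral (u1 x * q2 x - u2 x * q1 x - (u1 0 * q2 0 - u2 0 * q1 0))) {0..x}" by simp
  from has_integral_unique[OF this has_integral_0] show ?thesis by simp
qed

lemma wronskian: "0 \<le> x \<Longrightarrow> cu E x * sq E x - su E x * cq E x = 1"
  using wronskian_constant[OF csol_c csol_s, of x x] by simp

text \<open>The constant Wronskians of (u, q) with the two fundamental solutions are linear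
  equations for u x and q x with determinant 1; Cramer's rule solves them. Uniqueness for the
  initial value problem is contained in this.\<close>

lemma csol_representation:
  fixes u q :: "real \<Rightarrow> real"
  assumes "csol eps mu E 0 b u q" "x \<in> {0..b}"
  shows "u x = u 0 * cu E x + q 0 * su E x" "q x = u 0 * cq E x + q 0 * sq E x"
proof -
  have 1: "u x * cq E x - cu E x * q x = - q 0"
    using wronskian_constant[OF assms(1) csol_c assms(2)] by simp
  have 2: "u x * sq E x - su E x * q x = u 0"
    using wronskian_constant[OF assms(1) csol_s assms(2)] by simp
  have 3: "cu E x * sq E x - su E x * cq E x = 1" using wronskian assms(2) by simp
  have "u x = u x * (cu E x * sq E x - su E x * cq E x)" using 3 by simp
  also have "\<dots> = cu E x * (u x * sq E x - su E x * q x) - su E x * (u x * cq E x - cu E x * q x)"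
    by (simp add: algebra_simps)
  finally show "u x = u 0 * cu E x + q 0 * su E x" using 1 2 by simp
  have "q x = q x * (cu E x * sq E x - su E x * cq E x)" using 3 by simp
  also have "\<dots> = cq E x * (u x * sq E x - su E x * q x) - sq E x * (u x * cq E x - cu E x * q x)"
    by (simp add: algebra_simps)
  finally show "q x = u 0 * cq E x + q 0 * sq E x" using 1 2 by simp
qed

lemma csol_complex_representation:
  fixes u q :: "real \<Rightarrow> complex"
  assumes c: "csol eps mu E 0 b u q" "x \<in> {0..b}"
  shows "u x = u 0 * of_real (cu E x) + q 0 * of_real (su E x)"
        "q x = u 0 * of_real (cq E x) + q 0 * of_real (sq E x)"
proof -
  note re = csol_representation[OF csol_linear_image[OF c(1) bounded_linear_Re] c(2)]
    and im = csol_representation[OF csol_linear_image[OF c(1) bounded_linear_Im] c(2)]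
  show "u x = u 0 * of_real (cu E x) + q 0 * of_real (su E x)"
        "q x = u 0 * of_real (cq E x) + q 0 * of_real (sq E x)"
    by (auto simp: complex_eq_iff re im)
qed

lemma csol_combination:
  fixes \<alpha> \<beta> :: "'a::real_normed_algebra_1"
  shows "csol eps mu E 0 b (\<lambda>x. \<alpha> * of_real (cu E x) + \<beta> * of_real (su E x))
     (\<lambda>x. \<alpha> * of_real (cq E x) + \<beta> * of_real (sq E x))"
  by (rule csol_add)
     (rule csol_linear_image[OF csol_c, of "\<lambda>x. \<alpha> * of_real x"] csol_linear_image[OF csol_s, of "\<lambda>x. \<beta> * of_real x"],
      rule bounded_linear_compose[OF bounded_linear_mult_right bounded_linear_of_real])+

lemma sl_solution_combination:
  "sl_solution eps mu E 0 b (\<lambda>x. \<alpha> * of_real (cu E x) + \<beta> * of_real (su E x))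
     (\<lambda>x. \<alpha> * of_real (cq E x) + \<beta> * of_real (sq E x))"
  by (intro sl_solution_if_csol csol_combination piecewise_cont_regular_on pc_eps pc_mu)

section \<open>The monodromy matrix\<close>

text \<open>The monodromy matrix over one period has rows \<open>(disc, ms)\<close> and \<open>(mb, disc)\<close>; the diagonal
  entries agree because the coefficients are even.\<close>

definition "disc E = cu E 1"
definition "mb E = cq E 1"
definition "ms E = su E 1"

lemma coeffs_reflect: "eps (1 - x) = eps x" "mu (1 - x) = mu x"
  using eps_shift[of "- x" 1] mu_shift[of "- x" 1] by (simp_all add: eps_even mu_even algebra_simps)

text \<open>The reflected fundamental solutions again solve the equation; expanding them in the
  fundamental system and evaluating at x = 1 gives
  \<open>(disc E)^2 = 1 + mb E * ms E = (sq E 1)^2\<close>. The Wronskian adds that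
  \<open>disc E * sq E 1\<close> has the same value, so the square of \<open>sq E 1 - disc E\<close>
  is 0.\<close>

lemma sq_1: "sq E 1 = disc E" and det: "(disc E)\<^sup>2 - mb E * ms E = 1"
  and c_reflect: "x \<in> {0..1} \<Longrightarrow> cu E (1 - x) = disc E * cu E x - mb E * su E x"
  and s_reflect: "x \<in> {0..1} \<Longrightarrow> su E (1 - x) = ms E * cu E x - disc E * su E x"
proof -
  have c: "csol eps mu E 0 1 (\<lambda>x. cu E (1 - x)) (\<lambda>x. - cq E (1 - x))"
    using csol_reflect[OF csol_c[of E 1], of 1 eps mu] coeffs_reflect by simp
  have s: "csol eps mu E 0 1 (\<lambda>x. su E (1 - x)) (\<lambda>x. - sq E (1 - x))"
    using csol_reflect[OF csol_s[of E 1], of 1 eps mu] coeffs_reflect by simp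
  note c' = csol_representation[OF c] and s' = csol_representation[OF s]
  from c'(1)[of 1] have 1: "1 = (disc E)\<^sup>2 - mb E * ms E"
    by (simp add: disc_def mb_def ms_def power2_eq_square)
  from s'(2)[of 1] have 2: "- 1 = ms E * mb E - (sq E 1)\<^sup>2"
    by (simp add: disc_def mb_def ms_def power2_eq_square)
  have 3: "disc E * sq E 1 - mb E * ms E = 1"
    using wronskian[of 1 E] by (simp add: disc_def mb_def ms_def mult_ac)
  have "(sq E 1 - disc E)\<^sup>2 = 0"
    using 1 2 3 by (simp add: power2_diff algebra_simps)
  then show sq1: "sq E 1 = disc E" by simp
  show "(disc E)\<^sup>2 - mb E * ms E = 1" using 1 by simp
  show "cu E (1 - x) = disc E * cu E x - mb E * su E x" if "x \<in> {0..1}"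
    using c'(1)[OF that] by (simp add: disc_def mb_def)
  show "su E (1 - x) = ms E * cu E x - disc E * su E x" if "x \<in> {0..1}"
    using s'(1)[OF that] sq1 by (simp add: ms_def)
qed

lemma fund_shift:
  assumes "0 \<le> x"
  shows "cu E (x + 1) = disc E * cu E x + mb E * su E x"
    "cq E (x + 1) = disc E * cq E x + mb E * sq E x"
    "su E (x + 1) = ms E * cu E x + disc E * su E x"
    "sq E (x + 1) = ms E * cq E x + disc E * sq E x"
proof -
  have c: "csol eps mu E 0 x (\<lambda>x. cu E (x + 1)) (\<lambda>x. cq E (x + 1))"
    using csol_shift[OF csol_subinterval[OF csol_c[of E "x + 1"], of 1 "x + 1"], of 1 eps mu]
    by (simp add: eps_per mu_per)
  have s: "csol eps mu E 0 x (\<lambda>x. su E (x + 1)) (\<lambda>x. sq E (x + 1))"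
    using csol_shift[OF csol_subinterval[OF csol_s[of E "x + 1"], of 1 "x + 1"], of 1 eps mu]
    by (simp add: eps_per mu_per)
  show "cu E (x + 1) = disc E * cu E x + mb E * su E x"
    "cq E (x + 1) = disc E * cq E x + mb E * sq E x"
    "su E (x + 1) = ms E * cu E x + disc E * su E x"
    "sq E (x + 1) = ms E * cq E x + disc E * sq E x"
    using csol_representation[OF c, of x] csol_representation[OF s, of x] assms sq_1
    by (simp_all add: disc_def mb_def ms_def)
qed

end

section \<open>Dependence on the energy\<close>

lemma isCont_integral:
  fixes F :: "real \<Rightarrow> real \<Rightarrow> real"
  assumes d: "0 < d"
    and int: "\<And>E. \<bar>E - E0\<bar> < d \<Longrightarrow> F E integrable_on {a..b}"
    and bd: "\<And>E x. \<bar>E - E0\<bar> < d \<Longrightarrow> x \<in> {a..b} \<Longrightarrow> \<bar>F E x\<bar> \<le> B"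
    and c: "\<And>x. x \<in> {a..b} \<Longrightarrow> isCont (\<lambda>E. F E x) E0"
  shows "isCont (\<lambda>E. integral {a..b} (F E)) E0"
proof (rule continuous_at_sequentiallyI)
  fix X assume X: "X \<longlonglongrightarrow> E0"
  define Y where "Y n = (if \<bar>X n - E0\<bar> < d then X n else E0)" for n
  have ev: "eventually (\<lambda>n. Y n = X n) sequentially"
    using tendstoD[OF X d] by eventually_elim (auto simp: Y_def dist_real_def)
  have Y: "Y \<longlonglongrightarrow> E0" using X by (rule Lim_transform_eventually) (use ev in \<open>eventually_elim, simp\<close>)
  have Yd: "\<bar>Y n - E0\<bar> < d" for n using d by (auto simp: Y_def)
  have "(\<lambda>n. integral {a..b} (F (Y n))) \<longlonglongrightarrow> integral {a..b} (F E0)"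
  proof (rule dominated_convergence(2))
    show "F (Y n) integrable_on {a..b}" for n using int[OF Yd] .
    show "(\<lambda>x. B) integrable_on {a..b}" by (rule integrable_const_ivl)
    show "norm (F (Y n) x) \<le> B" if "x \<in> {a..b}" for n x using bd[OF Yd that] by simp
    show "(\<lambda>n. F (Y n) x) \<longlonglongrightarrow> F E0 x" if "x \<in> {a..b}" for x
      using isCont_tendsto_compose[OF c[OF that] Y] .
  qed
  then show "(\<lambda>n. integral {a..b} (F (X n))) \<longlonglongrightarrow> integral {a..b} (F E0)"
    by (rule Lim_transform_eventually) (use ev in \<open>eventually_elim, simp\<close>)
qed

lemma isCont_if_lipschitz:
  fixes f :: "real \<Rightarrow> real"
  assumes "\<And>y. \<bar>y - x\<bar> < 1 \<Longrightarrow> \<bar>f y - f x\<bar> \<le> C * \<bar>y - x\<bar>"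
  shows "isCont f x"
  unfolding continuous_at
proof (rule LIM_zero_cancel, rule Lim_null_comparison)
  show "eventually (\<lambda>y. norm (f y - f x) \<le> C * \<bar>y - x\<bar>) (at x)"
    unfolding eventually_at by (intro exI[of _ 1]) (auto simp: dist_real_def intro: assms)
  show "((\<lambda>y. C * \<bar>y - x\<bar>) \<longlongrightarrow> 0) (at x)" by (auto intro!: tendsto_eq_intros)
qed

context sl_coeffs
begin

text \<open>The function exp (- L t) (u^2 + q^2) is nonincreasing, because the derivative of u^2 +
  q^2 is 2 u q (mu - E eps), which is at most L (u^2 + q^2).\<close>

lemma gronwall_bound:
  fixes u q :: "real \<Rightarrow> real"
  assumes K: "0 < K" "\<And>x. eps x \<le> K" "\<And>x. mu x \<le> K"
    and sol: "csol eps mu E 0 x u q" and x: "0 \<le> x" and L: "L = K * (1 + \<bar>E\<bar>)"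
  shows "(u x)\<^sup>2 + (q x)\<^sup>2 \<le> exp (L * x) * ((u 0)\<^sup>2 + (q 0)\<^sup>2)"
proof -
  obtain S where S: "finite S" "continuous_on {0..x} u" "continuous_on {0..x} q"
    "\<And>t. t \<in> {0<..<x} - S \<Longrightarrow> (u has_real_derivative mu t * q t) (at t)"
    "\<And>t. t \<in> {0<..<x} - S \<Longrightarrow> (q has_real_derivative - (E * (eps t * u t))) (at t)"
    using csol_realE[OF sol] by metis
  define g where "g t = exp (- (L * t)) * (2 * (u t * q t) * (mu t - E * eps t) - L * ((u t)\<^sup>2 + (q t)\<^sup>2))" for t
  have d: "((\<lambda>t. exp (- (L * t)) * ((u t)\<^sup>2 + (q t)\<^sup>2)) has_real_derivative g t) (at t)"
    if "t \<in> {0<..<x} - S" for t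
    using that by (auto intro!: derivative_eq_intros S simp: g_def algebra_simps power2_eq_square)
  have gi: "(g has_integral (exp (- (L * x)) * ((u x)\<^sup>2 + (q x)\<^sup>2) - exp (- (L * 0)) * ((u 0)\<^sup>2 + (q 0)\<^sup>2))) {0..x}"
    by (rule ftc_real[OF S(1) x _ d]) (use S in \<open>auto intro!: continuous_intros\<close>)
  have gn: "g t \<le> 0" for t
  proof -
    have "\<bar>mu t - E * eps t\<bar> \<le> \<bar>mu t\<bar> + \<bar>E\<bar> * \<bar>eps t\<bar>" by (metis abs_mult abs_triangle_ineq4)
    also have "\<dots> \<le> L"
      using K(2,3)[of t] mu_pos[of t] eps_pos[of t] mult_left_mono[OF K(2)[of t], of "\<bar>E\<bar>"]
      by (simp add: L algebra_simps)
    finally have 1: "\<bar>mu t - E * eps t\<bar> \<le> L" .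
    have "2 * (u t * q t) * (mu t - E * eps t) \<le> \<bar>2 * (u t * q t)\<bar> * \<bar>mu t - E * eps t\<bar>"
      by (metis abs_ge_self abs_mult)
    also have "\<dots> \<le> ((u t)\<^sup>2 + (q t)\<^sup>2) * L"
    proof (rule mult_mono[OF _ 1])
      show "\<bar>2 * (u t * q t)\<bar> \<le> (u t)\<^sup>2 + (q t)\<^sup>2"
        using sum_squares_bound[of "\<bar>u t\<bar>" "\<bar>q t\<bar>"] by (simp add: abs_mult)
    qed auto
    finally show ?thesis unfolding g_def by (intro mult_nonneg_nonpos) (auto simp: mult_ac)
  qed
  have "exp (- (L * x)) * ((u x)\<^sup>2 + (q x)\<^sup>2) - exp (- (L * 0)) * ((u 0)\<^sup>2 + (q 0)\<^sup>2) \<le> 0"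
    by (rule has_integral_le[OF gi has_integral_0 gn])
  then have "exp (- (L * x)) * ((u x)\<^sup>2 + (q x)\<^sup>2) \<le> (u 0)\<^sup>2 + (q 0)\<^sup>2" by simp
  then show ?thesis by (simp add: exp_minus field_simps)
qed

lemma fund_bound:
  obtains B where "0 < B" "\<And>E x. \<bar>E\<bar> \<le> A \<Longrightarrow> x \<in> {0..1} \<Longrightarrow>
     \<bar>cu E x\<bar> \<le> B \<and> \<bar>cq E x\<bar> \<le> B \<and> \<bar>su E x\<bar> \<le> B \<and> \<bar>sq E x\<bar> \<le> B"
proof -
  obtain K where K: "0 < K" "\<And>x. eps x \<le> K" "\<And>x. mu x \<le> K" using coeff_bound by metis
  define B where "B = exp (K * (1 + \<bar>A\<bar>))"
  have "\<bar>u x\<bar> \<le> B \<and> \<bar>q x\<bar> \<le> B" if E: "\<bar>E\<bar> \<le> A" and x: "x \<in> {0..1}"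
    and uq: "csol eps mu E 0 x u q" "(u 0)\<^sup>2 + (q 0)\<^sup>2 = 1" for E x and u q :: "real \<Rightarrow> real"
  proof -
    have "(u x)\<^sup>2 + (q x)\<^sup>2 \<le> exp (K * (1 + \<bar>E\<bar>) * x)"
      using gronwall_bound[OF K uq(1) _ refl] x uq(2) by simp
    also have "K * (1 + \<bar>E\<bar>) * x \<le> K * (1 + \<bar>E\<bar>) * 1"
      using x K(1) by (intro mult_left_mono) auto
    also have "\<dots> \<le> K * (1 + \<bar>A\<bar>)" using E K(1) by (auto intro!: mult_left_mono)
    finally have 1: "(u x)\<^sup>2 + (q x)\<^sup>2 \<le> B" by (simp add: B_def)
    \<comment> \<open>Since B is at least 1, passing to its square turns the bound on the squares
      into the bound B on the values themselves.\<close>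
    also have "B \<le> B\<^sup>2" using K(1) by (auto simp: B_def power2_eq_square)
    finally have "(u x)\<^sup>2 \<le> B\<^sup>2" "(q x)\<^sup>2 \<le> B\<^sup>2"
      by (metis add.commute add_increasing2 dual_order.trans le_add_same_cancel1 zero_le_power2 order_refl)+
    then show ?thesis using abs_le_square_iff[of "u x" B] abs_le_square_iff[of "q x" B] by (simp add: B_def)
  qed
  from this[OF _ _ csol_c] this[OF _ _ csol_s] show ?thesis
    by (intro that[of B]) (auto simp: B_def)
qed

abbreviation wint :: "real \<Rightarrow> (real \<Rightarrow> real) \<Rightarrow> (real \<Rightarrow> real) \<Rightarrow> real" where
  "wint x f g \<equiv> integral {0..x} (\<lambda>t. eps t * (f t * g t))"

lemma wint_bound:
  assumes K: "0 < K" "\<And>x. eps x \<le> K" and x: "x \<in> {0..1}"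
    and f: "continuous_on {0..x} f" "\<And>t. t \<in> {0..1} \<Longrightarrow> \<bar>f t\<bar> \<le> B"
    and g: "continuous_on {0..x} g" "\<And>t. t \<in> {0..1} \<Longrightarrow> \<bar>g t\<bar> \<le> B"
  shows "\<bar>wint x f g\<bar> \<le> K * (B * B)"
proof -
  have B: "0 \<le> B" using f(2)[of 0] by auto
  have "norm (wint x f g) \<le> integral {0..x} (\<lambda>t. K * (B * B))"
  proof (rule integral_norm_bound_integral)
    show "(\<lambda>t. eps t * (f t * g t)) integrable_on {0..x}"
      by (intro piecewise_cont_mult_integrable pc_eps continuous_intros f g)
    show "norm (eps t * (f t * g t)) \<le> K * (B * B)" if "t \<in> {0..x}" for t
      unfolding real_norm_def abs_mult
      by (intro mult_mono) (use that x K(1) K(2)[of t] eps_pos[of t] f(2)[of t] g(2)[of t] B in auto)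
  qed auto
  also have "\<dots> = x * (K * (B * B))" using x by simp
  also have "\<dots> \<le> 1 * (K * (B * B))" using x K B by (intro mult_right_mono) auto
  finally show ?thesis by simp
qed

text \<open>Lagrange's identity pairs a solution at energy E with both fundamental solutions at F;
  solving these relations with the unit Wronskian at F yields the difference. The formula is exact,
  so continuity in E, and then differentiability, can be read off the factor multiplying E -
  F.\<close>

lemma variation_of_energy:
  assumes x: "0 \<le> x"
  shows "cu E x - cu F x = (E - F) * (cu F x * wint x (cu E) (su F) - su F x * wint x (cu E) (cu F))"
    "cq E x - cq F x = (E - F) * (cq F x * wint x (cu E) (su F) - sq F x * wint x (cu E) (cu F))"
    "su E x - su F x = (E - F) * (cu F x * wint x (su E) (su F) - su F x * wint x (su E) (cu F))"
    "sq E x - sq F x = (E - F) * (cq F x * wint x (su E) (su F) - sq F x * wint x (su E) (cu F))"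
proof -
  note L = lagrange_identity[of eps mu E 0 x _ _ F, OF _ _ x, THEN integral_unique, simplified]
  have 1: "cu E x * cq F x - cu F x * cq E x = (E - F) * wint x (cu E) (cu F)"
    using L[OF csol_c csol_c] by simp
  have 2: "cu E x * sq F x - su F x * cq E x - 1 = (E - F) * wint x (cu E) (su F)"
    using L[OF csol_c csol_s] by simp
  have 3: "su E x * cq F x - cu F x * sq E x + 1 = (E - F) * wint x (su E) (cu F)"
    using L[OF csol_s csol_c] by simp
  have 4: "su E x * sq F x - su F x * sq E x = (E - F) * wint x (su E) (su F)"
    using L[OF csol_s csol_s] by simp
  have W: "cu F x * sq F x = 1 + su F x * cq F x" using wronskian[OF x, of F] by simp
  have r: "(E - F) * (p * i - r * j) = p * ((E - F) * i) - r * ((E - F) * j)" for p r i j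
    by (simp add: algebra_simps)
  have "cu E x - cu F x = cu F x * (cu E x * sq F x - su F x * cq E x - 1) - su F x * (cu E x * cq F x - cu F x * cq E x)"
    using arg_cong[OF W, of "\<lambda>z. cu E x * z"] by (simp add: algebra_simps)
  then show "cu E x - cu F x = (E - F) * (cu F x * wint x (cu E) (su F) - su F x * wint x (cu E) (cu F))"
    unfolding r 1 2 .
  have "cq E x - cq F x = cq F x * (cu E x * sq F x - su F x * cq E x - 1) - sq F x * (cu E x * cq F x - cu F x * cq E x)"
    using arg_cong[OF W, of "\<lambda>z. cq E x * z"] by (simp add: algebra_simps)
  then show "cq E x - cq F x = (E - F) * (cq F x * wint x (cu E) (su F) - sq F x * wint x (cu E) (cu F))"
    unfolding r 1 2 .
  have "su E x - su F x = cu F x * (su E x * sq F x - su F x * sq E x) - su F x * (su E x * cq F x - cu F x * sq E x + 1)"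
    using arg_cong[OF W, of "\<lambda>z. su E x * z"] by (simp add: algebra_simps)
  then show "su E x - su F x = (E - F) * (cu F x * wint x (su E) (su F) - su F x * wint x (su E) (cu F))"
    unfolding r 3 4 .
  have "sq E x - sq F x = cq F x * (su E x * sq F x - su F x * sq E x) - sq F x * (su E x * cq F x - cu F x * sq E x + 1)"
    using arg_cong[OF W, of "\<lambda>z. sq E x * z"] by (simp add: algebra_simps)
  then show "sq E x - sq F x = (E - F) * (cq F x * wint x (su E) (su F) - sq F x * wint x (su E) (cu F))"
    unfolding r 3 4 .
qed

text \<open>All factors in the difference formula are bounded uniformly for energies within distance
  1 of F, so the dependence on E is Lipschitz at F.\<close>

lemma fund_isCont:
  assumes x: "x \<in> {0..1}"
  shows "isCont (\<lambda>E. cu E x) F" "isCont (\<lambda>E. cq E x) F" "isCont (\<lambda>E. su E x) F" "isCont (\<lambda>E. sq E x) F"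
proof -
  obtain K where K: "0 < K" "\<And>x. eps x \<le> K" using coeff_bound by metis
  obtain B where B: "0 < B" "\<And>E x. \<bar>E\<bar> \<le> \<bar>F\<bar> + 1 \<Longrightarrow> x \<in> {0..1} \<Longrightarrow>
     \<bar>cu E x\<bar> \<le> B \<and> \<bar>cq E x\<bar> \<le> B \<and> \<bar>su E x\<bar> \<le> B \<and> \<bar>sq E x\<bar> \<le> B" using fund_bound by metis
  define C where "C = B * (K * (B * B)) + B * (K * (B * B))"
  have x0: "0 \<le> x" using x by simp
  have est: "\<bar>(E - F) * (p * i - r * j)\<bar> \<le> C * \<bar>E - F\<bar>"
    if "\<bar>p\<bar> \<le> B" "\<bar>r\<bar> \<le> B" "\<bar>i\<bar> \<le> K * (B * B)" "\<bar>j\<bar> \<le> K * (B * B)" for p r i j E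
  proof -
    have "\<bar>p * i - r * j\<bar> \<le> \<bar>p\<bar> * \<bar>i\<bar> + \<bar>r\<bar> * \<bar>j\<bar>" by (metis abs_mult abs_triangle_ineq4)
    also have "\<dots> \<le> C" unfolding C_def using that B(1) by (intro add_mono mult_mono) auto
    finally have "\<bar>p * i - r * j\<bar> \<le> C" .
    from mult_left_mono[OF this, of "\<bar>E - F\<bar>"] show ?thesis by (simp add: abs_mult mult.commute)
  qed
  have W: "\<bar>wint x (f E) (g F)\<bar> \<le> K * (B * B)"
    if "\<bar>E - F\<bar> < 1" "f \<in> {cu, su}" "g \<in> {cu, su}" for E f g
  proof (rule wint_bound[OF K x])
    have "\<bar>E\<bar> \<le> \<bar>F\<bar> + 1" using that(1) by linarith
    then show "\<bar>f E t\<bar> \<le> B" "\<bar>g F t\<bar> \<le> B" if "t \<in> {0..1}" for t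
      using B(2)[of E t] B(2)[of F t] that \<open>f \<in> {cu, su}\<close> \<open>g \<in> {cu, su}\<close> by auto
    show "continuous_on {0..x} (f E)" "continuous_on {0..x} (g F)"
      using that(2,3) fund_continuous by blast+
  qed
  have bF: "\<bar>cu F x\<bar> \<le> B" "\<bar>cq F x\<bar> \<le> B" "\<bar>su F x\<bar> \<le> B" "\<bar>sq F x\<bar> \<le> B" using B(2)[of F x] x by auto
  show "isCont (\<lambda>E. cu E x) F" "isCont (\<lambda>E. cq E x) F" "isCont (\<lambda>E. su E x) F" "isCont (\<lambda>E. sq E x) F"
    by (rule isCont_if_lipschitz[of _ _ C], unfold variation_of_energy[OF x0], intro est bF W; simp)+
qed

lemma wint_isCont:
  assumes "f \<in> {cu, su}" and g: "continuous_on {0..1} g"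
  shows "isCont (\<lambda>E. wint 1 (f E) g) F"
proof -
  obtain K where K: "0 < K" "\<And>x. eps x \<le> K" using coeff_bound by metis
  obtain B where B: "0 < B" "\<And>E x. \<bar>E\<bar> \<le> \<bar>F\<bar> + 1 \<Longrightarrow> x \<in> {0..1} \<Longrightarrow>
     \<bar>cu E x\<bar> \<le> B \<and> \<bar>cq E x\<bar> \<le> B \<and> \<bar>su E x\<bar> \<le> B \<and> \<bar>sq E x\<bar> \<le> B" using fund_bound by metis
  obtain G where G: "\<forall>x\<in>{0..1}. \<bar>g x\<bar> \<le> G"
    using compact_imp_bounded[OF compact_continuous_image[OF g compact_Icc]]
    unfolding bounded_iff by auto
  have fB: "\<bar>f E x\<bar> \<le> B" if "\<bar>E - F\<bar> < 1" "x \<in> {0..1}" for E x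
    using assms(1) B(2)[of E x] that by auto
  have fc: "continuous_on {0..1} (f E)" for E using assms(1) fund_continuous by auto
  have fi: "isCont (\<lambda>E. f E x) F" if "x \<in> {0..1}" for x using assms(1) fund_isCont[OF that] by auto
  show ?thesis
  proof (rule isCont_integral[of 1 F _ 0 1 "K * (B * G)"])
    show "(\<lambda>t. eps t * (f E t * g t)) integrable_on {0..1}" for E
      by (intro piecewise_cont_mult_integrable pc_eps continuous_intros fc g)
    show "\<bar>eps x * (f E x * g x)\<bar> \<le> K * (B * G)" if "\<bar>E - F\<bar> < 1" "x \<in> {0..1}" for E x
      unfolding abs_mult
      by (intro mult_mono) (use that K(1) K(2)[of x] eps_pos[of x] fB G B(1) in auto)
    show "isCont (\<lambda>E. eps x * (f E x * g x)) F" if "x \<in> {0..1}" for x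
      using fi[OF that] by (auto intro!: continuous_intros)
  qed simp
qed

text \<open>\<open>PP\<close>, \<open>QQ\<close>, \<open>RR\<close> are the entries of the Gram
  matrix of \<open>cu E\<close> and \<open>su E\<close> for the weight \<open>eps\<close> over one
  period. Its positive definiteness decides the sign of every derivative in E below.\<close>

definition "PP E = wint 1 (cu E) (cu E)"
definition "QQ E = wint 1 (cu E) (su E)"
definition "RR E = wint 1 (su E) (su E)"

text \<open>Caratheodory's form of the derivative applied to the difference formulas. The
  discriminant is differentiated twice, once as \<open>cu E 1\<close> and once as
  \<open>sq E 1\<close>; averaging the two expressions eliminates \<open>QQ\<close>.\<close>

lemma monodromy_deriv:
  shows "(disc has_real_derivative (mb E * RR E - ms E * PP E) / 2) (at E)"
    "(mb has_real_derivative mb E * QQ E - disc E * PP E) (at E)"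
    "(ms has_real_derivative disc E * RR E - ms E * QQ E) (at E)"
proof -
  have carat: "(f has_real_derivative l) (at E)"
    if "\<And>z. f z - f E = (z - E) * (p * i z - r * j z)" "isCont i E" "isCont j E" "l = p * i E - r * j E"
    for f p r i j l
    unfolding CARAT_DERIV
    by (rule exI[of _ "\<lambda>z. p * i z - r * j z"]) (use that in \<open>auto intro!: continuous_intros\<close>)
  have comm: "wint 1 (su E) (cu E) = QQ E" unfolding QQ_def by (simp add: mult_ac)
  note c = wint_isCont[of cu, OF _ fund_continuous(1)] wint_isCont[of cu, OF _ fund_continuous(3)]
    wint_isCont[of su, OF _ fund_continuous(1)] wint_isCont[of su, OF _ fund_continuous(3)]
  have 1: "(disc has_real_derivative disc E * QQ E - ms E * PP E) (at E)"
    by (rule carat[where i = "\<lambda>z. wint 1 (cu z) (su E)" and j = "\<lambda>z. wint 1 (cu z) (cu E)"])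
       (use c variation_of_energy(1)[of 1] in \<open>auto simp: disc_def ms_def QQ_def PP_def\<close>)
  have 2: "(disc has_real_derivative mb E * RR E - disc E * QQ E) (at E)"
    by (rule carat[where i = "\<lambda>z. wint 1 (su z) (su E)" and j = "\<lambda>z. wint 1 (su z) (cu E)"])
       (use c variation_of_energy(4)[of 1] comm in \<open>auto simp: mb_def sq_1 RR_def\<close>)
  have half: "x - y = (z - y) / 2" if "x - y = z - x" for x y z :: real using that by simp
  have "disc E * QQ E - ms E * PP E = (mb E * RR E - ms E * PP E) / 2"
    by (rule half[OF DERIV_unique[OF 1 2]])
  with 1 show "(disc has_real_derivative (mb E * RR E - ms E * PP E) / 2) (at E)" by simp
  show "(mb has_real_derivative mb E * QQ E - disc E * PP E) (at E)"
    by (rule carat[where i = "\<lambda>z. wint 1 (cu z) (su E)" and j = "\<lambda>z. wint 1 (cu z) (cu E)"])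
       (use c variation_of_energy(2)[of 1] in \<open>auto simp: mb_def sq_1 QQ_def PP_def\<close>)
  show "(ms has_real_derivative disc E * RR E - ms E * QQ E) (at E)"
    by (rule carat[where i = "\<lambda>z. wint 1 (su z) (su E)" and j = "\<lambda>z. wint 1 (su z) (cu E)"])
       (use c variation_of_energy(3)[of 1] comm in \<open>auto simp: disc_def ms_def RR_def\<close>)
qed

lemma monodromy_isCont: "isCont disc E" "isCont mb E" "isCont ms E"
  using monodromy_deriv DERIV_isCont by blast+

text \<open>If \<open>su E\<close> vanished on the whole period, so would its derivative
  \<open>mu * sq E\<close> off a finite set, although \<open>sq E\<close> is close to 1 near
  0.\<close>

lemma su_nonzero: "\<exists>x\<in>{0..1}. su E x \<noteq> 0"
proof (rule ccontr)
  assume "\<not> ?thesis"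
  then have z: "\<And>x. x \<in> {0..1} \<Longrightarrow> su E x = 0" by blast
  obtain S where S: "finite S" "continuous_on {0..1} (su E)" "continuous_on {0..1} (sq E)"
    "\<And>x. x \<in> {0<..<1} - S \<Longrightarrow> (su E has_real_derivative mu x * sq E x) (at x)"
    using csol_realE[OF csol_s[of E 1]] by metis
  obtain d where d: "d > 0" "\<And>y. y \<in> {0..1} \<Longrightarrow> dist y 0 < d \<Longrightarrow> dist (sq E y) (sq E 0) < 1"
    using S(3) unfolding continuous_on_iff by (metis atLeastAtMost_iff le_numeral_extra(3) zero_less_one less_imp_le)
  have "infinite ({0<..<min 1 d} - S)"
    using S(1) d(1) by (simp add: Diff_infinite_finite infinite_Ioo)
  then obtain x where x: "x \<in> {0<..<min 1 d} - S" using infinite_imp_nonempty by blast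
  have "((\<lambda>_. 0) has_real_derivative mu x * sq E x) (at x)"
    by (rule has_field_derivative_transform_within_open[OF S(4), of x "{0<..<1}"]) (use x z in auto)
  then have "mu x * sq E x = 0" using DERIV_unique DERIV_const by blast
  then have "sq E x = 0" using mu_pos[of x] by simp
  moreover have "dist (sq E x) (sq E 0) < 1" using d(2)[of x] x by (auto simp: dist_real_def)
  ultimately show False by (simp add: dist_real_def)
qed

lemma PP_pos: "0 < PP E" and RR_pos: "0 < RR E"
proof -
  show "0 < PP E" unfolding PP_def
    by (rule weighted_integral_pos[of _ 0]) (auto intro!: continuous_intros fund_continuous)
  obtain x where "x \<in> {0..1}" "su E x \<noteq> 0" using su_nonzero by blast
  then show "0 < RR E" unfolding RR_def
    by (intro weighted_integral_pos[of _ x])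
       (auto intro!: continuous_intros fund_continuous simp: zero_less_mult_iff)
qed

text \<open>The form equals the weighted integral of \<open>?f\<close>, and completing the square
  gives A \<open>?f\<close> = (A cu + B su)^2 + (A C - B^2) su^2. At x = 0 the value of
  \<open>?f\<close> is A > 0, which makes the integral strictly positive.\<close>

lemma quadratic_form_pos:
  assumes A: "0 < A" and D: "B\<^sup>2 < A * C"
  shows "0 < A * PP E + 2 * B * QQ E + C * RR E"
proof -
  let ?f = "\<lambda>x. A * (cu E x * cu E x) + 2 * B * (cu E x * su E x) + C * (su E x * su E x)"
  have fx: "0 \<le> ?f x" for x
  proof -
    have "A * ?f x = (A * cu E x + B * su E x)\<^sup>2 + (A * C - B\<^sup>2) * (su E x)\<^sup>2"
      by (simp add: algebra_simps power2_eq_square)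
    also have "\<dots> \<ge> 0" using D by (intro add_nonneg_nonneg mult_nonneg_nonneg) auto
    finally show ?thesis using A by (simp add: zero_le_mult_iff)
  qed
  have int: "(\<lambda>t. eps t * (f t * g t)) integrable_on {0..1}"
    if "continuous_on {0..1} f" "continuous_on {0..1} g" for f g
    by (intro piecewise_cont_mult_integrable pc_eps continuous_intros that)
  note i = int[OF fund_continuous(1) fund_continuous(1), of E E]
    int[OF fund_continuous(1) fund_continuous(3), of E E] int[OF fund_continuous(3) fund_continuous(3), of E E]
  have "0 < integral {0..1} (\<lambda>x. eps x * ?f x)"
    by (rule weighted_integral_pos[of _ 0]) (use A fx in \<open>auto intro!: continuous_intros fund_continuous\<close>)
  also have "\<dots> = integral {0..1} (\<lambda>x. A * (eps x * (cu E x * cu E x)) + 2 * B * (eps x * (cu E x * su E x))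
       + C * (eps x * (su E x * su E x)))"
    by (rule integral_cong) (simp add: algebra_simps)
  finally have "0 < integral {0..1} (\<lambda>x. A * (eps x * (cu E x * cu E x)) + 2 * B * (eps x * (cu E x * su E x))
       + C * (eps x * (su E x * su E x)))" .
  moreover have "((\<lambda>x. A * (eps x * (cu E x * cu E x)) + 2 * B * (eps x * (cu E x * su E x))
       + C * (eps x * (su E x * su E x))) has_integral A * PP E + 2 * B * QQ E + C * RR E) {0..1}"
    unfolding PP_def QQ_def RR_def
    by (intro has_integral_add has_integral_mult_right integrable_integral i)
  ultimately show ?thesis by (simp add: integral_unique)
qed

end

section \<open>The discriminant\<close>

text \<open>Along a sequence of level points converging to p all difference quotients vanish. This
  is the device by which eigenvalues are shown to be discrete.\<close>

lemma deriv_zero_at_limpt_of_level_set: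
  fixes f :: "real \<Rightarrow> real"
  assumes d: "(f has_real_derivative l) (at p)" and p: "p islimpt {x. f x = c}"
  shows "f p = c" "l = 0"
proof -
  obtain X where X: "\<And>n. X n \<in> {x. f x = c} - {p}" "X \<longlonglongrightarrow> p"
    using p unfolding islimpt_sequential by blast
  have "(\<lambda>n. f (X n)) \<longlonglongrightarrow> f p" using isCont_tendsto_compose[OF DERIV_isCont[OF d] X(2)] .
  moreover have "(\<lambda>n. f (X n)) = (\<lambda>n. c)" using X(1) by auto
  ultimately show fp: "f p = c" using LIMSEQ_unique tendsto_const by metis
  have "((\<lambda>y. (f y - f p) / (y - p)) \<longlongrightarrow> l) (at p)"
    using d by (simp add: has_field_derivative_iff)
  then have "((\<lambda>n. (f (X n) - f p) / (X n - p)) \<longlongrightarrow> l) sequentially"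
    by (rule filterlim_compose) (use X in \<open>auto simp: filterlim_at\<close>)
  moreover have "(\<lambda>n. (f (X n) - f p) / (X n - p)) = (\<lambda>n. 0)" using X(1) fp by auto
  ultimately show "l = 0" using LIMSEQ_unique tendsto_const by metis
qed

text \<open>Algebra behind the Pruefer transform: w = sqrt E, N is the squared radius, R the angular
  rate, C and S are cosine and sine of the angle, m and e the coefficients. Along solutions the
  derivative of N is 2 E u q (m - e), so both identities have the shape f' N = f N' / 2, which says
  that f / sqrt N is constant.\<close>

lemma pruefer_algebra:
  fixes w E N R u q m e C S :: real
  assumes "w * w = E" "N = q\<^sup>2 + E * u\<^sup>2" "R * N = w * (m * q\<^sup>2 + e * (E * u\<^sup>2))"
  shows "(w * (m * q) * C - w * u * (S * R) + E * (e * u) * S - q * (C * R)) * N =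
      (w * u * C - q * S) * (E * (u * q * (m - e)))"
    "(w * (m * q) * S + w * u * (C * R) - E * (e * u) * C - q * (S * R)) * N =
      (w * u * S + q * C) * (E * (u * q * (m - e)))"
proof -
  have "(w * (m * q) * C - w * u * (S * R) + E * (e * u) * S - q * (C * R)) * N =
     w * (m * q) * C * N - w * u * S * (R * N) + E * (e * u) * S * N - q * C * (R * N)"
    by (simp add: algebra_simps)
  then show "(w * (m * q) * C - w * u * (S * R) + E * (e * u) * S - q * (C * R)) * N =
      (w * u * C - q * S) * (E * (u * q * (m - e)))"
    unfolding assms(3) unfolding assms(2) assms(1)[symmetric] by (simp add: algebra_simps power2_eq_square)
  have "(w * (m * q) * S + w * u * (C * R) - E * (e * u) * C - q * (S * R)) * N =
     w * (m * q) * S * N + w * u * C * (R * N) - E * (e * u) * C * N - q * S * (R * N)"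
    by (simp add: algebra_simps)
  then show "(w * (m * q) * S + w * u * (C * R) - E * (e * u) * C - q * (S * R)) * N =
      (w * u * S + q * C) * (E * (u * q * (m - e)))"
    unfolding assms(3) unfolding assms(2) assms(1)[symmetric] by (simp add: algebra_simps power2_eq_square)
qed

context sl_coeffs
begin

text \<open>For E < 0 the energy identity makes u q strictly larger at 1 than at 0 for both
  fundamental solutions. As both products start at 0, D b and s D are positive, hence so is b s =
  D^2 - 1.\<close>

lemma disc_gt_1_if_neg:
  assumes "E < 0" shows "1 < \<bar>disc E\<bar>"
proof -
  have int: "(\<lambda>t. eps t * (f t * f t)) integrable_on {0..1}" if "continuous_on {0..1} f" for f
    by (intro piecewise_cont_mult_integrable pc_eps continuous_intros that)
  have le: "- E * wint 1 u u \<le> u 1 * q 1 - u 0 * q 0"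
    if "csol eps mu E 0 1 u q" for u q
  proof -
    have u: "continuous_on {0..1} u" using that by (simp add: csol_def)
    have "((\<lambda>x. - E * (eps x * (u x * u x))) has_integral - E * wint 1 u u) {0..1}"
      by (intro has_integral_mult_right integrable_integral int u)
    from has_integral_le[OF this energy_identity[OF that]] show ?thesis
      using less_imp_le[OF mu_pos] by (simp add: power2_eq_square)
  qed
  have "0 < disc E * mb E"
    using le[OF csol_c] PP_pos[of E] mult_pos_pos[of "- E" "PP E"] assms by (simp add: PP_def disc_def mb_def)
  moreover have "0 < ms E * disc E"
    using le[OF csol_s] RR_pos[of E] mult_pos_pos[of "- E" "RR E"] assms by (simp add: RR_def sq_1 ms_def)
  ultimately have "0 < mb E * ms E" by (auto simp: zero_less_mult_iff)
  then have "1\<^sup>2 < \<bar>disc E\<bar>\<^sup>2" using det[of E] by simp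
  then show ?thesis by (rule power2_less_imp_less) simp
qed

text \<open>Level points lie in the compact interval \<open>{0..E}\<close>, so infinitely many would
  accumulate at some p with D'(p) = 0, that is b R = s P. Then b s >= 0 at p, whereas b s = c^2 - 1
  <= 0; so b and s both vanish at p and c^2 = 1.\<close>

lemma finite_disc_level_set:
  assumes "\<bar>c\<bar> \<le> 1" shows "finite {l. l \<le> E \<and> disc l = c}"
proof (rule ccontr)
  let ?Z = "{l. l \<le> E \<and> disc l = c}"
  assume inf: "infinite ?Z"
  have sub: "?Z \<subseteq> {0..E}" 
  proof
    fix l assume "l \<in> ?Z"
    then show "l \<in> {0..E}" using disc_gt_1_if_neg[of l] assms by (cases "l < 0") auto
  qed
  obtain p where "p islimpt ?Z"
    using Heine_Borel_imp_Bolzano_Weierstrass[OF compact_Icc inf sub] by blast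
  then have p: "p islimpt {l. disc l = c}" by (rule islimpt_subset) auto
  note d = deriv_zero_at_limpt_of_level_set[OF monodromy_deriv(1) p]
  have eq: "mb p * RR p = ms p * PP p" using d(2) by simp
  have P: "0 < PP p" "0 < RR p" by (fact PP_pos RR_pos)+
  have det_p: "c\<^sup>2 - mb p * ms p = 1" using det[of p] d(1) by simp
  have "(ms p)\<^sup>2 * PP p = ms p * mb p * RR p" using eq by (simp add: power2_eq_square mult_ac)
  then have "0 \<le> (mb p * ms p) * RR p" using P(1) by (metis mult.commute mult_nonneg_nonneg less_imp_le zero_le_power2)
  then have ge: "0 \<le> mb p * ms p" using P(2) by (simp add: zero_le_mult_iff)
  have c1: "c\<^sup>2 \<le> 1" using assms abs_square_le_1 by blast
  then have z: "mb p * ms p = 0" "c\<^sup>2 = 1" using det_p ge by linarith+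
  then have "mb p = 0" "ms p = 0" using eq P by auto
  \<comment> \<open>With c^2 = 1 every level point is a zero of b or of s, so zeros of one of them
    accumulate at p. But at p their derivatives are - D P and D R, neither of which is 0.\<close>
  have "{l. disc l = c} \<subseteq> {l. mb l = 0} \<union> {l. ms l = 0}"
    using det z(2) by (auto simp: algebra_simps)
  then have "p islimpt {l. mb l = 0} \<or> p islimpt {l. ms l = 0}"
    using islimpt_subset[OF p] islimpt_Un by blast
  then show False
  proof
    assume "p islimpt {l. mb l = 0}"
    from deriv_zero_at_limpt_of_level_set(2)[OF monodromy_deriv(2) this] \<open>mb p = 0\<close> d(1) z(2) P
    show False by auto
  next
    assume "p islimpt {l. ms l = 0}"
    from deriv_zero_at_limpt_of_level_set(2)[OF monodromy_deriv(3) this] \<open>ms p = 0\<close> d(1) z(2) P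
    show False by auto
  qed
qed

text \<open>A Pruefer transform: \<open>pr_angle E\<close> is the angle swept over one period by the vector
  \<open>(sqrt E * u, q)\<close>, started on the axis \<open>q = 0\<close>. It is continuous in \<open>E\<close> and tends to infinity;
  when it is an integer multiple of \<open>pi\<close>, the flux vanishes at the end of the period and the
  discriminant is \<open>1\<close> or \<open>- 1\<close> according to the parity of that integer.\<close>

definition "prN E x = (cq E x)\<^sup>2 + E * (cu E x)\<^sup>2"

text \<open>The angular velocity of (sqrt E u, q), split into two products of a coefficient with a
  continuous function, the shape for which integrability is available.\<close>

definition "pr_rate E x = mu x * (sqrt E * (cq E x)\<^sup>2 / prN E x) + eps x * (sqrt E * (E * (cu E x)\<^sup>2) / prN E x)"

definition "pr_angle E = integral {0..1} (pr_rate E)"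

lemma prN_pos: assumes "0 < E" "0 \<le> x" shows "0 < prN E x"
proof -
  have "cu E x \<noteq> 0 \<or> cq E x \<noteq> 0" using wronskian[OF assms(2), of E] by auto
  then show ?thesis using assms(1) unfolding prN_def
    by (auto simp: add_nonneg_pos add_pos_nonneg)
qed

lemma pr_rate_integrable:
  assumes "0 < E" "0 \<le> b" shows "pr_rate E integrable_on {0..b}"
proof -
  have "continuous_on {0..b} (\<lambda>x. sqrt E * (cq E x)\<^sup>2 / prN E x)"
    "continuous_on {0..b} (\<lambda>x. sqrt E * (E * (cu E x)\<^sup>2) / prN E x)"
    using prN_pos[OF assms(1)] unfolding prN_def
    by (auto intro!: continuous_intros fund_continuous) (metis less_irrefl)+
  then show ?thesis unfolding pr_rate_def
    by (intro integrable_add piecewise_cont_mult_integrable pc_eps pc_mu)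
qed

text \<open>The angle is the integral of its rate, so no branch of the arctangent is chosen. Instead
  the vector (sqrt E u, q) is rotated back by the angle: its components \<open>?A\<close> and
  \<open>?B\<close>, divided by the radius, have derivative 0 off a finite set and keep their
  initial values 1 and 0.\<close>

lemma pr_angle_polar:
  assumes E: "0 < E"
  obtains r where "0 < r" "sqrt E * disc E = r * cos (pr_angle E)" "mb E = - (r * sin (pr_angle E))"
proof -
  define w where "w = sqrt E"
  have w: "0 < w" "w * w = E" using E by (auto simp: w_def)
  define \<phi> where "\<phi> x = integral {0..x} (pr_rate E)" for x
  obtain S where S: "finite S" "continuous_on {0..1} (cu E)" "continuous_on {0..1} (cq E)"
    "\<And>x. x \<in> {0<..<1} - S \<Longrightarrow> (cu E has_real_derivative mu x * cq E x) (at x)"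
    "\<And>x. x \<in> {0<..<1} - S \<Longrightarrow> (cq E has_real_derivative - (E * (eps x * cu E x))) (at x)"
    using csol_realE[OF csol_c[of E 1]] by metis
  define T where "T = S \<union> ({x \<in> {0..1}. \<not> isCont eps x} \<union> {x \<in> {0..1}. \<not> isCont mu x})"
  have T: "finite T" using S(1) pc_eps pc_mu unfolding T_def piecewise_cont_def by blast
  have N: "0 < prN E x" if "x \<in> {0..1}" for x using prN_pos[OF E] that by simp
  have Nc: "continuous_on {0..1} (prN E)" unfolding prN_def[abs_def] by (intro continuous_intros S)
  have \<phi>c: "continuous_on {0..1} \<phi>"
    unfolding \<phi>_def by (rule indefinite_integral_continuous_1[OF pr_rate_integrable[OF E]]) simp
  have d\<phi>: "(\<phi> has_real_derivative pr_rate E x) (at x)" if x: "x \<in> {0<..<1} - T" for x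
    unfolding has_real_derivative_iff_has_vector_derivative
  proof (rule has_vector_derivative_if_has_integral)
    show "x \<in> {0<..<1}" using x by simp
    show "(pr_rate E has_integral (\<phi> y - \<phi> 0)) {0..y}" if "y \<in> {0..1}" for y
      using that pr_rate_integrable[OF E, of y] by (simp add: \<phi>_def integrable_integral)
    have "isCont mu x" "isCont eps x" using x by (auto simp: T_def)
    moreover have "isCont (cu E) x" "isCont (cq E) x"
      using continuous_on_interior[OF S(2), of x] continuous_on_interior[OF S(3), of x] x
      by (auto simp: interior_atLeastAtMost_real)
    ultimately show "isCont (pr_rate E) x"
      using N[of x] x unfolding pr_rate_def[abs_def] prN_def
      by (intro continuous_intros) auto
  qed
  let ?A = "\<lambda>x. w * cu E x * cos (\<phi> x) - cq E x * sin (\<phi> x)"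
  let ?B = "\<lambda>x. w * cu E x * sin (\<phi> x) + cq E x * cos (\<phi> x)"
  have dN: "(prN E has_real_derivative 2 * (E * (cu E x * cq E x * (mu x - eps x)))) (at x)"
    if "x \<in> {0<..<1} - T" for x
    unfolding prN_def[abs_def] using that
    by (auto intro!: derivative_eq_intros S simp: T_def algebra_simps power2_eq_square)
  have rate: "pr_rate E x * prN E x = w * (mu x * (cq E x)\<^sup>2 + eps x * (E * (cu E x)\<^sup>2))"
    if "x \<in> {0..1}" for x
    using N[OF that] by (simp add: pr_rate_def w_def field_simps)
  define dA where "dA x = w * (mu x * cq E x) * cos (\<phi> x) - w * cu E x * (sin (\<phi> x) * pr_rate E x)
      + E * (eps x * cu E x) * sin (\<phi> x) - cq E x * (cos (\<phi> x) * pr_rate E x)" for x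
  define dB where "dB x = w * (mu x * cq E x) * sin (\<phi> x) + w * cu E x * (cos (\<phi> x) * pr_rate E x)
      - E * (eps x * cu E x) * cos (\<phi> x) - cq E x * (sin (\<phi> x) * pr_rate E x)" for x
  have dA: "(?A has_real_derivative dA x) (at x)" if "x \<in> {0<..<1} - T" for x
    using that by (auto intro!: derivative_eq_intros S d\<phi> simp: T_def dA_def algebra_simps)
  have dB: "(?B has_real_derivative dB x) (at x)" if "x \<in> {0<..<1} - T" for x
    using that by (auto intro!: derivative_eq_intros S d\<phi> simp: T_def dB_def algebra_simps)
  have keyA: "dA x * prN E x = ?A x * (E * (cu E x * cq E x * (mu x - eps x)))" if "x \<in> {0..1}" for x
    unfolding dA_def by (rule pruefer_algebra(1)[OF w(2) prN_def rate[OF that]])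
  have keyB: "dB x * prN E x = ?B x * (E * (cu E x * cq E x * (mu x - eps x)))" if "x \<in> {0..1}" for x
    unfolding dB_def by (rule pruefer_algebra(2)[OF w(2) prN_def rate[OF that]])
  have const: "f 1 / sqrt (prN E 1) = f 0 / sqrt (prN E 0)"
    if fc: "continuous_on {0..1} f" and df: "\<And>x. x \<in> {0<..<1} - T \<Longrightarrow> (f has_real_derivative df x) (at x)"
      and key: "\<And>x. x \<in> {0..1} \<Longrightarrow> df x * prN E x = f x * (E * (cu E x * cq E x * (mu x - eps x)))"
    for f df
  proof -
    have "((\<lambda>x. f x / sqrt (prN E x)) has_real_derivative 0) (at x)" if x: "x \<in> {0<..<1} - T" for x
    proof -
      let ?n = "prN E x" and ?c = "E * (cu E x * cq E x * (mu x - eps x))"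
      have n: "0 < ?n" using N x by simp
      have "((\<lambda>x. sqrt (prN E x)) has_real_derivative inverse (sqrt ?n) / 2 * (2 * ?c)) (at x)"
        using DERIV_chain2[OF DERIV_real_sqrt[OF n] dN[OF x]] .
      from DERIV_divide[OF df[OF x] this] n
      have "((\<lambda>x. f x / sqrt (prN E x)) has_real_derivative
         (df x * sqrt ?n - f x * (inverse (sqrt ?n) / 2 * (2 * ?c))) / (sqrt ?n * sqrt ?n)) (at x)" by simp
      moreover have "df x * sqrt ?n - f x * (inverse (sqrt ?n) / 2 * (2 * ?c)) = 0"
      proof -
        have 1: "df x * sqrt ?n = (df x * ?n) / sqrt ?n"
          using n by (metis real_div_sqrt less_imp_le times_divide_eq_right)
        have 2: "y * (inverse s / 2 * (2 * z)) = y * z / s" for y z s :: real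
          by (simp add: field_simps)
        have "df x * ?n = f x * ?c" by (rule key) (use x in auto)
        then show ?thesis unfolding 1 2 by (simp only: diff_self)
      qed
      ultimately show ?thesis by simp
    qed
    note d0 = this
    have "((\<lambda>x. 0) has_integral (f 1 / sqrt (prN E 1) - f 0 / sqrt (prN E 0))) {0..1::real}"
    proof (rule ftc_real[where f = "\<lambda>x. f x / sqrt (prN E x)", OF T _ _ d0])
      have "prN E x \<noteq> 0" if "x \<in> {0..1}" for x using N[OF that] by simp
      then show "continuous_on {0..1} (\<lambda>x. f x / sqrt (prN E x))"
        by (intro continuous_intros fc Nc) auto
    qed auto
    from has_integral_unique[OF this has_integral_0] show ?thesis by simp
  qed
  have \<phi>0: "\<phi> 0 = 0" and \<phi>1: "\<phi> 1 = pr_angle E" by (simp_all add: \<phi>_def pr_angle_def)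
  have N0: "sqrt (prN E 0) = w" by (simp add: prN_def w_def)
  define r where "r = sqrt (prN E 1)"
  have r: "0 < r" using N[of 1] by (simp add: r_def)
  have "?A 1 / sqrt (prN E 1) = ?A 0 / sqrt (prN E 0)"
    by (rule const[OF _ dA keyA]) (auto intro!: continuous_intros S \<phi>c)
  then have A: "?A 1 = r" using w r unfolding N0 r_def[symmetric] by (simp add: \<phi>0)
  have "?B 1 / sqrt (prN E 1) = ?B 0 / sqrt (prN E 0)"
    by (rule const[OF _ dB keyB]) (auto intro!: continuous_intros S \<phi>c)
  then have B: "?B 1 = 0" using w r unfolding N0 r_def[symmetric] by (simp add: \<phi>0)
  have sc: "sin (\<phi> 1) * sin (\<phi> 1) = 1 - cos (\<phi> 1) * cos (\<phi> 1)"
    using sin_squared_eq[of "\<phi> 1"] by (simp add: power2_eq_square)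
  have "w * cu E 1 = ?A 1 * cos (\<phi> 1) + ?B 1 * sin (\<phi> 1)"
    using arg_cong[OF sc, of "\<lambda>z. w * cu E 1 * z"] by (simp add: algebra_simps)
  moreover have "cq E 1 = ?B 1 * cos (\<phi> 1) - ?A 1 * sin (\<phi> 1)"
    using arg_cong[OF sc, of "\<lambda>z. cq E 1 * z"] by (simp add: algebra_simps)
  ultimately show ?thesis using that[OF r] A B by (simp add: \<phi>1 w_def disc_def mb_def)
qed

lemma pr_angle_isCont:
  assumes E: "0 < E" shows "isCont pr_angle E"
  unfolding pr_angle_def[abs_def]
proof -
  obtain K where K: "0 < K" "\<And>x. eps x \<le> K" "\<And>x. mu x \<le> K" using coeff_bound by metis
  show "isCont (\<lambda>E. integral {0..1} (pr_rate E)) E"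
  \<comment> \<open>The radius of the neighbourhood is E itself, so all energies considered stay in
    (0, 2 E), where \<open>prN\<close> is positive.\<close>
  proof (rule isCont_integral[OF E])
    fix F assume "\<bar>F - E\<bar> < E"
    then have F: "0 < F" "F < 2 * E" by auto
    show "pr_rate F integrable_on {0..1}" using pr_rate_integrable[OF F(1)] by simp
    fix x :: real assume x: "x \<in> {0..1}"
    have N: "0 < prN F x" using prN_pos[OF F(1)] x by simp
    have sF: "sqrt F \<le> sqrt (2 * E)" using F by simp
    have le: "sqrt F * y / prN F x \<le> sqrt (2 * E)" if "0 \<le> y" "y \<le> prN F x" for y
    proof -
      have "sqrt F * y / prN F x = sqrt F * (y / prN F x)" by simp
      also have "\<dots> \<le> sqrt (2 * E) * 1" using that N F sF by (intro mult_mono) auto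
      finally show ?thesis by simp
    qed
    have "\<bar>pr_rate F x\<bar> = pr_rate F x"
      using N F mu_pos[of x] eps_pos[of x] by (simp add: pr_rate_def)
    also have "\<dots> \<le> K * sqrt (2 * E) + K * sqrt (2 * E)"
      unfolding pr_rate_def using N F K mu_pos[of x] eps_pos[of x]
      by (intro add_mono mult_mono le) (auto simp: prN_def)
    finally show "\<bar>pr_rate F x\<bar> \<le> K * sqrt (2 * E) + K * sqrt (2 * E)" .
  next
    fix x :: real assume x: "x \<in> {0..1}"
    have "0 < prN E x" using prN_pos[OF E] x by simp
    then show "isCont (\<lambda>F. pr_rate F x) E"
      unfolding pr_rate_def prN_def using fund_isCont[OF x, of E]
      by (intro continuous_intros) auto
  qed
qed

text \<open>The two weights in the rate sum to sqrt E, so the rate is at least sqrt E times the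
  smaller coefficient. The coefficients are positive but may have one-sided limit 0 at a jump, so
  the integral of their minimum takes the place of a uniform lower bound.\<close>

lemma pr_angle_unbounded:
  obtains \<delta> where "0 < \<delta>" "\<And>E. 0 < E \<Longrightarrow> sqrt E * \<delta> \<le> pr_angle E"
proof -
  let ?m = "\<lambda>x. min (eps x) (mu x)"
  have pc: "piecewise_cont ?m"
    unfolding piecewise_cont_def
  proof (intro conjI allI)
    fix a b :: real
    have "{x \<in> {a..b}. \<not> isCont ?m x} \<subseteq> {x \<in> {a..b}. \<not> isCont eps x} \<union> {x \<in> {a..b}. \<not> isCont mu x}"
      by (auto intro!: continuous_intros)
    moreover have "finite ({x \<in> {a..b}. \<not> isCont eps x} \<union> {x \<in> {a..b}. \<not> isCont mu x})"
      using pc_eps pc_mu unfolding piecewise_cont_def by blast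
    ultimately show "finite {x \<in> {a..b}. \<not> isCont ?m x}" by (rule finite_subset)
  next
    fix x
    obtain l1 l2 r1 r2 where "(eps \<longlongrightarrow> l1) (at_left x)" "(mu \<longlongrightarrow> l2) (at_left x)"
      "(eps \<longlongrightarrow> r1) (at_right x)" "(mu \<longlongrightarrow> r2) (at_right x)"
      using pc_eps pc_mu unfolding piecewise_cont_def by metis
    then show "\<exists>l. (?m \<longlongrightarrow> l) (at_left x)" "\<exists>l. (?m \<longlongrightarrow> l) (at_right x)"
      using tendsto_min by blast+
  qed
  have int: "?m integrable_on {0..1}"
    using piecewise_cont_mult_integrable[OF pc, of 0 1 "\<lambda>x. 1"] by simp
  obtain z where z: "z \<in> {0<..<1}" "isCont eps z" "isCont mu z"
    using exists_continuity_point[of 0 1] by auto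
  have pos: "0 < integral {0..1} ?m"
    by (rule integral_pos[OF int _ z(1)])
       (use z eps_pos mu_pos in \<open>auto intro!: continuous_intros simp: less_imp_le\<close>)
  have "sqrt E * integral {0..1} ?m \<le> pr_angle E" if E: "0 < E" for E
  proof -
    have "sqrt E * integral {0..1} ?m = integral {0..1} (\<lambda>x. sqrt E * ?m x)" by simp
    also have "\<dots> \<le> pr_angle E" unfolding pr_angle_def
    proof (rule integral_le)
      show "pr_rate E integrable_on {0..1}" using pr_rate_integrable[OF E] by simp
      show "(\<lambda>x. sqrt E * ?m x) integrable_on {0..1}" using int by (rule integrable_on_mult_right)
      fix x :: real assume "x \<in> {0..1}"
      then have N: "0 < prN E x" using prN_pos[OF E] by simp
      have "sqrt E * ?m x = ?m x * (sqrt E * (cq E x)\<^sup>2 / prN E x) + ?m x * (sqrt E * (E * (cu E x)\<^sup>2) / prN E x)"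
      proof -
        have "?m x * (sqrt E * a / n) + ?m x * (sqrt E * b / n) = sqrt E * ?m x * ((a + b) / n)" for a b n
          by (simp add: add_divide_distrib algebra_simps)
        then show ?thesis using N by (simp add: prN_def[symmetric])
      qed
      also have "\<dots> \<le> pr_rate E x"
        unfolding pr_rate_def using N E by (intro add_mono mult_right_mono) auto
      finally show "sqrt E * ?m x \<le> pr_rate E x" .
    qed
    finally show ?thesis .
  qed
  with pos show ?thesis by (rule that)
qed

text \<open>The angle is continuous and unbounded, so from energy 1 upwards it attains every
  multiple of pi beyond its value there. At such an energy sin vanishes, hence b = 0 and D is 1 or -
  1, with the sign of cos. Each energy is chosen above the preceding one, so the sequence
  increases.\<close>

lemma disc_oscillates:
  obtains X :: "nat \<Rightarrow> real" and c where "strict_mono X" "\<And>n. disc (X n) = c * (- 1) ^ n" "\<bar>c\<bar> = 1"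
proof -
  obtain \<delta> where \<delta>: "0 < \<delta>" "\<And>E. 0 < E \<Longrightarrow> sqrt E * \<delta> \<le> pr_angle E"
    using pr_angle_unbounded by metis
  have hit: "\<exists>F>E. pr_angle F = y" if E: "0 < E" "pr_angle E < y" for E y
  proof -
    define F where "F = max E ((y / \<delta>)\<^sup>2)"
    have F: "0 < F" "E \<le> F" using E by (auto simp: F_def)
    have "\<bar>y / \<delta>\<bar> \<le> sqrt F" by (metis F_def max.cobounded2 real_sqrt_abs real_sqrt_le_mono)
    then have "y \<le> sqrt F * \<delta>" using \<delta>(1) by (simp add: field_simps abs_le_iff)
    then have "y \<le> pr_angle F" using \<delta>(2)[OF F(1)] by linarith
    then obtain G where "E \<le> G" "G \<le> F" "pr_angle G = y"
      using IVT[of pr_angle E y F] E F pr_angle_isCont by fastforce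
    with E show ?thesis by (metis less_irrefl order_le_less)
  qed
  obtain n0 :: nat where n0: "pr_angle 1 < real n0 * pi"
    using reals_Archimedean3[OF pi_gt_zero] by blast
  have "\<exists>X. \<forall>n. (0 < X n \<and> pr_angle (X n) = real (n0 + n) * pi) \<and> X n < X (Suc n)"
  proof (rule dependent_nat_choice)
    show "\<exists>x. 0 < x \<and> pr_angle x = real (n0 + 0) * pi" 
      using hit[OF _ n0] by (metis add.right_neutral less_trans zero_less_one)
    fix x n assume x: "0 < x \<and> pr_angle x = real (n0 + n) * pi"
    then have "pr_angle x < real (n0 + Suc n) * pi" by simp
    from hit[OF _ this] x show "\<exists>y. (0 < y \<and> pr_angle y = real (n0 + Suc n) * pi) \<and> x < y"
      by (auto intro: less_trans)
  qed
  then obtain X where X: "\<And>n. 0 < X n" "\<And>n. pr_angle (X n) = real (n0 + n) * pi" "\<And>n. X n < X (Suc n)"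
    by blast
  have "disc (X n) = (- 1) ^ n0 * (- 1) ^ n" for n
  proof -
    obtain r where r: "0 < r" "sqrt (X n) * disc (X n) = r * cos (pr_angle (X n))"
      "mb (X n) = - (r * sin (pr_angle (X n)))" using pr_angle_polar[OF X(1)] by blast
    have "mb (X n) = 0" unfolding r(3) X(2) sin_npi by simp
    then have 1: "disc (X n) = 1 \<or> disc (X n) = - 1"
      using det[of "X n"] by (simp add: power2_eq_1_iff)
    have 2: "sqrt (X n) * disc (X n) = r * (- 1) ^ (n0 + n)" unfolding r(2) X(2) cos_npi by simp
    have "disc (X n) = (- 1) ^ (n0 + n)"
    proof (cases "even (n0 + n)")
      case True
      then have "0 < sqrt (X n) * disc (X n)" using 2 r(1) by simp
      then have "0 < disc (X n)" using X(1)[of n] by (simp add: zero_less_mult_iff)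
      with 1 True show ?thesis by auto
    next
      case False
      then have "sqrt (X n) * disc (X n) < 0" using 2 r(1) by simp
      then have "disc (X n) < 0" using X(1)[of n] by (simp add: mult_less_0_iff)
      with 1 False show ?thesis by auto
    qed
    then show ?thesis by (simp add: power_add)
  qed
  then show ?thesis using X(3) by (intro that[of X "(- 1) ^ n0"]) (auto simp: strict_mono_Suc_iff power_abs)
qed

text \<open>Between \<open>X (2 * i)\<close> and \<open>X (2 * i + 1)\<close> the discriminant runs
  from c to - c and attains every y in [-1, 1]. Using only every second interval keeps them
  disjoint, so the roots are distinct even for y = 1 or y = - 1. The bound is the same for all y,
  which later bounds a whole band.\<close>

lemma many_eigenvalues:
  "\<exists>b. \<forall>y. \<bar>y\<bar> \<le> 1 \<longrightarrow> (\<exists>T. finite T \<and> card T = m \<and> (\<forall>l\<in>T. l \<le> b \<and> disc l = y))"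
proof -
  obtain X :: "nat \<Rightarrow> real" and c where X: "strict_mono X" "\<And>n. disc (X n) = c * (- 1) ^ n" "\<bar>c\<bar> = 1"
    using disc_oscillates by metis
  show ?thesis
  proof (intro exI[of _ "X (2 * m)"] allI impI)
    fix y :: real assume y: "\<bar>y\<bar> \<le> 1"
    have "\<exists>l. X (2 * i) \<le> l \<and> l \<le> X (2 * i + 1) \<and> disc l = y" for i
    proof -
      have le: "X (2 * i) \<le> X (2 * i + 1)" using X(1) by (simp add: strict_mono_less_eq)
      have "disc (X (2 * i)) = c" "disc (X (2 * i + 1)) = - c" by (simp_all only: X(2)) simp_all
      moreover have "c = 1 \<or> c = -1" using X(3) by auto
      ultimately show ?thesis
        using IVT[of disc "X (2 * i)" y "X (2 * i + 1)"] IVT2[of disc "X (2 * i + 1)" y "X (2 * i)"]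
          le y monodromy_isCont(1) by auto
    qed
    then obtain l where l: "\<And>i. X (2 * i) \<le> l i" "\<And>i. l i \<le> X (2 * i + 1)" "\<And>i. disc (l i) = y" by metis
    have lt: "l i < l j" if "i < j" for i j
    proof -
      have "l i \<le> X (2 * i + 1)" by (rule l)
      also have "\<dots> < X (2 * j)" using X(1) that by (simp add: strict_mono_less)
      also have "\<dots> \<le> l j" by (rule l)
      finally show ?thesis .
    qed
    then have inj: "inj l" by (metis injI linorder_neqE_nat less_irrefl)
    have "l i \<le> X (2 * m)" if "i < m" for i
    proof -
      have "X (2 * i + 1) \<le> X (2 * m)" using X(1) that by (simp add: strict_mono_less_eq)
      then show ?thesis using l(2)[of i] by linarith
    qed
    then show "\<exists>T. finite T \<and> card T = m \<and> (\<forall>l\<in>T. l \<le> X (2 * m) \<and> disc l = y)"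
      using inj l(3) by (intro exI[of _ "l ` {..<m}"]) (auto simp: card_image inj_on_subset)
  qed
qed

end

section \<open>Eigenvalues and bands\<close>

text \<open>The cross product of the triples \<alpha> and \<beta> is orthogonal to both. If it
  vanishes, the first two of the pairs (\<alpha> i, \<beta> i) are already dependent. With two
  coordinates per eigenfunction this bounds multiplicities by 2.\<close>

lemma three_vectors_dependent:
  fixes \<alpha> \<beta> :: "nat \<Rightarrow> complex"
  obtains c where "\<exists>i<3. c i \<noteq> 0" "(\<Sum>i<3. c i * \<alpha> i) = 0" "(\<Sum>i<3. c i * \<beta> i) = 0"
proof -
  let ?d = "\<lambda>i j. \<alpha> i * \<beta> j - \<alpha> j * \<beta> i"
  have S: "(\<Sum>i<3. f i) = f 0 + f 1 + f 2" for f :: "nat \<Rightarrow> complex"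
    by (simp add: eval_nat_numeral)
  show ?thesis
  proof (cases "?d 0 1 = 0 \<and> ?d 1 2 = 0 \<and> ?d 2 0 = 0")
    case False
    let ?c = "\<lambda>i::nat. if i = 0 then ?d 1 2 else if i = 1 then ?d 2 0 else ?d 0 1"
    have "\<exists>i<3. ?c i \<noteq> 0"
    proof -
      have "?c 0 \<noteq> 0 \<or> ?c 1 \<noteq> 0 \<or> ?c 2 \<noteq> 0" using False by auto
      moreover have "(0::nat) < 3" "(1::nat) < 3" "(2::nat) < 3" by simp_all
      ultimately show ?thesis by blast
    qed
    then show ?thesis by (rule that) (simp_all add: S algebra_simps)
  next
    case True
    then have d: "\<alpha> 0 * \<beta> 1 = \<alpha> 1 * \<beta> 0" by simp
    consider "\<alpha> 0 \<noteq> 0 \<or> \<alpha> 1 \<noteq> 0" | "\<alpha> 0 = 0" "\<alpha> 1 = 0" "\<beta> 0 \<noteq> 0 \<or> \<beta> 1 \<noteq> 0"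
      | "\<alpha> 0 = 0" "\<alpha> 1 = 0" "\<beta> 0 = 0" "\<beta> 1 = 0" by blast
    then show ?thesis
    proof cases
      case 1
      have "\<exists>i<3. (\<lambda>i. if i = 0 then \<alpha> 1 else if i = 1 then - \<alpha> 0 else 0) (i::nat) \<noteq> 0"
        using 1 by (auto intro: exI[of _ 0] exI[of _ 1])
      then show ?thesis by (rule that) (use d in \<open>simp_all add: S algebra_simps\<close>)
    next
      case 2
      have "\<exists>i<3. (\<lambda>i. if i = 0 then \<beta> 1 else if i = 1 then - \<beta> 0 else 0) (i::nat) \<noteq> 0"
        using 2 by (auto intro: exI[of _ 0] exI[of _ 1])
      then show ?thesis by (rule that) (use 2 in \<open>simp_all add: S algebra_simps\<close>)
    next
      case 3
      have "\<exists>i<3. (\<lambda>i. if i = 0 then 1 else 0) (i::nat) \<noteq> (0::complex)" by auto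
      then show ?thesis by (rule that) (use 3 in \<open>simp_all add: S\<close>)
    qed
  qed
qed

text \<open>N is a step function that jumps only at points of positive weight and includes the jump
  at the point itself. So {E. m <= N E} is a closed half-line starting at the least such point with
  count at least m, and the infimum is attained there.\<close>

lemma weighted_count_Inf:
  fixes w :: "real \<Rightarrow> nat" and N :: "real \<Rightarrow> nat"
  assumes N: "\<And>E. N E = (\<Sum>l\<in>{l. l \<le> E \<and> 0 < w l}. w l)"
    and fin: "\<And>E. finite {l. l \<le> E \<and> 0 < w l}"
    and m: "1 \<le> m" "m \<le> N b"
  shows "0 < w (Inf {E. m \<le> N E})" "\<And>E. m \<le> N E \<longleftrightarrow> Inf {E. m \<le> N E} \<le> E"
proof -
  let ?L = "\<lambda>E. {l. l \<le> E \<and> 0 < w l}"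
  have last: "\<exists>l\<in>?L E. N l = N E" if "m \<le> N E" for E
  proof -
    have ne: "?L E \<noteq> {}"
    proof
      assume "?L E = {}"
      then have "N E = 0" unfolding N[of E] by simp
      with that m(1) show False by simp
    qed
    define l where "l = Max (?L E)"
    have l: "l \<in> ?L E" unfolding l_def using Max_in[OF fin ne] .
    have "?L l = ?L E" using l Max_ge[OF fin, of _ E] by (force simp: l_def)
    then have "N l = N E" by (simp only: N)
    with l show ?thesis by blast
  qed
  have mono: "N E \<le> N F" if "E \<le> F" for E F
    unfolding N using that by (intro sum_mono2 fin) auto
  define T where "T = {l \<in> ?L b. m \<le> N l}"
  have T: "finite T" using finite_subset[OF _ fin[of b], of T] by (auto simp: T_def)
  have Tne: "T \<noteq> {}" using last[OF m(2)] m(2) by (auto simp: T_def)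
  define B where "B = Min T"
  have B: "B \<in> T" unfolding B_def using Min_in[OF T Tne] .
  have iff: "m \<le> N E \<longleftrightarrow> B \<le> E" for E
  proof
    assume "m \<le> N E"
    with last obtain l where l: "l \<in> ?L E" "N l = N E" by blast
    show "B \<le> E"
    proof (cases "l \<le> b")
      case True
      then have "l \<in> T" using l \<open>m \<le> N E\<close> by (simp add: T_def)
      then show ?thesis using Min_le[OF T] l by (force simp: B_def)
    next
      case False
      then show ?thesis using B l by (auto simp: T_def)
    qed
  next
    assume "B \<le> E"
    then show "m \<le> N E" using mono[of B E] B by (simp add: T_def)
  qed
  then have "{E. m \<le> N E} = {B..}" by auto
  then have "Inf {E. m \<le> N E} = B" by simp
  then show "0 < w (Inf {E. m \<le> N E})" "\<And>E. m \<le> N E \<longleftrightarrow> Inf {E. m \<le> N E} \<le> E"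
    using B iff by (auto simp: T_def)
qed

context sl_coeffs
begin

text \<open>The initial data (u 0, q 0) form an eigenvector of the monodromy matrix for the
  eigenvalue \<open>cis k\<close>. Members of \<open>eigsp\<close> are constrained on the unit
  interval only, hence the restricted representation.\<close>

lemma eigspD:
  assumes "u \<in> eigsp eps mu k E"
  obtains \<alpha> \<beta> where "\<And>x. x \<in> {0..1} \<Longrightarrow> u x = \<alpha> * of_real (cu E x) + \<beta> * of_real (su E x)"
    "\<alpha> * of_real (disc E) + \<beta> * of_real (ms E) = cis k * \<alpha>"
    "\<alpha> * of_real (mb E) + \<beta> * of_real (disc E) = cis k * \<beta>"
proof -
  from assms obtain q where q: "sl_solution eps mu E 0 1 u q" "u 1 = cis k * u 0" "q 1 = cis k * q 0"
    unfolding eigsp_def by blast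
  have "csol eps mu E 0 1 u q"
    using q(1) by (rule csol_if_sl_solution) (intro piecewise_cont_regular_on pc_eps pc_mu)+
  note r = csol_complex_representation[OF this]
  show ?thesis
  proof (rule that[of "u 0" "q 0"])
    show "u x = u 0 * of_real (cu E x) + q 0 * of_real (su E x)" if "x \<in> {0..1}" for x using r(1)[OF that] .
    show "u 0 * of_real (disc E) + q 0 * of_real (ms E) = cis k * u 0"
      using r(1)[of 1] q(2) by (simp add: disc_def ms_def)
    show "u 0 * of_real (mb E) + q 0 * of_real (disc E) = cis k * q 0"
      using r(2)[of 1] q(3) by (simp add: mb_def sq_1)
  qed
qed

lemma eigspI:
  assumes "\<alpha> * of_real (disc E) + \<beta> * of_real (ms E) = cis k * \<alpha>"
    "\<alpha> * of_real (mb E) + \<beta> * of_real (disc E) = cis k * \<beta>"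
  shows "(\<lambda>x. \<alpha> * of_real (cu E x) + \<beta> * of_real (su E x)) \<in> eigsp eps mu k E"
proof -
  let ?u = "\<lambda>x. \<alpha> * of_real (cu E x) + \<beta> * of_real (su E x)"
    and ?q = "\<lambda>x. \<alpha> * of_real (cq E x) + \<beta> * of_real (sq E x)"
  have "?u 1 = cis k * ?u 0" using assms(1) unfolding disc_def ms_def by simp
  moreover have "?q 1 = cis k * ?q 0" using assms(2) unfolding mb_def sq_1 by simp
  ultimately show ?thesis unfolding eigsp_def mem_Collect_eq
    by (intro exI[of _ ?q] conjI sl_solution_combination)
qed

lemma combination_nonzero:
  assumes "\<alpha> \<noteq> 0 \<or> \<beta> \<noteq> (0::complex)"
  shows "\<exists>x\<in>{0..1}. \<alpha> * of_real (cu E x) + \<beta> * of_real (su E x) \<noteq> 0"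
proof (cases "\<alpha> = 0")
  case True
  with assms su_nonzero[of E] show ?thesis by auto
next
  case False
  then show ?thesis by (intro bexI[of _ 0]) auto
qed

text \<open>With determinant 1, the characteristic equation (D - z)^2 = b s for z =
  \<open>cis k\<close> becomes z^2 + 1 = 2 D z; dividing by z gives z + 1/z = 2 D, and the left side
  is 2 cos k.\<close>

lemma char_eq: "(of_real (disc E) - cis k)\<^sup>2 = complex_of_real (mb E * ms E) \<longleftrightarrow> disc E = cos k"
proof -
  have "mb E * ms E = (disc E)\<^sup>2 - 1" using det[of E] by simp
  then have bs: "complex_of_real (mb E * ms E) = (of_real (disc E))\<^sup>2 - 1" by simp
  have "(d - z)\<^sup>2 - (d\<^sup>2 - 1) = (z * z + 1) - z * (2 * d)" for d z :: complex
    by (simp add: power2_eq_square algebra_simps)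
  then have "(of_real (disc E) - cis k)\<^sup>2 = complex_of_real (mb E * ms E) \<longleftrightarrow>
     cis k * cis k + 1 = cis k * (2 * of_real (disc E))"
    unfolding bs by (metis eq_iff_diff_eq_0)
  also have "cis k * cis k + 1 = cis k * (cis k + cis (- k))"
    by (simp add: distrib_left cis_mult)
  also have "cis k * (cis k + cis (- k)) = cis k * (2 * of_real (disc E)) \<longleftrightarrow>
    cis k + cis (- k) = 2 * of_real (disc E)" by simp
  also have "cis k + cis (- k) = 2 * of_real (cos k)" by (simp add: complex_eq_iff)
  also have "(2 * complex_of_real (cos k) = 2 * of_real (disc E)) \<longleftrightarrow> disc E = cos k"
    by (metis mult_cancel_left of_real_eq_iff zero_neq_numeral)
  finally show ?thesis .
qed

lemma eigsp_nontrivial_iff: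
  "(\<exists>u\<in>eigsp eps mu k E. \<exists>x\<in>{0..1}. u x \<noteq> 0) \<longleftrightarrow> disc E = cos k"
proof
  assume "\<exists>u\<in>eigsp eps mu k E. \<exists>x\<in>{0..1}. u x \<noteq> 0"
  then obtain u x where u: "u \<in> eigsp eps mu k E" and x: "x \<in> {0..1}" "u x \<noteq> 0" by blast
  from eigspD[OF u] obtain \<alpha> \<beta> where ab: "u x = \<alpha> * of_real (cu E x) + \<beta> * of_real (su E x)"
    "\<alpha> * of_real (disc E) + \<beta> * of_real (ms E) = cis k * \<alpha>"
    "\<alpha> * of_real (mb E) + \<beta> * of_real (disc E) = cis k * \<beta>" using x(1) by metis
  let ?z = "of_real (disc E) - cis k"
  have 1: "\<alpha> * ?z = - (\<beta> * of_real (ms E))" "\<beta> * ?z = - (\<alpha> * of_real (mb E))"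
    using ab(2,3) by (simp_all add: algebra_simps eq_neg_iff_add_eq_0)
  have "\<alpha> * ?z\<^sup>2 = (\<alpha> * ?z) * ?z" by (simp only: power2_eq_square mult.assoc)
  also have "\<dots> = - (of_real (ms E) * (\<beta> * ?z))" unfolding 1(1) by (simp add: algebra_simps)
  also have "\<dots> = \<alpha> * of_real (mb E * ms E)" unfolding 1(2) by (simp add: mult_ac)
  finally have 2: "\<alpha> * ?z\<^sup>2 = \<alpha> * of_real (mb E * ms E)" .
  have "\<beta> * ?z\<^sup>2 = (\<beta> * ?z) * ?z" by (simp only: power2_eq_square mult.assoc)
  also have "\<dots> = - (of_real (mb E) * (\<alpha> * ?z))" unfolding 1(2) by (simp add: algebra_simps)
  also have "\<dots> = \<beta> * of_real (mb E * ms E)" unfolding 1(1) by (simp add: mult_ac)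
  finally have 3: "\<beta> * ?z\<^sup>2 = \<beta> * of_real (mb E * ms E)" .
  have "\<alpha> \<noteq> 0 \<or> \<beta> \<noteq> 0" using ab(1) x(2) by auto
  with 2 3 have "?z\<^sup>2 = of_real (mb E * ms E)" by auto
  then show "disc E = cos k" using char_eq by blast
next
  assume "disc E = cos k"
  then have z: "(of_real (disc E) - cis k)\<^sup>2 = complex_of_real (mb E * ms E)" using char_eq by blast
  show "\<exists>u\<in>eigsp eps mu k E. \<exists>x\<in>{0..1}. u x \<noteq> 0"
  \<comment> \<open>The eigenvector (s, z - D) with z = \<open>cis k\<close> degenerates to 0 when s
    = 0, since then z = D; in that case (0, 1) is an eigenvector.\<close>
  proof (cases "ms E = 0")
    case True
    then have "of_real (disc E) = cis k" using z by simp
    then have "(\<lambda>x. 0 * of_real (cu E x) + 1 * of_real (su E x)) \<in> eigsp eps mu k E"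
      using True by (intro eigspI) simp_all
    then show ?thesis by (rule bexI[rotated]) (rule combination_nonzero, simp)
  next
    case False
    let ?a = "complex_of_real (ms E)" and ?b = "cis k - of_real (disc E)"
    have 1: "?a * of_real (disc E) + ?b * of_real (ms E) = cis k * ?a" by (simp add: algebra_simps)
    have 2: "?a * of_real (mb E) + ?b * of_real (disc E) = cis k * ?b"
      using z by (simp add: algebra_simps power2_eq_square)
    from eigspI[OF 1 2] show ?thesis
      by (rule bexI[rotated]) (rule combination_nonzero, use False in simp)
  qed
qed

text \<open>\<open>GREATEST\<close> is meaningful only for a bounded, inhabited predicate: 0 belongs
  to it, and 2 bounds it because three eigenfunctions, each a combination of \<open>cu E\<close> and
  \<open>su E\<close>, are dependent. Positivity then amounts to a nontrivial eigenfunction.\<close>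

lemma mult_pos_iff: "0 < mult eps mu k E \<longleftrightarrow> disc E = cos k"
proof -
  define P where "P n \<longleftrightarrow> (\<exists>v::nat \<Rightarrow> real \<Rightarrow> complex.
       (\<forall>i<n. v i \<in> eigsp eps mu k E) \<and>
       (\<forall>c::nat \<Rightarrow> complex. (\<forall>x\<in>{0..1}. (\<Sum>i<n. c i * v i x) = 0) \<longrightarrow> (\<forall>i<n. c i = 0)))" for n
  have m: "mult eps mu k E = (GREATEST n. P n)" unfolding mult_def P_def ..
  have bd: "n \<le> 2" if "P n" for n
  proof (rule ccontr)
    assume "\<not> n \<le> 2"
    then have n: "3 \<le> n" by simp
    from that obtain v where v: "\<And>i. i < n \<Longrightarrow> v i \<in> eigsp eps mu k E"
      and ind: "\<And>c. (\<And>x. x\<in>{0..1} \<Longrightarrow> (\<Sum>i<n. c i * v i x) = 0) \<Longrightarrow> (\<forall>i<n. c i = 0)"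
      unfolding P_def by blast
    have "\<exists>\<alpha> \<beta>. \<forall>x\<in>{0..1}. v i x = \<alpha> * of_real (cu E x) + \<beta> * of_real (su E x)" if "i < n" for i
      using eigspD[OF v[OF that]] by metis
    then obtain \<alpha> \<beta> where ab: "\<And>i x. i < n \<Longrightarrow> x \<in> {0..1} \<Longrightarrow>
       v i x = \<alpha> i * of_real (cu E x) + \<beta> i * of_real (su E x)" by metis
    obtain c where c: "\<exists>i<3. c i \<noteq> 0" "(\<Sum>i<3. c i * \<alpha> i) = 0" "(\<Sum>i<3. c i * \<beta> i) = 0"
      using three_vectors_dependent[of \<alpha> \<beta>] by blast
    define c' where "c' i = (if i < 3 then c i else 0)" for i
    have "(\<Sum>i<n. c' i * v i x) = 0" if x: "x \<in> {0..1}" for x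
    proof -
      have "(\<Sum>i<n. c' i * v i x) = (\<Sum>i<3. c' i * v i x)"
        using n by (intro sum.mono_neutral_right) (auto simp: c'_def)
      also have "\<dots> = (\<Sum>i<3. c i * \<alpha> i * of_real (cu E x) + c i * \<beta> i * of_real (su E x))"
        using n x by (intro sum.cong refl) (simp add: c'_def ab algebra_simps)
      also have "\<dots> = 0" by (simp add: sum.distrib sum_distrib_right[symmetric] c)
      finally show ?thesis .
    qed
    from ind[OF this] have "\<forall>i<n. c' i = 0" .
    with c(1) n show False unfolding c'_def by (metis less_le_trans)
  qed
  have "P 0" unfolding P_def by simp
  then have G: "P (mult eps mu k E)" "\<And>n. P n \<Longrightarrow> n \<le> mult eps mu k E"
    unfolding m using GreatestI_nat[of P 0 2] Greatest_le_nat[of P _ 2] bd by blast+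
  show ?thesis
  proof
    assume "0 < mult eps mu k E"
    then obtain n where n: "mult eps mu k E = Suc n" by (cases "mult eps mu k E") auto
    from G(1) obtain v where v: "\<And>i. i < Suc n \<Longrightarrow> v i \<in> eigsp eps mu k E"
      and ind: "\<And>c. (\<And>x. x\<in>{0..1} \<Longrightarrow> (\<Sum>i<Suc n. c i * v i x) = 0) \<Longrightarrow> (\<forall>i<Suc n. c i = 0)"
      unfolding P_def n by blast
    have "\<exists>x\<in>{0..1}. v 0 x \<noteq> 0"
    proof (rule ccontr)
      assume "\<not> ?thesis"
      then have z: "v 0 x = 0" if "x \<in> {0..1}" for x using that by blast
      have "\<forall>i<Suc n. (\<lambda>i. if i = 0 then 1 else 0) i = (0::complex)"
        by (rule ind, rule sum.neutral) (simp add: z)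
      then show False by auto
    qed
    with v[of 0] show "disc E = cos k" using eigsp_nontrivial_iff by blast
  next
    assume "disc E = cos k"
    then obtain u x where u: "u \<in> eigsp eps mu k E" "x \<in> {0..1}" "u x \<noteq> 0"
      using eigsp_nontrivial_iff by blast
    have "P 1" unfolding P_def
      by (rule exI[of _ "\<lambda>_. u"]) (use u in auto)
    from G(2)[OF this] show "0 < mult eps mu k E" by simp
  qed
qed

text \<open>Keeps \<open>eig_count\<close> a genuine count: a sum over an infinite set would default
  to 0.\<close>

lemma finite_eigenvalues: "finite {l. l \<le> E \<and> 0 < mult eps mu k l}"
  unfolding mult_pos_iff by (rule finite_disc_level_set) simp

lemma eig_count_strict_mono:
  assumes "E < F" "disc F = cos k"
  shows "eig_count eps mu k E < eig_count eps mu k F"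
proof -
  have "0 < mult eps mu k F" using assms mult_pos_iff by blast
  then show ?thesis
    unfolding eig_count_def using assms(1)
    by (intro sum_strict_mono2[of _ _ F] finite_eigenvalues) auto
qed

lemma eig_count_unbounded: "\<exists>b. \<forall>k. m \<le> eig_count eps mu k b"
proof -
  obtain b where b: "\<And>y. \<bar>y\<bar> \<le> 1 \<Longrightarrow> \<exists>T. finite T \<and> card T = m \<and> (\<forall>l\<in>T. l \<le> b \<and> disc l = y)"
    using many_eigenvalues by metis
  have "m \<le> eig_count eps mu k b" for k
  proof -
    obtain T where T: "finite T" "card T = m" "\<forall>l\<in>T. l \<le> b \<and> disc l = cos k" using b[of "cos k"] by auto
    have pos: "0 < mult eps mu k l" if "l \<in> T" for l using T(3) that mult_pos_iff by blast
    have "m = (\<Sum>l\<in>T. 1)" using T by simp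
    also have "\<dots> \<le> (\<Sum>l\<in>T. mult eps mu k l)" using pos by (intro sum_mono) (simp add: Suc_leI)
    also have "\<dots> \<le> eig_count eps mu k b"
      unfolding eig_count_def using T(3) pos by (intro sum_mono2 finite_eigenvalues) auto
    finally show ?thesis .
  qed
  then show ?thesis by blast
qed

text \<open>The infimum defining a band is attained at an eigenvalue, and the count reaches m
  exactly from there on. Comparisons of bands with energies are made through this
  equivalence.\<close>

lemma disc_band: "1 \<le> m \<Longrightarrow> disc (band eps mu m k) = cos k"
  and le_eig_count_iff: "1 \<le> m \<Longrightarrow> m \<le> eig_count eps mu k E \<longleftrightarrow> band eps mu m k \<le> E"
proof -
  assume m: "1 \<le> m"
  obtain b where b: "m \<le> eig_count eps mu k b" using eig_count_unbounded by blast
  note w = weighted_count_Inf[OF eig_count_def finite_eigenvalues m b]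
  show "disc (band eps mu m k) = cos k" using w(1) unfolding band_def mult_pos_iff .
  show "m \<le> eig_count eps mu k E \<longleftrightarrow> band eps mu m k \<le> E" using w(2) unfolding band_def .
qed

text \<open>Needed for the supremum and infimum in \<open>band_max\<close> and
  \<open>band_min\<close> to have their usual meaning. Above, the energy by which m eigenvalues
  occur is uniform in k; below, negative energies are never eigenvalues.\<close>

lemma band_bounds:
  assumes "1 \<le> m"
  shows "bdd_above (band eps mu m ` S)" "bdd_below (band eps mu m ` S)"
proof -
  obtain b where "\<forall>k. m \<le> eig_count eps mu k b" using eig_count_unbounded by blast
  then show "bdd_above (band eps mu m ` S)"
    using le_eig_count_iff[OF assms] by (auto intro!: bdd_aboveI[of _ b])
  have "0 \<le> band eps mu m k" for k
    using disc_gt_1_if_neg[of "band eps mu m k"] disc_band[OF assms, of k]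
    by (metis abs_cos_le_one linorder_not_less)
  then show "bdd_below (band eps mu m ` S)" by (auto intro!: bdd_belowI[of _ 0])
qed

end

section \<open>Band gaps\<close>

context sl_coeffs
begin

text \<open>The numerator b' s - b s' of the derivative of b / s, with the derivatives expressed
  through the Gram matrix.\<close>

definition gap_num :: "real \<Rightarrow> real" where
  "gap_num E = 2 * (mb E * ms E) * QQ E - disc E * ms E * PP E - disc E * mb E * RR E"

lemma ratio_deriv:
  "ms E \<noteq> 0 \<Longrightarrow> ((\<lambda>E. mb E / ms E) has_real_derivative gap_num E / (ms E)\<^sup>2) (at E)"
  "mb E \<noteq> 0 \<Longrightarrow> ((\<lambda>E. ms E / mb E) has_real_derivative - gap_num E / (mb E)\<^sup>2) (at E)"
proof -
  assume "ms E \<noteq> 0"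
  from DERIV_divide[OF monodromy_deriv(2,3) this]
  show "((\<lambda>E. mb E / ms E) has_real_derivative gap_num E / (ms E)\<^sup>2) (at E)"
    by (rule back_subst) (simp add: gap_num_def power2_eq_square algebra_simps)
next
  assume "mb E \<noteq> 0"
  from DERIV_divide[OF monodromy_deriv(3,2) this]
  show "((\<lambda>E. ms E / mb E) has_real_derivative - gap_num E / (mb E)\<^sup>2) (at E)"
    by (rule back_subst) (simp add: gap_num_def power2_eq_square algebra_simps)
qed

lemma mb_ms_pos_iff: "0 < mb E * ms E \<longleftrightarrow> 1 < \<bar>disc E\<bar>"
proof -
  have "0 < mb E * ms E \<longleftrightarrow> 1 < (disc E)\<^sup>2" using det[of E] by linarith
  also have "\<dots> \<longleftrightarrow> 1 < \<bar>disc E\<bar>" using abs_square_le_1[of "disc E"] by linarith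
  finally show ?thesis .
qed

text \<open>Up to sign, \<open>gap_num\<close> is the quadratic form of the Gram matrix with
  coefficients D s, - b s, D b. It is definite because (b s)^2 < D^2 b s, which holds as b s > 0 and
  D^2 = 1 + b s.\<close>

lemma gap_num_pos: "1 < \<bar>disc E\<bar> \<Longrightarrow> disc E * ms E < 0 \<Longrightarrow> 0 < gap_num E"
  and gap_num_neg: "1 < \<bar>disc E\<bar> \<Longrightarrow> 0 < disc E * ms E \<Longrightarrow> gap_num E < 0"
proof -
  have key: "(mb E * ms E)\<^sup>2 < (disc E * ms E) * (disc E * mb E)" if "1 < \<bar>disc E\<bar>"
  proof -
    have p: "0 < mb E * ms E" using that mb_ms_pos_iff by blast
    have "(mb E * ms E) * (mb E * ms E) < (mb E * ms E) * (disc E)\<^sup>2"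
      using p det[of E] by (intro mult_strict_left_mono) auto
    then show ?thesis by (simp add: power2_eq_square mult_ac)
  qed
  show "0 < gap_num E" if "1 < \<bar>disc E\<bar>" "disc E * ms E < 0"
    using quadratic_form_pos[of "- (disc E * ms E)" "mb E * ms E" "- (disc E * mb E)" E] key[OF that(1)] that(2)
    by (simp add: gap_num_def algebra_simps)
  show "gap_num E < 0" if "1 < \<bar>disc E\<bar>" "0 < disc E * ms E"
    using quadratic_form_pos[of "disc E * ms E" "- (mb E * ms E)" "disc E * mb E" E] key[OF that(1)] that(2)
    by (simp add: gap_num_def algebra_simps)
qed

text \<open>If both off-diagonal entries vanished, their derivatives \<open>-D P\<close> and \<open>D R\<close> of opposite sign would
  make their product negative nearby, putting \<open>a\<close> in the interior of the spectrum.\<close>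

lemma edge_not_degenerate:
  assumes near: "\<And>P. eventually P (at a) \<Longrightarrow> \<exists>E. P E \<and> 1 < \<bar>disc E\<bar>" and a: "\<bar>disc a\<bar> = 1"
  shows "mb a = 0 \<longleftrightarrow> ms a \<noteq> 0"
proof -
  have d1: "(disc a)\<^sup>2 = 1" using a by (metis power2_abs one_power2)
  then have z: "mb a = 0 \<or> ms a = 0" using det[of a] by simp
  have False if "mb a = 0" "ms a = 0"
  proof -
    have "((\<lambda>E. (mb E - mb a) / (E - a)) \<longlongrightarrow> - (disc a * PP a)) (at a)"
      using monodromy_deriv(2)[of a] that by (simp add: has_field_derivative_iff)
    moreover have "((\<lambda>E. (ms E - ms a) / (E - a)) \<longlongrightarrow> disc a * RR a) (at a)"
      using monodromy_deriv(3)[of a] that by (simp add: has_field_derivative_iff)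
    ultimately have "((\<lambda>E. (mb E - mb a) / (E - a) * ((ms E - ms a) / (E - a))) \<longlongrightarrow>
       - (disc a * PP a) * (disc a * RR a)) (at a)" by (rule tendsto_mult)
    moreover have "- (disc a * PP a) * (disc a * RR a) = - ((disc a)\<^sup>2 * (PP a * RR a))"
      by (simp add: power2_eq_square mult_ac)
    then have "- (disc a * PP a) * (disc a * RR a) < 0"
      unfolding d1 using mult_pos_pos[OF PP_pos[of a] RR_pos[of a]] by linarith
    ultimately have "eventually (\<lambda>E. (mb E - mb a) / (E - a) * ((ms E - ms a) / (E - a)) < 0) (at a)"
      by (rule order_tendstoD(2))
    from near[OF this] obtain E where "(mb E - mb a) / (E - a) * ((ms E - ms a) / (E - a)) < 0"
      and dE: "1 < \<bar>disc E\<bar>" by blast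
    then have E: "mb E / (E - a) * (ms E / (E - a)) < 0" unfolding that by (simp only: diff_zero)
    have "mb E / (E - a) * (ms E / (E - a)) = mb E * ms E / (E - a)\<^sup>2" by (simp add: power2_eq_square)
    with E dE mb_ms_pos_iff[of E] show False
      by (metis divide_nonneg_nonneg less_imp_le not_less zero_le_power2)
  qed
  with z show ?thesis by blast
qed

text \<open>For each k the eigenvalue count is m from the top of band m up to the next band. An
  energy inside with \<open>\<bar>disc E\<bar> \<le> 1\<close> would be an eigenvalue for k = arccos
  (disc E) and raise the count. At the edges continuity gives at least 1, and more than 1 is
  impossible because eigenvalues come arbitrarily close. If the lower edge is an eigenvalue for k
  but \<open>band eps mu m k\<close> lay below it, the count at the edge would exceed m.\<close>

lemma gap_edges:
  assumes m: "1 \<le> m" and gap: "band_max eps mu m < band_min eps mu (m + 1)"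
  shows "\<And>E. E \<in> {band_max eps mu m<..<band_min eps mu (m + 1)} \<Longrightarrow> 1 < \<bar>disc E\<bar>"
    "\<bar>disc (band_max eps mu m)\<bar> = 1" "\<bar>disc (band_min eps mu (m + 1))\<bar> = 1"
    "\<And>k. k \<in> {-pi..pi} \<Longrightarrow> disc (band_max eps mu m) = cos k \<Longrightarrow> band eps mu m k = band_max eps mu m"
proof -
  let ?a = "band_max eps mu m" and ?b = "band_min eps mu (m + 1)"
  have m1: "1 \<le> m + 1" by simp
  have le: "band eps mu m k \<le> ?a" "?b \<le> band eps mu (m + 1) k" if "k \<in> {-pi..pi}" for k
    unfolding band_max_def band_min_def
    using that band_bounds[OF m] band_bounds[OF m1] by (auto intro!: cSUP_upper cINF_lower)
  \<comment> \<open>The lower edge is included, so an eigenvalue at the band top is already counted;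
    the last claim depends on this.\<close>
  have count: "eig_count eps mu k E = m" if "k \<in> {-pi..pi}" "?a \<le> E" "E < ?b" for k E
    using le[OF that(1)] that(2,3) le_eig_count_iff[OF m, of k E] le_eig_count_iff[OF m1, of k E] by auto
  show gap1: "1 < \<bar>disc E\<bar>" if "E \<in> {?a<..<?b}" for E
  proof (rule ccontr)
    assume "\<not> 1 < \<bar>disc E\<bar>"
    then have d: "- 1 \<le> disc E" "disc E \<le> 1" by auto
    define k where "k = arccos (disc E)"
    have k: "k \<in> {-pi..pi}" "disc E = cos k"
      using arccos_bounded[OF d] cos_arccos[OF d] by (auto simp: k_def)
    have "eig_count eps mu k ?a < eig_count eps mu k E"
      using that k by (intro eig_count_strict_mono) auto
    then show False using count[OF k(1)] that by auto
  qed
  have cd: "isCont (\<lambda>E. \<bar>disc E\<bar>) E" for E using monodromy_isCont(1) by (intro continuous_intros)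
  have tendsto_nhds: "((\<lambda>E. \<bar>disc E\<bar>) \<longlongrightarrow> \<bar>disc e\<bar>) (nhds e)" for e
    using cd[of e] tendsto_at_iff_tendsto_nhds[of "\<lambda>E. \<bar>disc E\<bar>" e] by (simp add: continuous_at)
  have away: "\<exists>d>0. \<forall>E. \<bar>E - e\<bar> < d \<longrightarrow> 1 < \<bar>disc E\<bar>" if "1 < \<bar>disc e\<bar>" for e
  proof -
    have "eventually (\<lambda>E. 1 < \<bar>disc E\<bar>) (nhds e)"
      by (rule order_tendstoD(1)[OF tendsto_nhds that])
    then show ?thesis unfolding eventually_nhds_metric by (auto simp: dist_real_def)
  qed
  have inside: "\<exists>d>0. \<forall>E. \<bar>E - e\<bar> < d \<longrightarrow> \<bar>disc E\<bar> < 1" if "\<bar>disc e\<bar> < 1" for e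
  proof -
    have "eventually (\<lambda>E. \<bar>disc E\<bar> < 1) (nhds e)"
      by (rule order_tendstoD(2)[OF tendsto_nhds that])
    then show ?thesis unfolding eventually_nhds_metric by (auto simp: dist_real_def)
  qed
  have ge: "\<not> \<bar>disc e\<bar> < 1" if e: "e = ?a \<or> e = ?b" for e
  proof
    assume "\<bar>disc e\<bar> < 1"
    from inside[OF this] obtain d where d: "d > 0" "\<And>E. \<bar>E - e\<bar> < d \<Longrightarrow> \<bar>disc E\<bar> < 1" by blast
    define h where "h = min (d / 2) ((?b - ?a) / 2)"
    have h: "0 < h" "h < d" "h < ?b - ?a" using d(1) gap by (auto simp: h_def min_less_iff_disj)
    from e show False
    proof
      assume "e = ?a"
      then show False using d(2)[of "?a + h"] gap1[of "?a + h"] h by auto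
    next
      assume "e = ?b"
      then show False using d(2)[of "?b - h"] gap1[of "?b - h"] h by auto
    qed
  qed
  have ne: "{-pi..pi} \<noteq> {}" by simp
  have supD: "\<exists>k\<in>{-pi..pi}. y < band eps mu m k" if "y < ?a" for y
    using that less_cSUP_iff[OF ne band_bounds(1)[OF m], of y] by (simp only: band_max_def)
  have infD: "\<exists>k\<in>{-pi..pi}. band eps mu (m + 1) k < y" if "?b < y" for y
    using that cINF_less_iff[OF ne band_bounds(2)[OF m1], of y] by (simp only: band_min_def)
  have "\<not> 1 < \<bar>disc ?a\<bar>"
  proof
    assume "1 < \<bar>disc ?a\<bar>"
    from away[OF this] obtain d where d: "d > 0" "\<And>E. \<bar>E - ?a\<bar> < d \<Longrightarrow> 1 < \<bar>disc E\<bar>" by blast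
    have "?a - d < ?a" using d(1) by simp
    from supD[OF this] obtain k where k: "k \<in> {-pi..pi}" "?a - d < band eps mu m k" by blast
    with le[OF k(1)] d have "1 < \<bar>disc (band eps mu m k)\<bar>" by auto
    then show False using disc_band[OF m, of k] by (metis abs_cos_le_one not_less)
  qed
  with ge[of ?a] show "\<bar>disc ?a\<bar> = 1" by auto
  have "\<not> 1 < \<bar>disc ?b\<bar>"
  proof
    assume "1 < \<bar>disc ?b\<bar>"
    from away[OF this] obtain d where d: "d > 0" "\<And>E. \<bar>E - ?b\<bar> < d \<Longrightarrow> 1 < \<bar>disc E\<bar>" by blast
    have "?b < ?b + d" using d(1) by simp
    from infD[OF this] obtain k where k: "k \<in> {-pi..pi}" "band eps mu (m + 1) k < ?b + d" by blast
    with le[OF k(1)] d have "1 < \<bar>disc (band eps mu (m + 1) k)\<bar>" by auto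
    then show False using disc_band[OF m1, of k] by (metis abs_cos_le_one not_less)
  qed
  with ge[of ?b] show "\<bar>disc ?b\<bar> = 1" by auto
  show "band eps mu m k = ?a" if k: "k \<in> {-pi..pi}" "disc ?a = cos k" for k
  proof (rule ccontr)
    assume "band eps mu m k \<noteq> ?a"
    with le[OF k(1)] have lt: "band eps mu m k < ?a" by simp
    have "m \<le> eig_count eps mu k (band eps mu m k)" using le_eig_count_iff[OF m] by blast
    also have "\<dots> < eig_count eps mu k ?a" by (rule eig_count_strict_mono[OF lt k(2)])
    finally show False using count[OF k(1), of ?a] gap by simp
  qed
qed

end

section \<open>One gap of the spectrum: entries of the monodromy matrix at its edges and
  inside\<close>

locale spectral_gap = sl_coeffs +
  fixes a b :: real
  assumes ab: "a < b" and gap: "\<And>E. E \<in> {a<..<b} \<Longrightarrow> 1 < \<bar>disc E\<bar>"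
    and edge_a: "\<bar>disc a\<bar> = 1" and edge_b: "\<bar>disc b\<bar> = 1"
begin

lemma edge_a_simple: "mb a = 0 \<longleftrightarrow> ms a \<noteq> 0"
proof (rule edge_not_degenerate[OF _ edge_a])
  fix P assume "eventually P (at a)"
  then have "eventually P (at_right a)" by (simp add: eventually_at_split)
  moreover have "eventually (\<lambda>E. E \<in> {a<..<b}) (at_right a)" using ab by (rule eventually_at_right_real)
  ultimately have "eventually (\<lambda>E. P E \<and> E \<in> {a<..<b}) (at_right a)" by eventually_elim auto
  then have "\<exists>E. P E \<and> E \<in> {a<..<b}" using eventually_happens trivial_limit_at_right_real by blast
  then show "\<exists>E. P E \<and> 1 < \<bar>disc E\<bar>" using gap by blast
qed

lemma edge_b_simple: "mb b = 0 \<longleftrightarrow> ms b \<noteq> 0"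
proof (rule edge_not_degenerate[OF _ edge_b])
  fix P assume "eventually P (at b)"
  then have "eventually P (at_left b)" by (simp add: eventually_at_split)
  moreover have "eventually (\<lambda>E. E \<in> {a<..<b}) (at_left b)" using ab by (rule eventually_at_left_real)
  ultimately have "eventually (\<lambda>E. P E \<and> E \<in> {a<..<b}) (at_left b)" by eventually_elim auto
  then have "\<exists>E. P E \<and> E \<in> {a<..<b}" using eventually_happens trivial_limit_at_left_real by blast
  then show "\<exists>E. P E \<and> 1 < \<bar>disc E\<bar>" using gap by blast
qed

lemma mb_ms_pos: "E \<in> {a<..<b} \<Longrightarrow> 0 < mb E * ms E"
  using gap mb_ms_pos_iff by blast

text \<open>The expression is the derivative of D^2 at the lower edge, where D^2 = 1. A negative
  derivative would force D^2 < 1 just inside the gap.\<close>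

lemma disc_deriv_at_edge: "0 \<le> disc a * (mb a * RR a - ms a * PP a)"
proof (rule ccontr)
  assume neg: "\<not> ?thesis"
  have "((\<lambda>E. disc E * disc E) has_real_derivative disc a * (mb a * RR a - ms a * PP a)) (at a)"
    by (rule derivative_eq_intros monodromy_deriv refl)+ (simp add: algebra_simps)
  from DERIV_neg_dec_right[OF this] neg obtain d where
    d: "d > 0" "\<And>h. 0 < h \<Longrightarrow> h < d \<Longrightarrow> disc (a + h) * disc (a + h) < disc a * disc a" by auto
  define h where "h = min (d / 2) ((b - a) / 2)"
  have h: "0 < h" "h < d" "h < b - a" using d(1) ab by (auto simp: h_def min_less_iff_disj)
  have "disc a * disc a = 1" using edge_a by (metis abs_mult_self_eq mult_1)
  then have "mb (a + h) * ms (a + h) < 0"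
    using d(2)[OF h(1,2)] det[of "a + h"] by (simp add: power2_eq_square)
  with mb_ms_pos[of "a + h"] h show False by auto
qed

lemma sign_constant:
  assumes f: "\<And>E. isCont f E" and nz: "\<And>E. E \<in> {a..<b} \<Longrightarrow> f E \<noteq> (0::real)" and E: "E \<in> {a<..<b}"
  shows "0 < f a \<longleftrightarrow> 0 < f E"
proof (rule ccontr)
  assume "\<not> ?thesis"
  then have "f a \<le> 0 \<and> 0 \<le> f E \<or> 0 \<le> f a \<and> f E \<le> 0" by auto
  then obtain x where "a \<le> x" "x \<le> E" "f x = 0"
    using IVT[of f a 0 E] IVT2[of f E 0 a] f E by auto
  with nz[of x] E show False by auto
qed

text \<open>With b = 0 at a, the sign of the derivative of D^2 there forces D s <= 0, and D s has no
  zero on [a, b), so it is negative in the gap and b / s increases. If the entry b also vanished at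
  the upper edge, s would not, and the positive ratio would increase to 0, a contradiction.\<close>

lemma even_gap:
  assumes "mb a = 0"
  shows "\<And>E. E \<in> {a<..<b} \<Longrightarrow> disc E * ms E < 0" "ms a \<noteq> 0" "ms b = 0" "mb b \<noteq> 0"
    "\<And>x y. x \<in> {a<..<b} \<Longrightarrow> y \<in> {a<..<b} \<Longrightarrow> x < y \<Longrightarrow> mb x / ms x < mb y / ms y"
proof -
  show ms: "ms a \<noteq> 0" using edge_a_simple assms by blast
  have "disc a * ms a * PP a \<le> 0" using disc_deriv_at_edge assms by (simp add: algebra_simps)
  then have "disc a * ms a \<le> 0" using PP_pos[of a] by (simp add: mult_le_0_iff)
  have nz: "disc E * ms E \<noteq> 0" if "E \<in> {a..<b}" for E
    using that ms edge_a mb_ms_pos[of E] gap[of E] by (cases "E = a") auto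
  have c: "isCont (\<lambda>E. disc E * ms E) E" for E by (intro continuous_intros monodromy_isCont)
  show neg: "disc E * ms E < 0" if "E \<in> {a<..<b}" for E
  proof -
    have "disc E * ms E \<noteq> 0" by (rule nz) (use that in auto)
    then show ?thesis
      using sign_constant[of "\<lambda>E. disc E * ms E", OF c nz that] \<open>disc a * ms a \<le> 0\<close> by linarith
  qed
  have pos: "0 < gap_num E" if "E \<in> {a<..<b}" for E using gap_num_pos gap[OF that] neg[OF that] .
  have msnz: "ms E \<noteq> 0" if "E \<in> {a<..<b}" for E using neg[OF that] by auto
  \<comment> \<open>The right point may be the upper edge itself as long as s does not vanish there;
    this is the case that the contradiction for \<open>mb b\<close> runs through.\<close>
  have inc: "mb x / ms x < mb y / ms y" if "x \<in> {a<..<b}" "y \<in> {a<..b}" "ms y \<noteq> 0" "x < y" for x y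
  proof (rule DERIV_pos_imp_increasing_open[OF that(4)])
    fix E assume "x < E" "E < y"
    then have E: "E \<in> {a<..<b}" using that by auto
    show "\<exists>l. ((\<lambda>E. mb E / ms E) has_real_derivative l) (at E) \<and> 0 < l"
      using ratio_deriv(1)[OF msnz[OF E]] pos[OF E] msnz[OF E] by fastforce
  next
    have "ms E \<noteq> 0" if "E \<in> {x..y}" for E
      using that \<open>x \<in> {a<..<b}\<close> \<open>y \<in> {a<..b}\<close> \<open>ms y \<noteq> 0\<close> msnz[of E] by (cases "E = y") auto
    then show "continuous_on {x..y} (\<lambda>E. mb E / ms E)"
      by (intro continuous_at_imp_continuous_on ballI continuous_intros monodromy_isCont) auto
  qed
  show "mb x / ms x < mb y / ms y" if "x \<in> {a<..<b}" "y \<in> {a<..<b}" "x < y" for x y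
    using inc[of x y] that msnz by auto
  show "mb b \<noteq> 0"
  proof
    assume "mb b = 0"
    then have "ms b \<noteq> 0" using edge_b_simple by blast
    have x: "(a + b) / 2 \<in> {a<..<b}" using ab by auto
    from inc[OF x _ \<open>ms b \<noteq> 0\<close>] ab \<open>mb b = 0\<close> have "mb ((a + b) / 2) / ms ((a + b) / 2) < 0" by auto
    with mb_ms_pos[OF x] show False by (auto simp: divide_less_0_iff zero_less_mult_iff)
  qed
  then show "ms b = 0" using edge_b_simple by blast
qed

text \<open>Mirror image of the even case with the off-diagonal entries exchanged. The ratio is
  inverted to s / b, which starts at 0 on the lower edge and increases.\<close>

lemma odd_gap:
  assumes "ms a = 0"
  shows "\<And>E. E \<in> {a<..<b} \<Longrightarrow> 0 < disc E * ms E" "mb a \<noteq> 0" "mb b = 0" "ms b \<noteq> 0"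
    "\<And>x y. x \<in> {a<..<b} \<Longrightarrow> y \<in> {a<..<b} \<Longrightarrow> x < y \<Longrightarrow> ms x / mb x < ms y / mb y"
proof -
  show mb: "mb a \<noteq> 0" using edge_a_simple assms by blast
  have "0 \<le> disc a * mb a * RR a" using disc_deriv_at_edge assms by (simp add: algebra_simps)
  then have "0 \<le> disc a * mb a" using RR_pos[of a] by (simp add: zero_le_mult_iff)
  have nz: "disc E * mb E \<noteq> 0" if "E \<in> {a..<b}" for E
    using that mb edge_a mb_ms_pos[of E] gap[of E] by (cases "E = a") auto
  have c: "isCont (\<lambda>E. disc E * mb E) E" for E by (intro continuous_intros monodromy_isCont)
  have posb: "0 < disc E * mb E" if "E \<in> {a<..<b}" for E
  proof -
    have "disc a * mb a \<noteq> 0" by (rule nz) (use ab in auto)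
    then show ?thesis
      using sign_constant[of "\<lambda>E. disc E * mb E", OF c nz that] \<open>0 \<le> disc a * mb a\<close> by linarith
  qed
  show poss: "0 < disc E * ms E" if "E \<in> {a<..<b}" for E
    using posb[OF that] mb_ms_pos[OF that] by (auto simp: zero_less_mult_iff)
  have pos: "gap_num E < 0" if "E \<in> {a<..<b}" for E using gap_num_neg gap[OF that] poss[OF that] .
  have mbnz: "mb E \<noteq> 0" if "E \<in> {a<..<b}" for E using posb[OF that] by auto
  have inc: "ms x / mb x < ms y / mb y" if "x \<in> {a<..<b}" "y \<in> {a<..b}" "mb y \<noteq> 0" "x < y" for x y
  proof (rule DERIV_pos_imp_increasing_open[OF that(4)])
    fix E assume "x < E" "E < y"
    then have E: "E \<in> {a<..<b}" using that by auto
    have "0 < - gap_num E / (mb E)\<^sup>2" using pos[OF E] mbnz[OF E] by (intro divide_pos_pos) auto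
    with ratio_deriv(2)[OF mbnz[OF E]]
    show "\<exists>l. ((\<lambda>E. ms E / mb E) has_real_derivative l) (at E) \<and> 0 < l" by blast
  next
    have "mb E \<noteq> 0" if "E \<in> {x..y}" for E
      using that \<open>x \<in> {a<..<b}\<close> \<open>y \<in> {a<..b}\<close> \<open>mb y \<noteq> 0\<close> mbnz[of E] by (cases "E = y") auto
    then show "continuous_on {x..y} (\<lambda>E. ms E / mb E)"
      by (intro continuous_at_imp_continuous_on ballI continuous_intros monodromy_isCont) auto
  qed
  show "ms x / mb x < ms y / mb y" if "x \<in> {a<..<b}" "y \<in> {a<..<b}" "x < y" for x y
    using inc[of x y] that mbnz by auto
  show "ms b \<noteq> 0"
  proof
    assume "ms b = 0"
    then have "mb b \<noteq> 0" using edge_b_simple by blast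
    have x: "(a + b) / 2 \<in> {a<..<b}" using ab by auto
    from inc[OF x _ \<open>mb b \<noteq> 0\<close>] ab \<open>ms b = 0\<close> have "ms ((a + b) / 2) / mb ((a + b) / 2) < 0" by auto
    with mb_ms_pos[OF x] show False by (auto simp: divide_less_0_iff zero_less_mult_iff)
  qed
  then show "mb b = 0" using edge_b_simple by blast
qed

end

section \<open>Bulk index and parity of the Bloch mode\<close>

context sl_coeffs
begin

lemma spectral_gapI:
  assumes "1 \<le> m" "band_max eps mu m < band_min eps mu (m + 1)"
  shows "spectral_gap eps mu (band_max eps mu m) (band_min eps mu (m + 1))"
  using gap_edges[OF assms] assms(2) by unfold_locales auto

text \<open>For k in {0, pi} the phases of n and - n agree, so evenness at integers is automatic. At
  any other point the floor of - x is - floor x - 1, and the extra phase \<open>cis k\<close>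
  together with the reflection of the cell gives the stated condition.\<close>

lemma bloch_ext_even_iff:
  assumes k: "k \<in> {0, pi}"
  shows "(\<forall>x. bloch_ext k u (- x) = bloch_ext k u x) \<longleftrightarrow> (\<forall>x\<in>{0<..<1}. cis k * u (1 - x) = u x)"
proof -
  have ck: "cis (k * of_int (- n)) = cis (k * of_int n)" for n
    using k by (auto simp: complex_eq_iff sin_npi_int)
  have ck1: "cis (- k) = cis k" using ck[of 1] by simp
  have cell: "bloch_ext k u (- x) = cis (k * of_int \<lfloor>x\<rfloor>) * (cis k * u (1 - (x - of_int \<lfloor>x\<rfloor>)))"
    if "x \<notin> \<int>" for x
  proof -
    have fl: "\<lfloor>- x\<rfloor> = - \<lfloor>x\<rfloor> - 1" using that
      by (metis Ints_of_int ceiling_def ceiling_altdef diff_minus_eq_add minus_diff_eq minus_minus uminus_add_conv_diff)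
    have "cis (k * of_int \<lfloor>- x\<rfloor>) = cis (k * of_int (- \<lfloor>x\<rfloor>)) * cis (- k)"
    proof -
      have "k * of_int \<lfloor>- x\<rfloor> = k * of_int (- \<lfloor>x\<rfloor>) + - k" by (simp add: fl algebra_simps)
      then show ?thesis by (simp only: cis_mult)
    qed
    also have "\<dots> = cis (k * of_int \<lfloor>x\<rfloor>) * cis k" by (simp only: ck ck1)
    finally show ?thesis unfolding bloch_ext_def by (simp add: fl mult_ac algebra_simps)
  qed
  show ?thesis
  proof
    assume e: "\<forall>x. bloch_ext k u (- x) = bloch_ext k u x"
    show "\<forall>x\<in>{0<..<1}. cis k * u (1 - x) = u x"
    proof
      fix x :: real assume x: "x \<in> {0<..<1}"
      then have fl: "\<lfloor>x\<rfloor> = 0" by (simp add: floor_eq_iff)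
      have "x \<notin> \<int>" using x by (auto elim!: Ints_cases)
      with cell[of x] e[THEN spec, of x] show "cis k * u (1 - x) = u x" by (simp add: fl bloch_ext_def)
    qed
  next
    assume e: "\<forall>x\<in>{0<..<1}. cis k * u (1 - x) = u x"
    show "\<forall>x. bloch_ext k u (- x) = bloch_ext k u x"
    proof
      fix x :: real
      show "bloch_ext k u (- x) = bloch_ext k u x"
      proof (cases "x \<in> \<int>")
        case True
        then obtain n where "x = of_int n" by (elim Ints_cases)
        then show ?thesis using ck[of n] by (simp add: bloch_ext_def floor_minus)
      next
        case False
        then have "x - of_int \<lfloor>x\<rfloor> \<in> {0<..<1}"
          by (metis floor_correct frac_def frac_gt_0_iff frac_lt_1 greaterThanLessThan_iff)
        with e cell[OF False] show ?thesis by (simp add: bloch_ext_def)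
      qed
    qed
  qed
qed

text \<open>If b = 0 at the edge, \<open>cu\<close> is a Bloch mode and its reflection formula makes
  it even. If b is not 0, then s = 0 and every eigenfunction is a multiple of \<open>su\<close>,
  which is odd under the same reflection; an even one would vanish inside the cell, and also at both
  ends since \<open>su\<close> is 0 there.\<close>

lemma bulk_index_iff:
  assumes m: "1 \<le> m" and gp: "band_max eps mu m < band_min eps mu (m + 1)"
  shows "bulk_index eps mu m = 1 \<longleftrightarrow> mb (band_max eps mu m) = 0"
proof -
  let ?a = "band_max eps mu m"
  interpret spectral_gap eps mu ?a "band_min eps mu (m + 1)" by (rule spectral_gapI[OF m gp])
  have cisk: "cis k = of_real (disc ?a)" if "k \<in> {0, pi}" "disc ?a = cos k" for k
    using that by (auto simp: complex_eq_iff)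
  have dd: "of_real (disc ?a) * (of_real (disc ?a) * z) = (z :: complex)" for z
    using edge_a by (auto simp: abs_if split: if_splits)
  show ?thesis
  proof
    assume "bulk_index eps mu m = 1"
    then have "\<exists>k\<in>{0, pi}. band eps mu m k = ?a \<and> (\<exists>u\<in>eigsp eps mu k ?a.
             (\<exists>x\<in>{0..1}. u x \<noteq> 0) \<and> (\<forall>x. bloch_ext k u (- x) = bloch_ext k u x))"
      unfolding bulk_index_def by (rule contrapos_pp) simp
    then obtain k u x where k: "k \<in> {0, pi}" and ka: "band eps mu m k = ?a"
      and u: "u \<in> eigsp eps mu k ?a" and x: "x \<in> {0..1}" "u x \<noteq> 0"
      and ev: "\<forall>x. bloch_ext k u (- x) = bloch_ext k u x"
      by blast
    have dk: "disc ?a = cos k" using disc_band[OF m, of k] ka by simp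
    show "mb ?a = 0"
    proof (rule ccontr)
      assume nz: "mb ?a \<noteq> 0"
      then have ms0: "ms ?a = 0" using edge_a_simple by blast
      obtain \<alpha> \<beta> where ab: "\<And>x. x \<in> {0..1} \<Longrightarrow> u x = \<alpha> * of_real (cu ?a x) + \<beta> * of_real (su ?a x)"
        "\<alpha> * of_real (mb ?a) + \<beta> * of_real (disc ?a) = cis k * \<beta>" using eigspD[OF u] by metis
      have "\<alpha> = 0" using ab(2) nz unfolding cisk[OF k dk] by simp
      then have us: "u y = \<beta> * of_real (su ?a y)" if "y \<in> {0..1}" for y using ab(1)[OF that] by simp
      have "u y = 0" if "y \<in> {0<..<1}" for y
      proof -
        have "u (1 - y) = - (of_real (disc ?a) * u y)"
          using us[of y] us[of "1 - y"] s_reflect[of y ?a] that ms0 by simp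
        moreover have "cis k * u (1 - y) = u y" using bloch_ext_even_iff[OF k, of u] ev that by blast
        ultimately have "- u y = u y" unfolding cisk[OF k dk] using dd[of "u y"] by simp
        then show ?thesis by simp
      qed
      moreover have "u 0 = 0" "u 1 = 0" using us[of 0] us[of 1] ms0 by (simp_all add: ms_def)
      ultimately show False using x by (cases "x = 0"; cases "x = 1") auto
    qed
  next
    assume mb0: "mb ?a = 0"
    \<comment> \<open>The quasimomentum is read off the sign of D at the edge;
      \<open>gap_edges\<close> then guarantees that band m attains its top at this very k.\<close>
    define k where "k = (if disc ?a = 1 then 0 else pi)"
    have k: "k \<in> {0, pi}" "disc ?a = cos k" using edge_a by (auto simp: k_def abs_if split: if_splits)
    have ka: "band eps mu m k = ?a" using gap_edges(4)[OF m gp, of k] k by auto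
    let ?u = "\<lambda>x. 1 * complex_of_real (cu ?a x) + 0 * of_real (su ?a x)"
    have u: "?u \<in> eigsp eps mu k ?a"
      by (rule eigspI) (simp_all add: mb0 cisk[OF k])
    have "cis k * ?u (1 - x) = ?u x" if "x \<in> {0<..<1}" for x
      using c_reflect[of x ?a] that dd[of "of_real (cu ?a x)"] by (simp add: mb0 cisk[OF k])
    then have ev: "\<forall>x. bloch_ext k ?u (- x) = bloch_ext k ?u x"
      using bloch_ext_even_iff[OF k(1), of ?u] by blast
    have nz: "\<exists>x\<in>{0..1}. ?u x \<noteq> 0" by (intro bexI[of _ 0]) auto
    have "\<exists>k\<in>{0, pi}. band eps mu m k = ?a \<and> (\<exists>u\<in>eigsp eps mu k ?a.
             (\<exists>x\<in>{0..1}. u x \<noteq> 0) \<and> (\<forall>x. bloch_ext k u (- x) = bloch_ext k u x))"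
      by (intro bexI[OF _ k(1)] conjI bexI[OF _ u] ka nz ev)
    then show "bulk_index eps mu m = 1" unfolding bulk_index_def by (rule if_P)
  qed
qed

end

section \<open>Decaying solutions\<close>

lemma cell_recursion:
  fixes f :: "real \<Rightarrow> real"
  assumes c: "\<And>b. continuous_on {0..b} f" and f: "\<And>x. 0 \<le> x \<Longrightarrow> f (x + 1) = c * f x"
  shows "integral {0..real (Suc n)} (\<lambda>x. (f x)\<^sup>2) =
     integral {0..1} (\<lambda>x. (f x)\<^sup>2) + c\<^sup>2 * integral {0..real n} (\<lambda>x. (f x)\<^sup>2)"
proof -
  have c2: "continuous_on {0..b} (\<lambda>x. (f x)\<^sup>2)" for b by (intro continuous_intros c)
  have "integral {0..real (Suc n)} (\<lambda>x. (f x)\<^sup>2) =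
     integral {0..1} (\<lambda>x. (f x)\<^sup>2) + integral {1..real (Suc n)} (\<lambda>x. (f x)\<^sup>2)"
    by (rule Henstock_Kurzweil_Integration.integral_combine[symmetric])
       (auto intro: integrable_continuous_real c2)
  also have "integral {1..real (Suc n)} (\<lambda>x. (f x)\<^sup>2) = integral {0 + 1..real n + 1} (\<lambda>x. (f x)\<^sup>2)"
    by (simp add: add.commute)
  also have "\<dots> = integral {0..real n} ((\<lambda>x. (f x)\<^sup>2) \<circ> (\<lambda>x. x + 1))"
    by (rule integral_shift[symmetric]) (rule continuous_on_subset[OF c2[of "real n + 1"]], auto)
  also have "\<dots> = integral {0..real n} (\<lambda>x. c\<^sup>2 * (f x)\<^sup>2)"
    by (rule integral_cong) (simp add: f power_mult_distrib)
  finally show ?thesis by simp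
qed

text \<open>With multiplier of modulus at least 1, each cell contributes at least as much as the
  first, so the integral grows at least linearly.\<close>

lemma integral_cell_lower_bound:
  fixes f :: "real \<Rightarrow> real"
  assumes c: "\<And>b. continuous_on {0..b} f" and f: "\<And>x. 0 \<le> x \<Longrightarrow> f (x + 1) = c * f x"
    and "1 \<le> \<bar>c\<bar>"
  shows "real n * integral {0..1} (\<lambda>x. (f x)\<^sup>2) \<le> integral {0..real n} (\<lambda>x. (f x)\<^sup>2)"
proof (induction n)
  case (Suc n)
  have "1 \<le> c\<^sup>2" using assms(3) by (metis abs_le_square_iff abs_1 one_power2)
  moreover have "0 \<le> integral {0..real n} (\<lambda>x. (f x)\<^sup>2)"
    by (intro integral_nonneg integrable_continuous_real continuous_intros c) auto
  ultimately have "1 * integral {0..real n} (\<lambda>x. (f x)\<^sup>2) \<le> c\<^sup>2 * integral {0..real n} (\<lambda>x. (f x)\<^sup>2)"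
    by (rule mult_right_mono)
  with Suc have "integral {0..1} (\<lambda>x. (f x)\<^sup>2) + real n * integral {0..1} (\<lambda>x. (f x)\<^sup>2)
      \<le> integral {0..real (Suc n)} (\<lambda>x. (f x)\<^sup>2)"
    using cell_recursion[of f c n, OF c f] by linarith
  then show ?case by (simp add: algebra_simps)
qed simp

text \<open>The bound I / (1 - c^2), where I is the integral over the first cell, is the fixed point
  of the recursion y -> I + c^2 y, that is, the sum of the geometric series of the cells.\<close>

lemma integral_cell_upper_bound:
  fixes f :: "real \<Rightarrow> real"
  assumes c: "\<And>b. continuous_on {0..b} f" and f: "\<And>x. 0 \<le> x \<Longrightarrow> f (x + 1) = c * f x"
    and c1: "\<bar>c\<bar> < 1"
  shows "integral {0..real n} (\<lambda>x. (f x)\<^sup>2) \<le> integral {0..1} (\<lambda>x. (f x)\<^sup>2) / (1 - c\<^sup>2)"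
proof -
  let ?I = "integral {0..1} (\<lambda>x. (f x)\<^sup>2)"
  have I: "0 \<le> ?I" by (intro integral_nonneg integrable_continuous_real continuous_intros c) auto
  have c2: "c\<^sup>2 < 1" using c1 by (simp add: abs_square_less_1)
  show ?thesis
  proof (induction n)
    case 0
    then show ?case using I c2 by simp
  next
    case (Suc n)
    have "c\<^sup>2 * integral {0..real n} (\<lambda>x. (f x)\<^sup>2) \<le> c\<^sup>2 * (?I / (1 - c\<^sup>2))"
      using Suc by (intro mult_left_mono) auto
    moreover have "?I + c\<^sup>2 * (?I / (1 - c\<^sup>2)) = ?I / (1 - c\<^sup>2)" using c2 by (simp add: field_simps)
    ultimately show ?case using cell_recursion[of f c n, OF c f] by linarith
  qed
qed

lemma integrable_on_UNIV_if_bounded: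
  fixes h :: "real \<Rightarrow> real"
  assumes h: "\<And>n::nat. h integrable_on {- real n..real n}" "\<And>x. 0 \<le> h x"
    and C: "\<And>n::nat. integral {- real n..real n} h \<le> C"
  shows "h integrable_on UNIV"
proof -
  let ?f = "\<lambda>(n::nat) x. if x \<in> {- real n..real n} then h x else 0"
  have int: "integral UNIV (?f n) = integral {- real n..real n} h" for n
    by (rule integral_restrict_UNIV)
  have ge: "0 \<le> integral {- real n..real n} h" for n :: nat
    using h by (intro integral_nonneg) auto
  show ?thesis
  proof (rule conjunct1[OF monotone_convergence_increasing])
    show "?f n integrable_on UNIV" for n using h(1) by (simp only: integrable_restrict_UNIV)
    show "?f n x \<le> ?f (Suc n) x" for n x using h(2) by auto
    show "(\<lambda>n. ?f n x) \<longlonglongrightarrow> h x" for x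
    proof (rule tendsto_eventually)
      obtain N where N: "\<bar>x\<bar> \<le> real N" using real_arch_simple by blast
      have "?f n x = h x" if "N \<le> n" for n using N that by auto
      then show "eventually (\<lambda>n. ?f n x = h x) sequentially" unfolding eventually_sequentially by blast
    qed
    show "bounded (range (\<lambda>n. integral UNIV (?f n)))"
      unfolding int bounded_iff using C ge by (intro exI[of _ C]) auto
  qed
qed

section \<open>Floquet multipliers and square integrability on the half-line\<close>

context sl_coeffs
begin

text \<open>In a gap the eigenvalues of the monodromy matrix are D + rho and D - rho. The sign is
  opposite to that of D, which makes D + rho the contracting one.\<close>

definition "rho E = - sgn (disc E) * sqrt (mb E * ms E)"

lemma rho_sq: "1 < \<bar>disc E\<bar> \<Longrightarrow> (rho E)\<^sup>2 = mb E * ms E"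
  using mb_ms_pos_iff[of E] by (auto simp: rho_def power_mult_distrib sgn_if)

lemma multiplier:
  assumes "1 < \<bar>disc E\<bar>"
  shows "(disc E + rho E) * (disc E - rho E) = 1" "\<bar>disc E + rho E\<bar> < 1" "1 \<le> \<bar>disc E - rho E\<bar>"
proof -
  show p: "(disc E + rho E) * (disc E - rho E) = 1"
    using rho_sq[OF assms] det[of E] by (simp add: algebra_simps power2_eq_square)
  define r where "r = sqrt (mb E * ms E)"
  have "0 \<le> r" using mb_ms_pos_iff[of E] assms by (simp add: r_def)
  then have g: "1 < \<bar>disc E - rho E\<bar>"
    using assms unfolding rho_def r_def[symmetric] by (auto simp: sgn_if)
  then show "1 \<le> \<bar>disc E - rho E\<bar>" by simp
  have p': "\<bar>disc E + rho E\<bar> * \<bar>disc E - rho E\<bar> = 1" using p by (metis abs_mult abs_1)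
  show "\<bar>disc E + rho E\<bar> < 1"
  proof (rule ccontr)
    assume "\<not> ?thesis"
    then have "1 * \<bar>disc E - rho E\<bar> \<le> \<bar>disc E + rho E\<bar> * \<bar>disc E - rho E\<bar>"
      by (intro mult_right_mono) auto
    with p' g show False by simp
  qed
qed

lemma ms_nonzero: "1 < \<bar>disc E\<bar> \<Longrightarrow> ms E \<noteq> 0"
  using mb_ms_pos_iff[of E] by auto

text \<open>The solutions whose initial data are the eigenvectors (s, - rho) and (s, rho) of the
  monodromy matrix, with multipliers D - rho and D + rho.\<close>

definition "grow E x = ms E * cu E x - rho E * su E x"
definition "decay E x = ms E * cu E x + rho E * su E x"

lemma grow_decay_continuous: "continuous_on {0..b} (grow E)" "continuous_on {0..b} (decay E)"
  unfolding grow_def[abs_def] decay_def[abs_def] by (intro continuous_intros fund_continuous)+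

lemma grow_decay_shift:
  assumes "1 < \<bar>disc E\<bar>" "0 \<le> x"
  shows "grow E (x + 1) = (disc E - rho E) * grow E x" "decay E (x + 1) = (disc E + rho E) * decay E x"
proof -
  have r: "mb E * ms E = rho E * rho E" using rho_sq[OF assms(1)] by (simp add: power2_eq_square)
  have "grow E (x + 1) = ms E * disc E * cu E x + (mb E * ms E) * su E x - rho E * ms E * cu E x - rho E * disc E * su E x"
    unfolding grow_def fund_shift[OF assms(2)] by (simp add: algebra_simps)
  also have "\<dots> = (disc E - rho E) * grow E x" unfolding r grow_def by (simp add: algebra_simps)
  finally show "grow E (x + 1) = (disc E - rho E) * grow E x" .
  have "decay E (x + 1) = ms E * disc E * cu E x + (mb E * ms E) * su E x + rho E * ms E * cu E x + rho E * disc E * su E x"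
    unfolding decay_def fund_shift[OF assms(2)] by (simp add: algebra_simps)
  also have "\<dots> = (disc E + rho E) * decay E x" unfolding r decay_def by (simp add: algebra_simps)
  finally show "decay E (x + 1) = (disc E + rho E) * decay E x" .
qed

text \<open>For a solution \<open>\<psi>\<close>, the combination \<open>\<psi>(x + 1) - \<lambda> \<psi>(x)\<close> with the contracting multiplier
  \<open>\<lambda>\<close> is a multiple of the growing Floquet solution.\<close>

lemma square_integrable_imp_decaying:
  fixes \<alpha> \<beta> :: complex
  assumes E: "1 < \<bar>disc E\<bar>"
    and \<psi>: "\<And>x. 0 \<le> x \<Longrightarrow> \<psi> x = \<alpha> * of_real (cu E x) + \<beta> * of_real (su E x)"
    and C: "\<And>n::nat. integral {0..real n} (\<lambda>x. (cmod (\<psi> x))\<^sup>2) \<le> C"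
  shows "\<alpha> * of_real (rho E) = \<beta> * of_real (ms E)"
proof (rule ccontr)
  assume ne: "\<not> ?thesis"
  define t where "t = \<beta> * of_real (ms E) - \<alpha> * of_real (rho E)"
  have t: "t \<noteq> 0" using ne by (auto simp: t_def)
  \<comment> \<open>A continuous closed form of \<open>\<psi>\<close>, which is described by the
    fundamental system on the half-line only.\<close>
  define \<phi> where "\<phi> x = \<alpha> * of_real (cu E x) + \<beta> * of_real (su E x)" for x
  have \<phi>c: "continuous_on {0..b} (\<lambda>x. (cmod (\<phi> x))\<^sup>2)" for b
    unfolding \<phi>_def[abs_def] by (intro continuous_intros fund_continuous)
  have C': "integral {0..real n} (\<lambda>x. (cmod (\<phi> x))\<^sup>2) \<le> C" for n
  proof -
    have "integral {0..real n} (\<lambda>x. (cmod (\<phi> x))\<^sup>2) = integral {0..real n} (\<lambda>x. (cmod (\<psi> x))\<^sup>2)"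
      by (rule integral_cong) (simp add: \<phi>_def \<psi>)
    with C show ?thesis by simp
  qed
  let ?l = "disc E + rho E"
  have r: "of_real (mb E) * of_real (ms E) = of_real (rho E) * (of_real (rho E) :: complex)"
    using rho_sq[OF E] by (metis of_real_mult power2_eq_square)
  have key: "of_real (ms E) * (\<phi> (x + 1) - of_real ?l * \<phi> x) = t * of_real (grow E x)" if "0 \<le> x" for x
  proof -
    have "of_real (ms E) * (\<phi> (x + 1) - of_real ?l * \<phi> x) =
      (\<beta> * of_real (ms E) - \<alpha> * of_real (rho E)) * of_real (ms E) * of_real (cu E x)
      + \<alpha> * (of_real (mb E) * of_real (ms E)) * of_real (su E x)
      - \<beta> * of_real (rho E) * of_real (ms E) * of_real (su E x)"
      unfolding \<phi>_def fund_shift[OF that] by (simp add: algebra_simps)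
    also have "\<dots> = t * of_real (grow E x)"
      unfolding r t_def grow_def by (simp add: algebra_simps)
    finally show ?thesis .
  qed
  have l1: "\<bar>?l\<bar> \<le> 1" using multiplier(2)[OF E] by simp
  have pw: "(cmod t)\<^sup>2 * (grow E x)\<^sup>2 \<le> (ms E)\<^sup>2 * (2 * (cmod (\<phi> (x + 1)))\<^sup>2 + 2 * (cmod (\<phi> x))\<^sup>2)"
    if "0 \<le> x" for x
  proof -
    have "(cmod t)\<^sup>2 * (grow E x)\<^sup>2 = (cmod (t * of_real (grow E x)))\<^sup>2"
      by (simp add: norm_mult power_mult_distrib)
    also have "\<dots> = (ms E)\<^sup>2 * (cmod (\<phi> (x + 1) - of_real ?l * \<phi> x))\<^sup>2"
      unfolding key[OF that, symmetric] norm_mult power_mult_distrib by simp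
    also have "(cmod (\<phi> (x + 1) - of_real ?l * \<phi> x))\<^sup>2 \<le> (cmod (\<phi> (x + 1)) + cmod (\<phi> x))\<^sup>2"
    proof (rule power_mono)
      have "cmod (of_real ?l * \<phi> x) = \<bar>?l\<bar> * cmod (\<phi> x)" by (simp only: norm_mult norm_of_real)
      also have "\<dots> \<le> 1 * cmod (\<phi> x)" using l1 by (rule mult_right_mono) simp
      finally show "cmod (\<phi> (x + 1) - of_real ?l * \<phi> x) \<le> cmod (\<phi> (x + 1)) + cmod (\<phi> x)"
        using norm_triangle_ineq4[of "\<phi> (x + 1)" "of_real ?l * \<phi> x"] by linarith
    qed simp
    also have "(cmod (\<phi> (x + 1)) + cmod (\<phi> x))\<^sup>2 \<le> 2 * (cmod (\<phi> (x + 1)))\<^sup>2 + 2 * (cmod (\<phi> x))\<^sup>2"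
      using sum_squares_bound[of "cmod (\<phi> (x + 1))" "cmod (\<phi> x)"] by (simp add: power2_sum)
    finally show ?thesis by (simp add: mult_left_mono)
  qed
  let ?h = "\<lambda>x. (cmod (\<phi> x))\<^sup>2"
  have shc: "continuous_on {0..b} (\<lambda>x. ?h (x + 1))" for b
    by (rule continuous_on_compose2[OF \<phi>c[of "b + 1"]]) (auto intro!: continuous_intros)
  have sh: "integral {0..real n} (\<lambda>x. ?h (x + 1)) \<le> C" for n
  proof -
    have "integral {0..real n} (\<lambda>x. ?h (x + 1)) = integral {0 + 1..real n + 1} ?h"
      using integral_shift[of 0 1 "real n" ?h] continuous_on_subset[OF \<phi>c[of "real n + 1"], of "{1..real n + 1}"]
      by (simp add: o_def)
    also have "\<dots> \<le> integral {0..real (Suc n)} ?h"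
      by (rule integral_subset_le) (auto intro!: integrable_continuous_real \<phi>c continuous_on_subset[OF \<phi>c[of "real n + 1"]])
    also have "\<dots> \<le> C" by (rule C')
    finally show ?thesis .
  qed
  \<comment> \<open>The right side does not depend on n, while the integral of the squared growing
    solution increases at least linearly in n; with t nonzero this is the contradiction.\<close>
  have bound: "(cmod t)\<^sup>2 * integral {0..real n} (\<lambda>x. (grow E x)\<^sup>2) \<le> (ms E)\<^sup>2 * (2 * C + 2 * C)" for n
  proof -
    have "(cmod t)\<^sup>2 * integral {0..real n} (\<lambda>x. (grow E x)\<^sup>2) = integral {0..real n} (\<lambda>x. (cmod t)\<^sup>2 * (grow E x)\<^sup>2)"
      by simp
    also have "\<dots> \<le> integral {0..real n} (\<lambda>x. (ms E)\<^sup>2 * (2 * ?h (x + 1) + 2 * ?h x))"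
      by (rule integral_le)
         (auto intro!: integrable_continuous_real continuous_intros grow_decay_continuous shc \<phi>c pw)
    also have "\<dots> = (ms E)\<^sup>2 * (2 * integral {0..real n} (\<lambda>x. ?h (x + 1)) + 2 * integral {0..real n} ?h)"
      by (simp add: Henstock_Kurzweil_Integration.integral_add integrable_continuous_real shc \<phi>c
          integrable_on_mult_right)
    also have "\<dots> \<le> (ms E)\<^sup>2 * (2 * C + 2 * C)"
      using sh[of n] C'[of n] by (intro mult_left_mono add_mono) auto
    finally show ?thesis .
  qed
  let ?J = "integral {0..1} (\<lambda>x. (grow E x)\<^sup>2)"
  have Jc: "(\<lambda>x. (grow E x)\<^sup>2) integrable_on {0..1}"
    by (intro integrable_continuous_real continuous_intros grow_decay_continuous)
  have "0 < ?J"
  proof -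
    have "0 \<le> ?J" using Jc by (intro integral_nonneg) auto
    moreover have "?J \<noteq> 0"
    proof
      assume "?J = 0"
      then have "((\<lambda>x. (grow E x)\<^sup>2) has_integral 0) (cbox 0 1)" using Jc by (simp add: has_integral_integral[symmetric] has_integral_iff)
      from has_integral_0_cbox_imp_0[OF _ _ this, of 0] have "(grow E 0)\<^sup>2 = 0"
        by (auto intro!: continuous_intros grow_decay_continuous)
      then show False using ms_nonzero[OF E] by (simp add: grow_def)
    qed
    ultimately show ?thesis by simp
  qed
  then have "0 < (cmod t)\<^sup>2 * ?J" using t by simp
  then obtain n :: nat where n: "(ms E)\<^sup>2 * (2 * C + 2 * C) < real n * ((cmod t)\<^sup>2 * ?J)"
    using reals_Archimedean3 by blast
  have "real n * ((cmod t)\<^sup>2 * ?J) = (cmod t)\<^sup>2 * (real n * ?J)" by simp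
  also have "\<dots> \<le> (cmod t)\<^sup>2 * integral {0..real n} (\<lambda>x. (grow E x)\<^sup>2)"
    by (intro mult_left_mono integral_cell_lower_bound[OF grow_decay_continuous(1) grow_decay_shift(1)[OF E] multiplier(3)[OF E]]) auto
  finally show False using n bound[of n] by linarith
qed

lemma decaying_square_integrable:
  assumes E: "1 < \<bar>disc E\<bar>" and Z: "Z = rho E / ms E"
  obtains C where "\<And>n::nat. integral {0..real n} (\<lambda>x. (cu E x + Z * su E x)\<^sup>2) \<le> C"
proof -
  have "(\<lambda>x. (cu E x + Z * su E x)\<^sup>2) = (\<lambda>x. (1 / ms E)\<^sup>2 * (decay E x)\<^sup>2)"
    using ms_nonzero[OF E] by (auto simp: decay_def Z field_simps power_mult_distrib[symmetric])
  note eq = this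
  have "integral {0..real n} (\<lambda>x. (cu E x + Z * su E x)\<^sup>2) \<le>
     (1 / ms E)\<^sup>2 * (integral {0..1} (\<lambda>x. (decay E x)\<^sup>2) / (1 - (disc E + rho E)\<^sup>2))" for n
    unfolding eq integral_mult_right
    by (intro mult_left_mono integral_cell_upper_bound[OF grow_decay_continuous(2)
          grow_decay_shift(2)[OF E] multiplier(2)[OF E]]) auto
  then show ?thesis by (rule that)
qed

text \<open>Splits the flux-to-value ratio of the decaying solution into its square, which is free
  of square roots and monotone across the gap, and its sign, which is opposite to that of D
  s.\<close>

lemma decay_rate_sign:
  assumes "1 < \<bar>disc E\<bar>"
  shows "(rho E / ms E)\<^sup>2 = mb E / ms E"
    "disc E * ms E < 0 \<Longrightarrow> 0 < rho E / ms E" "0 < disc E * ms E \<Longrightarrow> rho E / ms E < 0"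
proof -
  define r where "r = sqrt (mb E * ms E)"
  have s: "0 < r" using mb_ms_pos_iff[of E] assms by (simp add: r_def)
  have rho: "rho E = - sgn (disc E) * r" by (simp add: rho_def r_def)
  show "(rho E / ms E)\<^sup>2 = mb E / ms E"
    using rho_sq[OF assms] ms_nonzero[OF assms] by (simp add: power_divide power2_eq_square)
  show "0 < rho E / ms E" if "disc E * ms E < 0"
    using that s by (auto simp: rho mult_less_0_iff zero_less_divide_iff sgn_if divide_pos_neg)
  show "rho E / ms E < 0" if "0 < disc E * ms E"
    using that s by (auto simp: rho zero_less_mult_iff divide_less_0_iff sgn_if divide_pos_neg)
qed

end

section \<open>Interface modes\<close>

locale interface =
  left: sl_coeffs eps1 mu1 + right: sl_coeffs eps2 mu2
  for eps1 mu1 eps2 mu2 :: "real \<Rightarrow> real"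
begin

lemma regular_glue: "regular_on a b (glue eps1 eps2)" "regular_on a b (glue mu1 mu2)"
  by (intro regular_on_glue left.pc_eps left.pc_mu right.pc_eps right.pc_mu)+

lemma interface_mode_imp:
  assumes mode: "interface_mode eps1 mu1 eps2 mu2 E \<psi>"
    and E: "1 < \<bar>left.disc E\<bar>" "1 < \<bar>right.disc E\<bar>"
  shows "left.rho E / left.ms E + right.rho E / right.ms E = 0"
proof -
  from mode obtain q where nz: "\<exists>x. \<psi> x \<noteq> 0" and int: "(\<lambda>x. (cmod (\<psi> x))\<^sup>2) integrable_on UNIV"
    and sl: "\<And>a b. sl_solution (glue eps1 eps2) (glue mu1 mu2) E a b \<psi> q"
    unfolding interface_mode_def by blast
  have cs: "csol (glue eps1 eps2) (glue mu1 mu2) E a b \<psi> q" for a b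
    by (rule csol_if_sl_solution[OF sl regular_glue])
  have R: "csol eps2 mu2 E 0 b \<psi> q" for b
    by (rule csol_cong[OF cs[of 0 b]]) (auto simp: glue_def)
  have L: "csol eps1 mu1 E 0 b (\<lambda>x. \<psi> (- x)) (\<lambda>x. - q (- x))" for b
    using csol_reflect[OF cs[of "- b" 0], of 0 eps1 mu1]
    by (simp add: glue_def left.eps_even left.mu_even)
  have \<psi>R: "\<psi> x = \<psi> 0 * of_real (right.cu E x) + q 0 * of_real (right.su E x)" if "0 \<le> x" for x
    using right.csol_complex_representation(1)[OF R[of x], of x] that by simp
  have \<psi>L: "\<psi> (- x) = \<psi> 0 * of_real (left.cu E x) + (- q 0) * of_real (left.su E x)" if "0 \<le> x" for x
    using left.csol_complex_representation(1)[OF L[of x], of x] that by simp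
  define C where "C = integral UNIV (\<lambda>x. (cmod (\<psi> x))\<^sup>2)"
  have sub: "integral {a..b} (\<lambda>x. (cmod (\<psi> x))\<^sup>2) \<le> C" for a b
    unfolding C_def by (rule integral_subset_le)
      (auto intro: integrable_on_subinterval[OF int] int)
  have 1: "\<psi> 0 * of_real (right.rho E) = q 0 * of_real (right.ms E)"
    by (rule right.square_integrable_imp_decaying[OF E(2) \<psi>R sub])
  have "integral {0..real n} (\<lambda>x. (cmod (\<psi> (- x)))\<^sup>2) \<le> C" for n
    using Henstock_Kurzweil_Integration.integral_reflect_real[of "real n" 0 "\<lambda>x. (cmod (\<psi> (- x)))\<^sup>2"] sub[of "- real n" 0] by simp
  then have 2: "\<psi> 0 * of_real (left.rho E) = - q 0 * of_real (left.ms E)"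
    by (intro left.square_integrable_imp_decaying[OF E(1), of "\<lambda>x. \<psi> (- x)"] \<psi>L)
  have ms: "left.ms E \<noteq> 0" "right.ms E \<noteq> 0" using left.ms_nonzero right.ms_nonzero E by auto
  \<comment> \<open>Decay ties the flux at 0 to the value at 0 with nonzero factor s, so a mode
    vanishing at the interface would have zero data there and vanish on both half-lines.\<close>
  have "\<psi> 0 \<noteq> 0"
  proof
    assume "\<psi> 0 = 0"
    then have "q 0 = 0" using 1 ms by simp
    have "\<psi> x = 0" for x
      using \<psi>R[of x] \<psi>L[of "- x"] \<open>\<psi> 0 = 0\<close> \<open>q 0 = 0\<close> by (cases "0 \<le> x") auto
    with nz show False by blast
  qed
  have "\<psi> 0 * of_real (right.rho E / right.ms E) = q 0" "\<psi> 0 * of_real (left.rho E / left.ms E) = - q 0"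
    using 1 2 ms by (simp_all add: field_simps)
  then have "\<psi> 0 * of_real (left.rho E / left.ms E + right.rho E / right.ms E) = 0"
    by (simp only: of_real_add distrib_left) simp
  with \<open>\<psi> 0 \<noteq> 0\<close> show ?thesis by (metis mult_eq_0_iff of_real_eq_0_iff)
qed

lemma interface_mode_exists:
  assumes E: "1 < \<bar>left.disc E\<bar>" "1 < \<bar>right.disc E\<bar>"
    and Z: "left.rho E / left.ms E + right.rho E / right.ms E = 0"
  shows "\<exists>\<psi>. interface_mode eps1 mu1 eps2 mu2 E \<psi>"
proof -
  define Z where "Z = right.rho E / right.ms E"
  have ZL: "- Z = left.rho E / left.ms E" using Z by (simp add: Z_def)
  \<comment> \<open>Both decaying solutions are normalised to the value 1 at the interface. The left
    one has flux - Z in the reflected variable, and reflecting it back changes this to Z, so f and g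
    match at 0.\<close>
  define f where "f x = (if 0 \<le> x then right.cu E x + Z * right.su E x
       else left.cu E (- x) + (- Z) * left.su E (- x))" for x
  define g where "g x = (if 0 \<le> x then right.cq E x + Z * right.sq E x
       else - (left.cq E (- x) + (- Z) * left.sq E (- x)))" for x
  have R: "csol (glue eps1 eps2) (glue mu1 mu2) E 0 b f g" for b
    using right.csol_combination[of E b 1 Z] by (rule csol_cong) (auto simp: f_def g_def glue_def)
  have "csol (glue eps1 eps2) (glue mu1 mu2) E (0 - b) (0 - 0)
     (\<lambda>x. 1 * of_real (left.cu E (0 - x)) + (- Z) * of_real (left.su E (0 - x)))
     (\<lambda>x. - (1 * of_real (left.cq E (0 - x)) + (- Z) * of_real (left.sq E (0 - x))))" for b
    using left.csol_combination[of E b 1 "- Z"]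
    by (rule csol_reflect) (auto simp: glue_def left.eps_even left.mu_even)
  note H = this
  have "csol (glue eps1 eps2) (glue mu1 mu2) E (0 - b) (0 - 0) f g" for b
    by (rule csol_cong[OF H]) (auto simp: f_def g_def)
  then have L: "csol (glue eps1 eps2) (glue mu1 mu2) E (- b) 0 f g" for b by simp
  have cs: "csol (glue eps1 eps2) (glue mu1 mu2) E (- real n) (real n) f g" for n
    by (rule csol_join[OF L R]) auto
  have sl: "sl_solution (glue eps1 eps2) (glue mu1 mu2) E a b (\<lambda>x. of_real (f x)) (\<lambda>x. of_real (g x))" for a b
  proof -
    obtain n where n: "\<bar>a\<bar> + \<bar>b\<bar> \<le> real n" using real_arch_simple by blast
    have "csol (glue eps1 eps2) (glue mu1 mu2) E a b f g"
      by (rule csol_subinterval[OF cs[of n]]) (use n in auto)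
    then have "csol (glue eps1 eps2) (glue mu1 mu2) E a b (\<lambda>x. of_real (f x)) (\<lambda>x. complex_of_real (g x))"
      by (rule csol_linear_image) (rule bounded_linear_of_real)
    then show ?thesis by (rule sl_solution_if_csol) (rule regular_glue)+
  qed
  obtain C1 where C1: "\<And>n::nat. integral {0..real n} (\<lambda>x. (left.cu E x + (- Z) * left.su E x)\<^sup>2) \<le> C1"
    using left.decaying_square_integrable[OF E(1) ZL] by metis
  obtain C2 where C2: "\<And>n::nat. integral {0..real n} (\<lambda>x. (right.cu E x + Z * right.su E x)\<^sup>2) \<le> C2"
    using right.decaying_square_integrable[OF E(2) Z_def] by metis
  have fi: "(\<lambda>x. (f x)\<^sup>2) integrable_on {- real n..real n}" for n
    using cs[of n] by (intro integrable_continuous_real continuous_intros) (auto simp: csol_def)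
  have "(\<lambda>x. (f x)\<^sup>2) integrable_on UNIV"
  proof (rule integrable_on_UNIV_if_bounded[OF fi])
    fix n :: nat
    have "integral {- real n..real n} (\<lambda>x. (f x)\<^sup>2) =
       integral {- real n..0} (\<lambda>x. (f x)\<^sup>2) + integral {0..real n} (\<lambda>x. (f x)\<^sup>2)"
      by (rule Henstock_Kurzweil_Integration.integral_combine[symmetric]) (auto intro: fi)
    moreover have "integral {- real n..0} (\<lambda>x. (f x)\<^sup>2) = integral {0..real n} (\<lambda>x. (left.cu E x + (- Z) * left.su E x)\<^sup>2)"
    proof -
      have "integral {- real n..- 0} (\<lambda>x. (f x)\<^sup>2) = integral {0..real n} (\<lambda>x. (f (- x))\<^sup>2)"
        using Henstock_Kurzweil_Integration.integral_reflect_real[of "real n" 0 "\<lambda>x. (f (- x))\<^sup>2"] by simp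
      also have "\<dots> = integral {0..real n} (\<lambda>x. (left.cu E x + (- Z) * left.su E x)\<^sup>2)"
        by (rule integral_cong) (auto simp: f_def)
      finally show ?thesis by simp
    qed
    moreover have "integral {0..real n} (\<lambda>x. (f x)\<^sup>2) = integral {0..real n} (\<lambda>x. (right.cu E x + Z * right.su E x)\<^sup>2)"
      by (rule integral_cong) (auto simp: f_def)
    ultimately show "integral {- real n..real n} (\<lambda>x. (f x)\<^sup>2) \<le> C1 + C2"
      using C1[of n] C2[of n] by simp
  qed simp
  then have "(\<lambda>x. (cmod (of_real (f x)))\<^sup>2) integrable_on UNIV" by simp
  moreover have "complex_of_real (f 0) \<noteq> 0" by (simp add: f_def)
  ultimately have "interface_mode eps1 mu1 eps2 mu2 E (\<lambda>x. of_real (f x))"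
    unfolding interface_mode_def using sl by (intro conjI exI[of _ 0] exI[of _ "\<lambda>x. of_real (g x)"]) auto
  then show ?thesis by blast
qed

text \<open>The two decay ratios have opposite signs by the hypothesis on D s, so their sum vanishes
  exactly if their squares agree; this removes the square roots from the matching condition.\<close>

lemma interface_mode_iff:
  assumes "1 < \<bar>left.disc E\<bar>" "1 < \<bar>right.disc E\<bar>"
    and opp: "(left.disc E * left.ms E) * (right.disc E * right.ms E) < 0"
  shows "(\<exists>\<psi>. interface_mode eps1 mu1 eps2 mu2 E \<psi>) \<longleftrightarrow>
     left.mb E / left.ms E = right.mb E / right.ms E"
proof -
  define x y where "x = left.rho E / left.ms E" and "y = right.rho E / right.ms E"
  have xy: "x < 0 \<and> 0 < y \<or> 0 < x \<and> y < 0"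
    using opp left.decay_rate_sign(2,3)[OF assms(1)] right.decay_rate_sign(2,3)[OF assms(2)]
    unfolding x_def y_def mult_less_0_iff by blast
  have "(\<exists>\<psi>. interface_mode eps1 mu1 eps2 mu2 E \<psi>) \<longleftrightarrow> x + y = 0"
    unfolding x_def y_def using interface_mode_imp interface_mode_exists assms(1,2) by blast
  also have "\<dots> \<longleftrightarrow> x\<^sup>2 = y\<^sup>2" using xy by (auto simp: power2_eq_iff)
  also have "\<dots> \<longleftrightarrow> left.mb E / left.ms E = right.mb E / right.ms E"
    unfolding x_def y_def left.decay_rate_sign(1)[OF assms(1)] right.decay_rate_sign(1)[OF assms(2)] ..
  finally show ?thesis .
qed

end

section \<open>Crossing of the squared decay ratios of two media of different parity\<close>

text \<open>Existence uses the cross-multiplied form of the equation, which stays finite at the gap edges.\<close>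

lemma unique_crossing:
  fixes eps1 mu1 eps2 mu2 :: "real \<Rightarrow> real"
  assumes g1: "spectral_gap eps1 mu1 a1 b1" and g2: "spectral_gap eps2 mu2 a2 b2"
    and even: "sl_coeffs.mb eps1 mu1 a1 = 0" and odd: "sl_coeffs.ms eps2 mu2 a2 = 0"
    and ne: "{a1<..<b1} \<inter> {a2<..<b2} \<noteq> {}"
  shows "\<exists>!E. E \<in> {a1<..<b1} \<inter> {a2<..<b2} \<and>
    sl_coeffs.mb eps1 mu1 E / sl_coeffs.ms eps1 mu1 E = sl_coeffs.mb eps2 mu2 E / sl_coeffs.ms eps2 mu2 E"
proof -
  interpret L: spectral_gap eps1 mu1 a1 b1 by (rule g1)
  interpret R: spectral_gap eps2 mu2 a2 b2 by (rule g2)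
  note ev = L.even_gap[OF even] and od = R.odd_gap[OF odd]
  define A B where "A = max a1 a2" and "B = min b1 b2"
  have I: "{a1<..<b1} \<inter> {a2<..<b2} = {A<..<B}" by (auto simp: A_def B_def)
  have AB: "A < B" using ne unfolding I by auto
  have nzL: "L.mb E \<noteq> 0" "L.ms E \<noteq> 0" if "E \<in> {a1<..<b1}" for E using L.mb_ms_pos[OF that] by auto
  have nzR: "R.mb E \<noteq> 0" "R.ms E \<noteq> 0" if "E \<in> {a2<..<b2}" for E using R.mb_ms_pos[OF that] by auto
  have ratio: "0 < L.mb E / L.ms E" "0 < R.mb E / R.ms E" if "E \<in> {A<..<B}" for E
    using L.mb_ms_pos[of E] R.mb_ms_pos[of E] that
    by (auto simp: A_def B_def zero_less_divide_iff zero_less_mult_iff)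
  \<comment> \<open>Absolute values are taken because s may have different signs in the two media;
    inside the common gap both ratios are positive, so a zero of \<open>?G\<close> is an equality of
    ratios.\<close>
  let ?G = "\<lambda>E. \<bar>L.mb E * R.ms E\<bar> - \<bar>R.mb E * L.ms E\<bar>"
  \<comment> \<open>The larger of the two lower edges belongs to one of the media. Its vanishing
    entry, b for the even or s for the odd one, annihilates the positive term of \<open>?G\<close>,
    and the other term is nonzero there. At B the vanishing entries are exchanged, which reverses
    the sign.\<close>
  have GA: "?G A < 0"
  proof (cases "a2 \<le> a1")
    case True
    then have A: "A = a1" by (simp add: A_def)
    have "R.mb a1 \<noteq> 0" using od(2) nzR[of a1] True AB A by (cases "a1 = a2") (auto simp: B_def)
    then show ?thesis using ev(2) even by (simp add: A)
  next
    case False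
    then have A: "A = a2" by (simp add: A_def)
    have "L.ms a2 \<noteq> 0" using nzL[of a2] False AB A by (auto simp: B_def)
    then show ?thesis using od(2) odd by (simp add: A)
  qed
  have GB: "0 < ?G B"
  proof (cases "b1 \<le> b2")
    case True
    then have B: "B = b1" by (simp add: B_def)
    have "R.ms b1 \<noteq> 0" using od(4) nzR[of b1] True AB B by (cases "b1 = b2") (auto simp: A_def)
    then show ?thesis using ev(3,4) by (simp add: B)
  next
    case False
    then have B: "B = b2" by (simp add: B_def)
    have "L.mb b2 \<noteq> 0" using nzL[of b2] False AB B by (auto simp: A_def)
    then show ?thesis using od(3,4) by (simp add: B)
  qed
  have Gc: "\<forall>E. A \<le> E \<and> E \<le> B \<longrightarrow> isCont ?G E"
    by (intro allI impI continuous_intros L.monodromy_isCont R.monodromy_isCont)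
  obtain E where E: "A \<le> E" "E \<le> B" "?G E = 0"
    using IVT[OF less_imp_le[OF GA] less_imp_le[OF GB] less_imp_le[OF AB] Gc] by blast
  have EI: "E \<in> {A<..<B}" using E GA GB by (cases "E = A"; cases "E = B") auto
  have eq: "L.mb E / L.ms E = R.mb E / R.ms E"
  proof -
    have nz: "L.ms E \<noteq> 0" "R.ms E \<noteq> 0" using nzL[of E] nzR[of E] EI by (auto simp: A_def B_def)
    have "\<bar>L.mb E\<bar> * \<bar>R.ms E\<bar> = \<bar>R.mb E\<bar> * \<bar>L.ms E\<bar>" using E(3) by (simp add: abs_mult)
    then have "\<bar>L.mb E\<bar> / \<bar>L.ms E\<bar> = \<bar>R.mb E\<bar> / \<bar>R.ms E\<bar>" using nz by (simp add: frac_eq_eq)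
    then have "\<bar>L.mb E / L.ms E\<bar> = \<bar>R.mb E / R.ms E\<bar>" by (simp only: abs_divide)
    then show ?thesis using ratio[OF EI] by linarith
  qed
  have no: False if xy: "x \<in> {A<..<B}" "y \<in> {A<..<B}" "x < y" "L.mb x / L.ms x = R.mb x / R.ms x"
    "L.mb y / L.ms y = R.mb y / R.ms y" for x y
  proof -
    have 1: "L.mb x / L.ms x < L.mb y / L.ms y" using xy by (intro ev(5)) (auto simp: A_def B_def)
    have "R.ms x / R.mb x < R.ms y / R.mb y" using xy by (intro od(5)) (auto simp: A_def B_def)
    then have "inverse (R.mb x / R.ms x) < inverse (R.mb y / R.ms y)" by simp
    then have "R.mb y / R.ms y < R.mb x / R.ms x" using ratio(2)[OF xy(1)] ratio(2)[OF xy(2)]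
      by (meson inverse_less_imp_less)
    with 1 xy(4,5) show False by simp
  qed
  show ?thesis unfolding I
  proof (rule ex1I[of _ E])
    show "E \<in> {A<..<B} \<and> L.mb E / L.ms E = R.mb E / R.ms E" using EI eq by blast
    show "y = E" if "y \<in> {A<..<B} \<and> L.mb y / L.ms y = R.mb y / R.ms y" for y
      using no[of y E] no[of E y] that EI eq by (metis linorder_neqE_linordered_idom)
  qed
qed

theorem mainTheorem4:
  fixes eps1 mu1 eps2 mu2 :: "real \<Rightarrow> real" and m1 m2 :: nat
  assumes reg1: "piecewise_cont eps1" "piecewise_cont mu1"
      and reg2: "piecewise_cont eps2" "piecewise_cont mu2"
      and pos: "\<forall>x. 0 < eps1 x \<and> 0 < mu1 x \<and> 0 < eps2 x \<and> 0 < mu2 x"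
      and per: "\<forall>x. eps1 (x + 1) = eps1 x \<and> mu1 (x + 1) = mu1 x \<and>
                    eps2 (x + 1) = eps2 x \<and> mu2 (x + 1) = mu2 x"
      and even: "\<forall>x. eps1 (- x) = eps1 x \<and> mu1 (- x) = mu1 x \<and>
                     eps2 (- x) = eps2 x \<and> mu2 (- x) = mu2 x"
      and m_pos: "1 \<le> m1" "1 \<le> m2"
      and gap1: "band_max eps1 mu1 m1 < band_min eps1 mu1 (m1 + 1)"
      and gap2: "band_max eps2 mu2 m2 < band_min eps2 mu2 (m2 + 1)"
      and I_ne: "{band_max eps1 mu1 m1 <..< band_min eps1 mu1 (m1 + 1)} \<inter>
                 {band_max eps2 mu2 m2 <..< band_min eps2 mu2 (m2 + 1)} \<noteq> {}"
      and idx: "bulk_index eps1 mu1 m1 \<noteq> bulk_index eps2 mu2 m2"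
  shows "\<exists>!E. E \<in> {band_max eps1 mu1 m1 <..< band_min eps1 mu1 (m1 + 1)} \<inter>
                 {band_max eps2 mu2 m2 <..< band_min eps2 mu2 (m2 + 1)} \<and>
              (\<exists>\<psi>. interface_mode eps1 mu1 eps2 mu2 E \<psi>)"
proof -
  interpret interface eps1 mu1 eps2 mu2
    using reg1 reg2 pos per even by unfold_locales auto
  define a1 b1 a2 b2 where ab: "a1 = band_max eps1 mu1 m1" "b1 = band_min eps1 mu1 (m1 + 1)"
    "a2 = band_max eps2 mu2 m2" "b2 = band_min eps2 mu2 (m2 + 1)"
  have g1: "spectral_gap eps1 mu1 a1 b1" unfolding ab by (rule left.spectral_gapI[OF m_pos(1) gap1])
  have g2: "spectral_gap eps2 mu2 a2 b2" unfolding ab by (rule right.spectral_gapI[OF m_pos(2) gap2])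
  interpret L: spectral_gap eps1 mu1 a1 b1 by (rule g1)
  interpret R: spectral_gap eps2 mu2 a2 b2 by (rule g2)
  let ?I = "{a1<..<b1} \<inter> {a2<..<b2}"
  have ne: "?I \<noteq> {}" using I_ne unfolding ab .
  \<comment> \<open>With only two possible values, different indices mean that exactly one of them
    is 1, so exactly one medium has b = 0 at its lower edge; simplicity of the edge gives s = 0 for
    the other.\<close>
  have range: "bulk_index eps mu m \<in> {1, - 1}" for eps mu m unfolding bulk_index_def by simp
  have "left.mb a1 = 0 \<and> right.ms a2 = 0 \<or> left.ms a1 = 0 \<and> right.mb a2 = 0"
    using range[of eps1 mu1 m1] range[of eps2 mu2 m2] idx L.edge_a_simple R.edge_a_simple
      left.bulk_index_iff[OF m_pos(1) gap1] right.bulk_index_iff[OF m_pos(2) gap2]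
    unfolding ab by auto
  then have "(\<exists>!E. E \<in> ?I \<and> left.mb E / left.ms E = right.mb E / right.ms E) \<and>
    (\<forall>E\<in>?I. (left.disc E * left.ms E) * (right.disc E * right.ms E) < 0)"
  proof
    assume z: "left.mb a1 = 0 \<and> right.ms a2 = 0"
    have "(left.disc E * left.ms E) * (right.disc E * right.ms E) < 0" if "E \<in> ?I" for E
      by (rule mult_neg_pos) (use L.even_gap(1)[of E] R.odd_gap(1)[of E] z that in auto)
    then show ?thesis using unique_crossing[OF g1 g2 _ _ ne] z by blast
  next
    assume z: "left.ms a1 = 0 \<and> right.mb a2 = 0"
    have "(left.disc E * left.ms E) * (right.disc E * right.ms E) < 0" if "E \<in> ?I" for E
      by (rule mult_pos_neg) (use L.odd_gap(1)[of E] R.even_gap(1)[of E] z that in auto)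
    \<comment> \<open>The equation for E is symmetric in the two media, so the even one may be taken
      first.\<close>
    moreover have "\<exists>!E. E \<in> {a2<..<b2} \<inter> {a1<..<b1} \<and> right.mb E / right.ms E = left.mb E / left.ms E"
      by (rule unique_crossing[OF g2 g1]) (use z ne in auto)
    then have "\<exists>!E. E \<in> ?I \<and> left.mb E / left.ms E = right.mb E / right.ms E"
      by (simp only: Int_commute eq_commute)
    ultimately show ?thesis by blast
  qed
  moreover have "(\<exists>\<psi>. interface_mode eps1 mu1 eps2 mu2 E \<psi>) \<longleftrightarrow>
      left.mb E / left.ms E = right.mb E / right.ms E"
    if "E \<in> ?I" "(left.disc E * left.ms E) * (right.disc E * right.ms E) < 0" for E
    using that by (intro interface_mode_iff L.gap R.gap) auto
  ultimately have "\<exists>!E. E \<in> ?I \<and> (\<exists>\<psi>. interface_mode eps1 mu1 eps2 mu2 E \<psi>)" by metis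
  then show ?thesis unfolding ab .
qed

end
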